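(* Let $E\subset [1,2]$ be nonempty with upper Minkowski dimension $\dim_M(E)=\beta$, and assume that the dimension $d$ satisfies $d>4+\beta$. If $s_1,s_2\geq 0$ satisfy $s_1+s_2<\frac{d-4-\beta}{2}$, then $$\|\mathcal{T}_E(f,g)\|_{L^2}\lesssim \|f\|_{H^{-s_1}}\|g\|_{H^{-s_2}}.$$
   Context: All functions are on $\mathbb{R}^d$. Operators are initially defined for $f,g\in C_0^\infty(\mathbb{R}^d)$, and $A\lesssim B$ means $A\le CB$ with $C$ independent of $f,g$. The Fourier transform is $\hat f(\xi)=\int f(x)e^{-2\pi i x\cdot\xi}\,dx$. Let $\mathcal{I}=\{(y,z)\in\mathbb{R}^{2d}: |y|=|z|=|y-z|=1\}$ (with $d\ge2$) and let $\mu$ be the natural normalized surface measure on the submanifold $\mathcal{I}$. The triangle averaging operator of radius $t>0$ and the associated single-scale maximal operator are $$\mathcal{T}_t(f,g)(x)=\int_{\mathcal{I}}f(x-ty)g(x-tz)\,d\mu(y,z),\qquad \mathcal{T}_E(f,g)(x)=\sup_{t\in E}|\mathcal{T}_t(f,g)(x)|.$$ Upper Minkowski dimension: $\dim_M(E)=\limsup_{\delta\to0}\frac{\log N(E,\delta)}{\log(1/\delta)}$, where $N(E,\delta)$ is the minimal number of closed intervals of length $\delta$ needed to cover $E$. For $s\ge0$, $\|f\|_{H^{-s}}=\|(1+|\xi|^2)^{-s/2}\hat f(\xi)\|_{L^2_\xi}$. *)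

theory Defs
  imports "HOL-Analysis.Analysis"
begin

section \<open>Test functions\<close>

primrec C_k :: "nat \<Rightarrow> ('a::euclidean_space \<Rightarrow> complex) \<Rightarrow> bool" where
  "C_k 0 f = continuous_on UNIV f"
| "C_k (Suc k) f =
     (f differentiable_on UNIV \<and> (\<forall>b\<in>Basis. C_k k (\<lambda>x. frechet_derivative f (at x) b)))"

definition test_function :: "('a::euclidean_space \<Rightarrow> complex) \<Rightarrow> bool" where
  "test_function f \<longleftrightarrow> (\<forall>k. C_k k f) \<and> compact (closure {x. f x \<noteq> 0})"


section \<open>Norms\<close>

text \<open>The \<open>L\<^sup>2\<close> norm of a nonnegative extended function, with values in \<open>[0, \<infinity>]\<close>; there is no square
  root on \<^typ>\<open>ennreal\<close>, so the infinite case is treated explicitly.\<close>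

definition L2_norm :: "('a::euclidean_space \<Rightarrow> ennreal) \<Rightarrow> ennreal" where
  "L2_norm h = (let I = (\<integral>\<^sup>+ x. (h x)\<^sup>2 \<partial>lborel)
                in if I = \<infinity> then \<infinity> else ennreal (sqrt (enn2real I)))"

definition fourier :: "('a::euclidean_space \<Rightarrow> complex) \<Rightarrow> 'a \<Rightarrow> complex" where
  "fourier f \<xi> = (LINT x|lborel. f x * exp (- 2 * pi * \<i> * complex_of_real (x \<bullet> \<xi>)))"

definition sobolev_norm :: "real \<Rightarrow> ('a::euclidean_space \<Rightarrow> complex) \<Rightarrow> ennreal" where
  "sobolev_norm r f =
     L2_norm (\<lambda>\<xi>. ennreal (cmod (complex_of_real ((1 + (norm \<xi>)\<^sup>2) powr (r / 2)) * fourier f \<xi>)))"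


section \<open>Hausdorff measure\<close>

text \<open>On an \<open>m\<close>-dimensional embedded submanifold of Euclidean space, the Riemannian surface measure
  is, up to a constant factor, the restriction of the \<open>m\<close>-dimensional Hausdorff measure.
  Covering sets are required to be bounded because \<^const>\<open>diameter\<close> is real-valued and carries no
  information for unbounded sets. The empty set costs nothing, also when \<open>m = 0\<close>.\<close>

definition hausdorff_pre :: "nat \<Rightarrow> real \<Rightarrow> 'a::metric_space set \<Rightarrow> ennreal" where
  "hausdorff_pre m \<delta> A =
     (INF U \<in> {U :: nat \<Rightarrow> 'a set. A \<subseteq> (\<Union>i. U i) \<and> (\<forall>i. bounded (U i) \<and> diameter (U i) \<le> \<delta>)}.
        \<Sum>i. if U i = {} then 0 else ennreal (diameter (U i) ^ m))"

definition hausdorff_outer :: "nat \<Rightarrow> 'a::metric_space set \<Rightarrow> ennreal" where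
  "hausdorff_outer m A = (SUP \<delta> \<in> {0<..}. hausdorff_pre m \<delta> A)"

definition hausdorff_measure :: "nat \<Rightarrow> 'a::metric_space measure" where
  "hausdorff_measure m = measure_of UNIV (sets borel) (hausdorff_outer m)"


section \<open>Triangle averages\<close>

definition triangle_set :: "('a::euclidean_space \<times> 'a) set" where
  "triangle_set = {(y, z). norm y = 1 \<and> norm z = 1 \<and> norm (y - z) = 1}"

text \<open>The set is a submanifold of codimension \<open>3\<close> of the \<open>2d\<close>-dimensional product space, whose
  product metric is the Euclidean one; the surface measure is normalized to total mass \<open>1\<close>.\<close>

definition triangle_measure :: "('a::euclidean_space \<times> 'a) measure" where
  "triangle_measure = uniform_measure (hausdorff_measure (2 * DIM('a) - 3)) triangle_set"

definition triangle_avg ::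
    "real \<Rightarrow> ('a::euclidean_space \<Rightarrow> complex) \<Rightarrow> ('a \<Rightarrow> complex) \<Rightarrow> 'a \<Rightarrow> complex" where
  "triangle_avg t f g x =
     (LINT (y, z)|triangle_measure. f (x - t *\<^sub>R y) * g (x - t *\<^sub>R z))"

definition triangle_max ::
    "real set \<Rightarrow> ('a::euclidean_space \<Rightarrow> complex) \<Rightarrow> ('a \<Rightarrow> complex) \<Rightarrow> 'a \<Rightarrow> ennreal" where
  "triangle_max E f g x = (SUP t\<in>E. ennreal (cmod (triangle_avg t f g x)))"


section \<open>Upper Minkowski dimension\<close>

definition covering_number :: "real set \<Rightarrow> real \<Rightarrow> nat" where
  "covering_number E \<delta> = (LEAST n. \<exists>a :: nat \<Rightarrow> real. E \<subseteq> (\<Union>i<n. {a i .. a i + \<delta>}))"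

definition upper_minkowski_dim :: "real set \<Rightarrow> ereal" where
  "upper_minkowski_dim E =
     Limsup (at_right 0) (\<lambda>\<delta>. ereal (ln (real (covering_number E \<delta>)) / ln (1 / \<delta>)))"

end

theory Submission
  imports Defs "HOL-Probability.Characteristic_Functions"
begin

text \<open>Of the dimension \<open>\<beta>\<close> only \<open>\<beta> \<ge> 0\<close> matters: the supremum is taken over all of \<open>[1, 2]\<close>, at the cost of
  one power of the frequency \<open>R\<close> in the squared estimate. Writing \<open>m\<close> for the Fourier transform of the triangle
  measure \<open>\<mu>\<close>, a Cauchy--Schwarz argument at fixed larger frequency \<open>\<xi>\<close>, \<open>|\<xi>| \<approx> R\<close>, reduces the estimate to
  \<open>\<integral>\<^bsub>1\<^esub>\<^bsup>2\<^esup> \<integral>\<^bsub>|\<eta>| \<le> |\<xi>|\<^esub> |m (t \<xi>, t \<eta>)|\<^sup>2 d\<eta> dt \<lesssim> R\<^bsup>3 - d\<^esup>\<close>. Since \<open>m\<close> is rotation invariant, the left-hand side is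
  controlled by its average over the directions of \<open>\<xi>\<close>, hence by \<open>R\<^bsup>- d\<^esup>\<close> times the square integral of \<open>m\<close> over a
  ball of radius comparable to \<open>R\<close> in \<open>\<real>\<^bsup>2d\<^esup>\<close>; and that is a Gaussian energy of \<open>\<mu>\<close>, at most a multiple of
  \<open>R\<^bsup>2d\<^esup> R\<^bsup>- (2d - 3)\<^esup> = R\<^sup>3\<close> because \<open>\<mu>\<close> satisfies a Frostman condition of dimension \<open>2d - 3\<close>. No pointwise decay of
  \<open>m\<close> is used. About the Hausdorff measure one only needs its invariance under isometries, not that it is
  positive and finite on the set of triangles; even if \<open>uniform_measure\<close> degenerates, \<open>\<mu>\<close> has mass at most \<open>1\<close>.\<close>

section \<open>Gaussians and their Fourier transforms\<close>

text \<open>Power counting behind the condition on the exponents: for |\<xi>| of size R the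
  multiplier contributes R^(3-d) to the squared estimate, and its derivative in t, larger by a
  factor R, contributes R^(5-d). A one-dimensional Sobolev inequality on intervals of length 1/R
  combines them into R * R^(3-d) + R^(-1) * R^(5-d), a multiple of R^(4-d). Passing from localised
  L2 norms to negative Sobolev norms costs R^(2 (s1 + s2)), so the dyadic sum converges when s1 + s2
  < (d-4)/2. Gaussians have three roles: as majorants of balls whose positive definiteness turns
  square integrals into energies, as product functions that separate the free coordinates of a
  triangle from the constrained ones, and as mollifiers for which Fourier inversion is an explicit
  computation. A supremum over an uncountable set of dilations has to be integrated. Every maximal
  bound is therefore carried by a measurable majorant that does not depend on t; such majorants can
  be added, summed, and passed through Fatou's lemma.\<close>

definition gaussian :: "real \<Rightarrow> 'a::real_normed_vector \<Rightarrow> real" where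
  "gaussian r x = exp (- pi * (r * norm x)\<^sup>2)"

lemma gaussian_measurable [measurable]: "gaussian r \<in> borel_measurable borel"
  unfolding gaussian_def[abs_def] by measurable

lemma gaussian_nonneg [simp]: "gaussian r x \<ge> 0"
  by (simp add: gaussian_def)

lemma gaussian_le_1: "gaussian r x \<le> 1"
  by (simp add: gaussian_def)

lemma gaussian_minus_commute: "gaussian r (x - y) = gaussian r (y - x)"
  by (simp add: gaussian_def norm_minus_commute)

lemma cis_measurable [measurable]: "cis \<in> borel_measurable borel"
  by (intro borel_measurable_continuous_onI continuous_intros)

lemma std_normal_fourier:
  "has_bochner_integral lborel (\<lambda>x. std_normal_density x *\<^sub>R cis (t * x)) (complex_of_real (exp (- (t\<^sup>2) / 2)))"
proof -
  have 1: "integrable lborel (\<lambda>x. std_normal_density x *\<^sub>R cis (t * x))"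
  proof (rule Bochner_Integration.integrable_bound)
    show "integrable lborel std_normal_density"
      by (rule integrable_normal_density) simp
  qed (auto simp: norm_mult)
  have "(LINT x|lborel. std_normal_density x *\<^sub>R cis (t * x)) = char std_normal_distribution t"
    by (simp add: char_def integral_density cis_conv_exp)
  then show ?thesis
    using 1 by (simp add: has_bochner_integral_iff char_std_normal_distribution)
qed

lemma gaussian_fourier_real:
  fixes x :: real
  assumes "\<rho> > 0"
  shows "has_bochner_integral lborel (\<lambda>s. exp (- pi * (s / \<rho>)\<^sup>2) *\<^sub>R cis (2 * pi * (s * x)))
           (complex_of_real (\<rho> * exp (- pi * (\<rho> * x)\<^sup>2)))"
proof -
  \<comment> \<open>This scaling turns the exponent (c s)^2 / 2 of the standard normal density into
    pi (s / \<rho>)^2, so the known characteristic function gives the transform after an affine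
    substitution.\<close>
  define c where "c = sqrt (2 * pi) / \<rho>"
  have c: "c \<noteq> 0" "c > 0" using assms by (auto simp: c_def)
  define t where "t = 2 * pi * x / c"
  have tc: "t * (c * s) = 2 * pi * (s * x)" for s
    using c by (simp add: t_def)
  have c2: "(c * s)\<^sup>2 / 2 = pi * (s / \<rho>)\<^sup>2" for s
    by (simp add: c_def power_mult_distrib power_divide)
  have t2: "t\<^sup>2 / 2 = pi * (\<rho> * x)\<^sup>2"
    using assms by (simp add: t_def c_def power_mult_distrib power_divide field_simps power2_eq_square)
  have "has_bochner_integral lborel (\<lambda>s. std_normal_density (0 + c * s) *\<^sub>R cis (t * (0 + c * s)))
      (complex_of_real (exp (- (t\<^sup>2) / 2)) /\<^sub>R \<bar>c\<bar>)"
    using std_normal_fourier[of t] lborel_has_bochner_integral_real_affine_iff[OF c(1),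
      of "\<lambda>x. std_normal_density x *\<^sub>R cis (t * x)" _ 0] by blast
  then have "has_bochner_integral lborel (\<lambda>s. sqrt (2*pi) *\<^sub>R (std_normal_density (c * s) *\<^sub>R cis (t * (c * s))))
      (sqrt (2*pi) *\<^sub>R (complex_of_real (exp (- (t\<^sup>2) / 2)) /\<^sub>R c))"
    using c by (intro has_bochner_integral_scaleR_right) simp
  moreover have "sqrt (2*pi) *\<^sub>R (std_normal_density (c * s) *\<^sub>R cis (t * (c * s))) =
      exp (- pi * (s / \<rho>)\<^sup>2) *\<^sub>R cis (2 * pi * (s * x))" for s
    using c2[of s] unfolding tc by (simp add: normal_density_def field_simps)
  moreover have "sqrt (2*pi) *\<^sub>R (complex_of_real (exp (- (t\<^sup>2) / 2)) /\<^sub>R c) =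
     complex_of_real (\<rho> * exp (- pi * (\<rho> * x)\<^sup>2))"
    using t2 assms by (simp add: c_def scaleR_conv_of_real)
  ultimately show ?thesis by simp
qed

text \<open>Lebesgue measure on \<open>'a\<close> is the image under \<open>T\<close> of a product
  of real Lebesgue measures indexed by \<open>Basis\<close>; in these coordinates the integrand is a
  product of functions of one variable each.\<close>

lemma lborel_integral_prod:
  fixes f :: "'a::euclidean_space \<Rightarrow> real \<Rightarrow> complex"
  assumes "\<And>b. b \<in> Basis \<Longrightarrow> has_bochner_integral lborel (f b) (I b)"
  shows "has_bochner_integral lborel (\<lambda>x::'a. \<Prod>b\<in>Basis. f b (x \<bullet> b)) (\<Prod>b\<in>Basis. I b)"
proof -
  interpret product_sigma_finite "\<lambda>_::'a. lborel::real measure" ..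
  define T :: "('a \<Rightarrow> real) \<Rightarrow> 'a" where "T = (\<lambda>g. \<Sum>b\<in>Basis. g b *\<^sub>R b)"
  have T[measurable]: "T \<in> measurable (\<Pi>\<^sub>M b\<in>Basis. lborel) borel"
    unfolding T_def by measurable
  have eq: "lborel = distr (\<Pi>\<^sub>M b\<in>Basis. lborel) borel T"
    unfolding T_def by (rule lborel_eq)
  have int: "integrable lborel (f b)" and val: "integral\<^sup>L lborel (f b) = I b" if "b \<in> Basis" for b
    using assms[OF that] by (auto simp: has_bochner_integral_iff)
  have meas: "f b \<in> borel_measurable borel" if "b \<in> Basis" for b
    using int[OF that] by simp
  have m: "(\<lambda>x::'a. \<Prod>b\<in>Basis. f b (x \<bullet> b)) \<in> borel_measurable borel"
  proof (rule borel_measurable_prod)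
    fix b :: 'a assume "b \<in> Basis"
    then have [measurable]: "f b \<in> borel_measurable borel" by (rule meas)
    show "(\<lambda>x. f b (x \<bullet> b)) \<in> borel_measurable borel" by measurable
  qed
  have Tb: "T g \<bullet> b = g b" if "b \<in> Basis" for g b
    using that by (simp add: T_def)
  have prodeq: "(\<Prod>b\<in>Basis. f b (T g \<bullet> b)) = (\<Prod>b\<in>Basis. f b (g b))" for g
    by (intro prod.cong refl) (simp add: Tb)
  have "integrable (\<Pi>\<^sub>M b\<in>Basis. lborel) (\<lambda>g. \<Prod>b\<in>Basis. f b (g b))"
    by (intro product_integrable_prod) (auto simp: int)
  then have 1: "integrable lborel (\<lambda>x::'a. \<Prod>b\<in>Basis. f b (x \<bullet> b))"
    unfolding eq by (subst integrable_distr_eq[OF T m]) (simp add: prodeq)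
  have "(LINT x|lborel. (\<Prod>b\<in>Basis. f b ((x::'a) \<bullet> b))) = (\<integral>g. (\<Prod>b\<in>Basis. f b (g b)) \<partial>(\<Pi>\<^sub>M b\<in>(Basis::'a set). lborel))"
    unfolding eq by (subst integral_distr[OF T m]) (simp add: prodeq)
  also have "\<dots> = (\<Prod>b\<in>Basis. I b)"
    by (subst product_integral_prod) (auto simp: int val)
  finally show ?thesis using 1 by (simp add: has_bochner_integral_iff)
qed

lemma cis_sum: "cis (\<Sum>i\<in>A. f i) = (\<Prod>i\<in>A. cis (f i))"
  by (induction A rule: infinite_finite_induct) (auto simp flip: cis_mult)

lemma gaussian_eq_prod:
  fixes x :: "'a::euclidean_space"
  shows "gaussian r x = (\<Prod>b\<in>Basis. exp (- pi * (r * (x \<bullet> b))\<^sup>2))"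
proof -
  have "(r * norm x)\<^sup>2 = (\<Sum>b\<in>Basis. (r * (x \<bullet> b))\<^sup>2)"
    unfolding power_mult_distrib power2_norm_eq_inner euclidean_inner[of x x]
    by (simp add: sum_distrib_left power2_eq_square)
  then show ?thesis
    by (simp add: gaussian_def sum_distrib_left exp_sum flip: sum_negf)
qed

text \<open>Both the Gaussian and the character split into factors over \<open>Basis\<close>, which
  reduces everything to one real variable. The factor pi in \<open>gaussian\<close> matches the 2 pi
  in the Fourier transform, so no constant besides the power of \<rho> appears.\<close>

lemma gaussian_fourier:
  fixes x :: "'a::euclidean_space"
  assumes "\<rho> > 0"
  shows "has_bochner_integral lborel (\<lambda>\<xi>::'a. gaussian (1 / \<rho>) \<xi> *\<^sub>R cis (2 * pi * (\<xi> \<bullet> x)))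
           (complex_of_real (\<rho> ^ DIM('a) * gaussian \<rho> x))"
proof -
  have "has_bochner_integral lborel
      (\<lambda>\<xi>::'a. \<Prod>b\<in>Basis. exp (- pi * ((\<xi> \<bullet> b) / \<rho>)\<^sup>2) *\<^sub>R cis (2 * pi * ((\<xi> \<bullet> b) * (x \<bullet> b))))
      (\<Prod>b\<in>(Basis::'a set). complex_of_real (\<rho> * exp (- pi * (\<rho> * (x \<bullet> b))\<^sup>2)))"
    by (intro lborel_integral_prod gaussian_fourier_real assms)
  moreover have "(\<Prod>b\<in>Basis. exp (- pi * ((\<xi> \<bullet> b) / \<rho>)\<^sup>2) *\<^sub>R cis (2 * pi * ((\<xi> \<bullet> b) * (x \<bullet> b)))) =
      gaussian (1 / \<rho>) \<xi> *\<^sub>R cis (2 * pi * (\<xi> \<bullet> x))" for \<xi> :: 'a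
    by (simp add: gaussian_eq_prod scaleR_conv_of_real prod.distrib flip: cis_sum)
       (simp add: euclidean_inner[of \<xi> x] sum_distrib_left)
  moreover have "(\<Prod>b\<in>(Basis::'a set). complex_of_real (\<rho> * exp (- pi * (\<rho> * (x \<bullet> b))\<^sup>2))) =
      complex_of_real (\<rho> ^ DIM('a) * gaussian \<rho> x)"
    by (simp add: gaussian_eq_prod prod.distrib)
  ultimately show ?thesis by simp
qed

lemma gaussian_integral:
  assumes "r > 0"
  shows "has_bochner_integral lborel (gaussian r :: 'a::euclidean_space \<Rightarrow> real) ((1 / r) ^ DIM('a))"
proof -
  have "has_bochner_integral lborel (\<lambda>\<xi>::'a. Re (gaussian r \<xi> *\<^sub>R cis (2 * pi * (\<xi> \<bullet> 0))))
           (Re (complex_of_real ((1 / r) ^ DIM('a) * gaussian (1 / r) (0::'a))))"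
    using gaussian_fourier[of "1/r" "0::'a"] assms by (intro has_bochner_integral_Re) simp
  then show ?thesis by (simp add: gaussian_def[abs_def])
qed

lemma nn_integral_gaussian:
  assumes "r > 0"
  shows "(\<integral>\<^sup>+ x. ennreal (gaussian r (x::'a::euclidean_space)) \<partial>lborel) = ennreal ((1 / r) ^ DIM('a))"
  using gaussian_integral[OF assms, where 'a='a] by (intro nn_integral_eq_integral[THEN trans])
    (auto simp: has_bochner_integral_iff)

section \<open>Gaussian energy and the Plancherel inequality\<close>

abbreviation csq :: "complex \<Rightarrow> ennreal" where
  "csq z \<equiv> ennreal ((cmod z)\<^sup>2)"

lemma borel_measurable_cnj [measurable (raw)]:
  "f \<in> borel_measurable M \<Longrightarrow> (\<lambda>x. cnj (f x)) \<in> borel_measurable M"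
  by (rule borel_measurable_continuous_on[where f=cnj]) (intro continuous_intros)

lemma nn_integral_lborel_affine:
  fixes f :: "'a::euclidean_space \<Rightarrow> ennreal"
  assumes [measurable]: "f \<in> borel_measurable borel" and "c \<noteq> 0"
  shows "(\<integral>\<^sup>+ x. f x \<partial>lborel) = ennreal (\<bar>c\<bar> ^ DIM('a)) * (\<integral>\<^sup>+ x. f (t + c *\<^sub>R x) \<partial>lborel)"
  by (subst lborel_affine[OF assms(2), of t])
     (simp add: nn_integral_density nn_integral_distr nn_integral_cmult)

lemma nn_integral_lborel_diff:
  fixes f :: "'a::euclidean_space \<Rightarrow> ennreal"
  assumes [measurable]: "f \<in> borel_measurable borel"
  shows "(\<integral>\<^sup>+ x. f (t - x) \<partial>lborel) = (\<integral>\<^sup>+ x. f x \<partial>lborel)"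
  using nn_integral_lborel_affine[OF assms, of "-1" t] by simp

lemma nn_integral_lborel_translate:
  fixes f :: "'a::euclidean_space \<Rightarrow> ennreal"
  assumes [measurable]: "f \<in> borel_measurable borel"
  shows "(\<integral>\<^sup>+ x. f (x + t) \<partial>lborel) = (\<integral>\<^sup>+ x. f x \<partial>lborel)"
  using nn_integral_lborel_affine[OF assms, of "1" t] by (simp add: add.commute)

lemma (in pair_sigma_finite) integrable_pair_mult:
  fixes f :: "'a \<Rightarrow> 'c::{real_normed_field, banach, second_countable_topology}"
  assumes f: "integrable M1 f" and g: "integrable M2 g"
  shows "integrable (M1 \<Otimes>\<^sub>M M2) (\<lambda>(x, y). f x * g y)"
proof (rule Fubini_integrable)
  have [measurable]: "f \<in> borel_measurable M1" "g \<in> borel_measurable M2" using assms by auto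
  show "(\<lambda>(x, y). f x * g y) \<in> borel_measurable (M1 \<Otimes>\<^sub>M M2)" by measurable
  show "integrable M1 (\<lambda>x. \<integral>y. norm (case (x, y) of (x, y) \<Rightarrow> f x * g y) \<partial>M2)"
    using f g by (simp add: norm_mult)
  show "AE x in M1. integrable M2 (\<lambda>y. case (x, y) of (x, y) \<Rightarrow> f x * g y)"
    using g by simp
qed

text \<open>Positive definiteness of the Gaussian turns a weighted \<open>L\<^sup>2\<close> bound for a Fourier transform
  into a Gaussian interaction energy.\<close>

lemma gaussian_energy:
  fixes a :: "'a::euclidean_space \<Rightarrow> complex"
  assumes sf: "sigma_finite_measure N" and N [measurable_cong]: "sets N = sets borel"
    and a: "integrable N a" and \<rho>: "\<rho> > 0"
  shows "(\<integral>\<^sup>+ x. ennreal (gaussian (1 / \<rho>) x * (cmod (LINT p|N. a p * cis (2 * pi * (x \<bullet> p))))\<^sup>2) \<partial>lborel)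
    \<le> (\<integral>\<^sup>+ p. \<integral>\<^sup>+ p'. ennreal (cmod (a p) * cmod (a p') * (\<rho> ^ DIM('a) * gaussian \<rho> (p - p'))) \<partial>N \<partial>N)"
proof -
  interpret N: sigma_finite_measure N by fact
  interpret NN: pair_sigma_finite N N ..
  interpret L: pair_sigma_finite "lborel :: 'a measure" "N \<Otimes>\<^sub>M N" ..
  have am [measurable]: "a \<in> borel_measurable N" using a by simp
  define A where "A x = (LINT p|N. a p * cis (2 * pi * (x \<bullet> p)))" for x
  have int1: "integrable N (\<lambda>p. a p * cis (2 * pi * (x \<bullet> p)))" for x
    by (rule Bochner_Integration.integrable_bound[OF a]) (auto simp: norm_mult)
  have [measurable]: "A \<in> borel_measurable borel"
    unfolding A_def by measurable
  \<comment> \<open>Integrand of a triple integral: the square of |A x| is expanded as A x times its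
    conjugate. Integrating the pair first returns the weighted square (\<open>inner\<close>);
    integrating x first produces the Gaussian kernel in p - p' (\<open>outer\<close>).\<close>
  define h where "h = (\<lambda>(x, p, p'). complex_of_real (gaussian (1 / \<rho>) x) *
      ((a p * cis (2 * pi * (x \<bullet> p))) * cnj (a p' * cis (2 * pi * (x \<bullet> p')))))"
  have hm [measurable]: "h \<in> borel_measurable (lborel \<Otimes>\<^sub>M (N \<Otimes>\<^sub>M N))"
    unfolding h_def by measurable
  have gi: "integrable lborel (gaussian (1 / \<rho>) :: 'a \<Rightarrow> real)"
    using gaussian_integral[of "1/\<rho>", where 'a='a] \<rho> by (auto simp: has_bochner_integral_iff)
  have hint: "integrable (lborel \<Otimes>\<^sub>M (N \<Otimes>\<^sub>M N)) h"
  proof (rule Bochner_Integration.integrable_bound[OF _ hm])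
    show "integrable ((lborel :: 'a measure) \<Otimes>\<^sub>M (N \<Otimes>\<^sub>M N)) (\<lambda>(x, pp). gaussian (1 / \<rho>) x *
        (case pp of (p, p') \<Rightarrow> cmod (a p) * cmod (a p')))"
      using L.integrable_pair_mult[OF gi NN.integrable_pair_mult[OF integrable_norm[OF a] integrable_norm[OF a]]] .
  qed (auto simp: h_def norm_mult)
  have inner: "(\<integral>pp. h (x, pp) \<partial>(N \<Otimes>\<^sub>M N)) = complex_of_real (gaussian (1 / \<rho>) x * (cmod (A x))\<^sup>2)" for x
  proof -
    have "(\<integral>pp. h (x, pp) \<partial>(N \<Otimes>\<^sub>M N)) = gaussian (1 / \<rho>) x *
        (\<integral>pp. (case pp of (p, p') \<Rightarrow> (a p * cis (2 * pi * (x \<bullet> p))) * cnj (a p' * cis (2 * pi * (x \<bullet> p')))) \<partial>(N \<Otimes>\<^sub>M N))"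
      unfolding h_def by (subst integral_mult_right_zero[symmetric])
        (intro Bochner_Integration.integral_cong refl, auto)
    also have "(\<integral>pp. (case pp of (p, p') \<Rightarrow> (a p * cis (2 * pi * (x \<bullet> p))) * cnj (a p' * cis (2 * pi * (x \<bullet> p')))) \<partial>(N \<Otimes>\<^sub>M N))
        = (\<integral>p. (\<integral>p'. (a p * cis (2 * pi * (x \<bullet> p))) * cnj (a p' * cis (2 * pi * (x \<bullet> p'))) \<partial>N) \<partial>N)"
      using NN.integrable_pair_mult[OF int1 integrable_cnj[OF int1], of x x]
      by (subst NN.integral_fst'[symmetric]) auto
    also have "\<dots> = A x * cnj (A x)"
      by (simp only: integral_mult_right_zero integral_mult_left_zero Bochner_Integration.integral_cnj A_def)
    finally show ?thesis by (simp add: complex_norm_square[symmetric])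
  qed
  have int2: "integrable lborel (\<lambda>x. complex_of_real (gaussian (1 / \<rho>) x * (cmod (A x))\<^sup>2))"
    using L.integrable_fst'[OF hint] by (simp only: inner)
  have int3: "integrable lborel (\<lambda>x. gaussian (1 / \<rho>) x * (cmod (A x))\<^sup>2)"
    using integrable_Re[OF int2] by simp
  have outer: "(\<integral>x. h (x, p, p') \<partial>lborel) = a p * cnj (a p') * (\<rho> ^ DIM('a) * gaussian \<rho> (p - p'))" for p p'
  proof -
    have "h (x, p, p') = a p * cnj (a p') * (gaussian (1 / \<rho>) x *\<^sub>R cis (2 * pi * (x \<bullet> (p - p'))))" for x
      by (simp add: h_def cis_cnj scaleR_conv_of_real cis_mult algebra_simps inner_diff_right)
    then have "(\<integral>x. h (x, p, p') \<partial>lborel) = a p * cnj (a p') * (\<integral>x. gaussian (1 / \<rho>) x *\<^sub>R cis (2 * pi * (x \<bullet> (p - p'))) \<partial>lborel)"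
      by (simp only: integral_mult_right_zero)
    then show ?thesis
      using has_bochner_integral_integral_eq[OF gaussian_fourier[OF \<rho>, of "p - p'"]] by (simp only:)
  qed
  have "complex_of_real (LINT x|lborel. gaussian (1 / \<rho>) x * (cmod (A x))\<^sup>2) = (\<integral>x. \<integral>pp. h (x, pp) \<partial>(N \<Otimes>\<^sub>M N) \<partial>lborel)"
    by (simp only: inner integral_complex_of_real)
  also have "\<dots> = (\<integral>pp. \<integral>x. h (x, pp) \<partial>lborel \<partial>(N \<Otimes>\<^sub>M N))"
    using L.Fubini_integral[of "\<lambda>x y. h (x, y)"] hint by simp
  finally have eq: "complex_of_real (LINT x|lborel. gaussian (1 / \<rho>) x * (cmod (A x))\<^sup>2) =
    (\<integral>pp. \<integral>x. h (x, pp) \<partial>lborel \<partial>(N \<Otimes>\<^sub>M N))" .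
  have "(\<integral>\<^sup>+ x. ennreal (gaussian (1 / \<rho>) x * (cmod (A x))\<^sup>2) \<partial>lborel) =
      ennreal (LINT x|lborel. gaussian (1 / \<rho>) x * (cmod (A x))\<^sup>2)"
    by (rule nn_integral_eq_integral[OF int3]) simp
  also have "\<dots> = ennreal (cmod (complex_of_real (LINT x|lborel. gaussian (1 / \<rho>) x * (cmod (A x))\<^sup>2)))"
    by (simp add: integral_nonneg_AE)
  also have "\<dots> \<le> (\<integral>\<^sup>+ pp. ennreal (cmod (\<integral>x. h (x, pp) \<partial>lborel)) \<partial>(N \<Otimes>\<^sub>M N))"
    unfolding eq by (rule integral_norm_bound_ennreal) (rule L.integrable_snd, simp add: hint)
  also have "\<dots> = (\<integral>\<^sup>+ p. \<integral>\<^sup>+ p'. ennreal (cmod (\<integral>x. h (x, p, p') \<partial>lborel)) \<partial>N \<partial>N)"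
    by (rule N.nn_integral_fst[symmetric]) measurable
  also have "\<dots> = (\<integral>\<^sup>+ p. \<integral>\<^sup>+ p'. ennreal (cmod (a p) * cmod (a p') * (\<rho> ^ DIM('a) * gaussian \<rho> (p - p'))) \<partial>N \<partial>N)"
    unfolding outer using \<rho> by (simp add: norm_mult norm_power)
  finally show ?thesis unfolding A_def .
qed

lemma nn_integral_gaussian_diff:
  fixes p :: "'a::euclidean_space"
  assumes "\<rho> > 0"
  shows "(\<integral>\<^sup>+ x. ennreal (\<rho> ^ DIM('a) * gaussian \<rho> (p - x)) \<partial>lborel) = 1"
proof -
  have "(\<integral>\<^sup>+ x. ennreal (\<rho> ^ DIM('a) * gaussian \<rho> (p - x)) \<partial>lborel) =
      (\<integral>\<^sup>+ x. ennreal (\<rho> ^ DIM('a)) * ennreal (gaussian \<rho> (x::'a)) \<partial>lborel)"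
    using assms by (subst nn_integral_lborel_diff) (auto simp: ennreal_mult)
  also have "\<dots> = ennreal (\<rho> ^ DIM('a)) * ennreal ((1 / \<rho>) ^ DIM('a))"
    by (subst nn_integral_cmult) (auto simp: nn_integral_gaussian assms)
  also have "\<dots> = 1"
    using assms by (simp add: power_one_over flip: ennreal_mult)
  finally show ?thesis .
qed

lemma gaussian_tendsto_1: "(\<lambda>n. gaussian (1 / real (Suc n)) x) \<longlonglongrightarrow> 1"
proof -
  have "(\<lambda>n. exp (- pi * (1 / real (Suc n) * norm x)\<^sup>2)) \<longlonglongrightarrow> exp (- pi * (0 * norm x)\<^sup>2)"
    by (intro tendsto_intros LIMSEQ_Suc[OF lim_1_over_n]) 
  then show ?thesis by (simp add: gaussian_def)
qed

text \<open>With a Gaussian weight the left-hand side is an interaction energy of H against a kernel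
  of mass 1 in either variable. Replacing |H p| |H p'| by half the sum of the squares bounds it
  uniformly in \<rho> by the right-hand side, and Fatou's lemma removes the weight as \<rho> tends
  to infinity.\<close>

lemma plancherel_le:
  fixes H :: "'a::euclidean_space \<Rightarrow> complex"
  assumes H: "integrable lborel H"
  shows "(\<integral>\<^sup>+ x. csq (LINT \<zeta>|lborel. H \<zeta> * cis (2 * pi * (x \<bullet> \<zeta>))) \<partial>lborel)
    \<le> (\<integral>\<^sup>+ \<zeta>. csq (H \<zeta>) \<partial>lborel)" (is "_ \<le> ?R")
proof -
  interpret sigma_finite_measure "lborel :: 'a measure" ..
  define A where "A x = (LINT \<zeta>|lborel. H \<zeta> * cis (2 * pi * (x \<bullet> \<zeta>)))" for x
  have Hm [measurable]: "H \<in> borel_measurable borel" using H by simp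
  have [measurable]: "A \<in> borel_measurable borel"
    unfolding A_def by measurable
  have bd: "(\<integral>\<^sup>+ x. ennreal (gaussian (1 / \<rho>) x * (cmod (A x))\<^sup>2) \<partial>lborel) \<le> ?R" if \<rho>: "\<rho> > 0" for \<rho> :: real
  proof -
    define k where "k p p' = \<rho> ^ DIM('a) * gaussian \<rho> (p - p')" for p p' :: 'a
    have k0: "k p p' \<ge> 0" for p p' using \<rho> by (simp add: k_def)
    have [measurable]: "(\<lambda>(p, p'). k p p') \<in> borel_measurable (borel \<Otimes>\<^sub>M borel)" unfolding k_def by measurable
    have k1: "(\<integral>\<^sup>+ p'. ennreal (k p p') \<partial>lborel) = 1" for p
      unfolding k_def by (rule nn_integral_gaussian_diff[OF \<rho>])
    have ks: "k p p' = k p' p" for p p' by (simp add: k_def gaussian_minus_commute)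
    have k1': "(\<integral>\<^sup>+ p. ennreal (k p p') \<partial>lborel) = 1" for p'
      using k1[of p'] by (simp add: ks[of p'])
    have J: "(\<integral>\<^sup>+ p. \<integral>\<^sup>+ p'. ennreal ((cmod (H p))\<^sup>2 / 2) * ennreal (k p p') \<partial>lborel \<partial>lborel) = (\<integral>\<^sup>+ p. ennreal ((cmod (H p))\<^sup>2 / 2) \<partial>lborel)"
      by (simp add: nn_integral_cmult k1)
    have J': "(\<integral>\<^sup>+ p. \<integral>\<^sup>+ p'. ennreal ((cmod (H p'))\<^sup>2 / 2) * ennreal (k p p') \<partial>lborel \<partial>lborel) = (\<integral>\<^sup>+ p. ennreal ((cmod (H p))\<^sup>2 / 2) \<partial>lborel)"
      by (subst lborel_pair.Fubini') (simp_all add: nn_integral_cmult k1')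
    have "(\<integral>\<^sup>+ x. ennreal (gaussian (1 / \<rho>) x * (cmod (A x))\<^sup>2) \<partial>lborel) \<le>
      (\<integral>\<^sup>+ p. \<integral>\<^sup>+ p'. ennreal (cmod (H p) * cmod (H p') * k p p') \<partial>lborel \<partial>lborel)"
      unfolding A_def k_def by (rule gaussian_energy[OF _ _ H \<rho>]) (auto intro: sigma_finite_lborel)
    also have "\<dots> \<le> (\<integral>\<^sup>+ p. \<integral>\<^sup>+ p'. ennreal ((cmod (H p))\<^sup>2 / 2) * ennreal (k p p') + ennreal ((cmod (H p'))\<^sup>2 / 2) * ennreal (k p p') \<partial>lborel \<partial>lborel)"
    proof (intro nn_integral_mono)
      fix p p' :: 'a
      have "cmod (H p) * cmod (H p') \<le> (cmod (H p))\<^sup>2 / 2 + (cmod (H p'))\<^sup>2 / 2"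
        using sum_squares_bound[of "cmod (H p)" "cmod (H p')"] by simp
      then have "cmod (H p) * cmod (H p') * k p p' \<le> (cmod (H p))\<^sup>2 / 2 * k p p' + (cmod (H p'))\<^sup>2 / 2 * k p p'"
        using k0[of p p'] by (metis distrib_right mult_right_mono)
      then show "ennreal (cmod (H p) * cmod (H p') * k p p') \<le> ennreal ((cmod (H p))\<^sup>2 / 2) * ennreal (k p p') + ennreal ((cmod (H p'))\<^sup>2 / 2) * ennreal (k p p')"
        using k0[of p p'] by (simp add: ennreal_leI flip: ennreal_mult ennreal_plus)
    qed
    also have "\<dots> = (\<integral>\<^sup>+ p. ennreal ((cmod (H p))\<^sup>2 / 2) \<partial>lborel) + (\<integral>\<^sup>+ p. ennreal ((cmod (H p))\<^sup>2 / 2) \<partial>lborel)"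
      by (simp add: nn_integral_add J J')
    also have "\<dots> = ?R"
      by (subst nn_integral_add[symmetric]) (auto simp flip: ennreal_plus)
    finally show ?thesis .
  qed
  have "(\<integral>\<^sup>+ x. csq (A x) \<partial>lborel) =
      (\<integral>\<^sup>+ x. liminf (\<lambda>n. ennreal (gaussian (1 / real (Suc n)) x * (cmod (A x))\<^sup>2)) \<partial>lborel)"
  proof (intro nn_integral_cong)
    fix x
    have "(\<lambda>n. ennreal (gaussian (1 / real (Suc n)) x * (cmod (A x))\<^sup>2)) \<longlonglongrightarrow> ennreal (1 * (cmod (A x))\<^sup>2)"
      by (intro tendsto_ennrealI tendsto_intros gaussian_tendsto_1)
    from lim_imp_Liminf[OF trivial_limit_sequentially this]
    show "csq (A x) = liminf (\<lambda>n. ennreal (gaussian (1 / real (Suc n)) x * (cmod (A x))\<^sup>2))"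
      by simp
  qed
  also have "\<dots> \<le> liminf (\<lambda>n. (\<integral>\<^sup>+ x. ennreal (gaussian (1 / real (Suc n)) x * (cmod (A x))\<^sup>2) \<partial>lborel))"
    by (rule nn_integral_liminf) measurable
  also have "\<dots> \<le> liminf (\<lambda>n::nat. ?R)"
    by (intro Liminf_mono always_eventually allI bd) simp
  finally show ?thesis by (simp add: A_def Liminf_const)
qed

section \<open>The triangle measure\<close>

lemma diameter_isometry_image:
  fixes \<phi> :: "'a::metric_space \<Rightarrow> 'b::metric_space"
  assumes "\<And>x y. dist (\<phi> x) (\<phi> y) = dist x y"
  shows "diameter (\<phi> ` S) = diameter S"
proof -
  have "(\<lambda>(x, y). dist x y) ` ((\<phi> ` S) \<times> (\<phi> ` S)) = (\<lambda>(x, y). dist x y) ` (S \<times> S)"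
    using assms by (force simp: image_iff)
  then show ?thesis by (simp add: diameter_def)
qed

lemma hausdorff_pre_isometry_le:
  fixes \<phi> :: "'a::metric_space \<Rightarrow> 'b::metric_space"
  assumes iso: "\<And>x y. dist (\<phi> x) (\<phi> y) = dist x y"
  shows "hausdorff_pre m \<delta> (\<phi> ` A) \<le> hausdorff_pre m \<delta> A"
  unfolding hausdorff_pre_def
proof (rule INF_mono)
  fix U :: "nat \<Rightarrow> 'a set"
  assume "U \<in> {U. A \<subseteq> (\<Union>i. U i) \<and> (\<forall>i. bounded (U i) \<and> diameter (U i) \<le> \<delta>)}"
  then have U: "A \<subseteq> (\<Union>i. U i)" "\<And>i. bounded (U i)" "\<And>i. diameter (U i) \<le> \<delta>" by auto
  have "bounded (\<phi> ` U i)" for i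
    using U(2)[of i] iso unfolding bounded_def by (metis imageE)
  moreover have cov: "\<phi> ` A \<subseteq> (\<Union>i. \<phi> ` U i)"
    using image_mono[OF U(1), of \<phi>] by (simp add: image_UN)
  ultimately have "(\<lambda>i. \<phi> ` U i) \<in> {U. \<phi> ` A \<subseteq> (\<Union>i. U i) \<and> (\<forall>i. bounded (U i) \<and> diameter (U i) \<le> \<delta>)}"
    using U(3) cov by (simp add: diameter_isometry_image[OF iso])
  then show "\<exists>V\<in>{U. \<phi> ` A \<subseteq> (\<Union>i. U i) \<and> (\<forall>i. bounded (U i) \<and> diameter (U i) \<le> \<delta>)}.
      (\<Sum>i. if V i = {} then 0 else ennreal (diameter (V i) ^ m)) \<le> (\<Sum>i. if U i = {} then 0 else ennreal (diameter (U i) ^ m))"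
    by (rule bexI[rotated]) (simp add: diameter_isometry_image[OF iso] cong: if_cong)
qed

lemma hausdorff_outer_isometry_le:
  fixes \<phi> :: "'a::metric_space \<Rightarrow> 'b::metric_space"
  assumes "\<And>x y. dist (\<phi> x) (\<phi> y) = dist x y"
  shows "hausdorff_outer m (\<phi> ` A) \<le> hausdorff_outer m A"
  unfolding hausdorff_outer_def by (intro SUP_mono) (auto intro: hausdorff_pre_isometry_le assms)

lemma isometry_measurable:
  fixes \<phi> :: "'a::metric_space \<Rightarrow> 'b::metric_space"
  assumes "\<And>x y. dist (\<phi> x) (\<phi> y) = dist x y"
  shows "\<phi> \<in> borel_measurable borel"
  by (intro borel_measurable_continuous_onI) (auto simp: continuous_on_iff assms)

lemma sets_hausdorff_measure [measurable_cong, simp]: "sets (hausdorff_measure m) = sets borel"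
  unfolding hausdorff_measure_def by (subst sets_measure_of) (auto simp: sets.sigma_sets_eq[of borel, simplified])

lemma emeasure_hausdorff_measure_vimage:
  fixes \<phi> :: "'a::metric_space \<Rightarrow> 'a"
  assumes iso: "\<And>x y. dist (\<phi> x) (\<phi> y) = dist x y" and "surj \<phi>" and A: "A \<in> sets borel"
  shows "emeasure (hausdorff_measure m) (\<phi> -` A) = emeasure (hausdorff_measure m) A"
proof -
  have inj: "inj \<phi>" using iso by (metis injI dist_eq_0_iff)
  define \<psi> where "\<psi> = inv \<phi>"
  have \<psi>: "\<phi> (\<psi> x) = x" "\<psi> (\<phi> x) = x" for x
    using \<open>surj \<phi>\<close> inj by (auto simp: \<psi>_def surj_f_inv_f)
  have iso': "dist (\<psi> x) (\<psi> y) = dist x y" for x y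
    using iso[of "\<psi> x" "\<psi> y"] by (simp add: \<psi>)
  have 1: "\<phi> ` (\<phi> -` A) = A" using \<open>surj \<phi>\<close> by (rule surj_image_vimage_eq)
  have 2: "\<psi> ` A = \<phi> -` A" by (force simp: \<psi> image_iff)
  have "hausdorff_outer m (\<phi> -` A) = hausdorff_outer m A"
    using hausdorff_outer_isometry_le[OF iso, of m "\<phi> -` A"] hausdorff_outer_isometry_le[OF iso', of m A]
    unfolding 1 2 by (rule antisym[rotated])
  moreover have "\<phi> -` A \<in> sets borel"
    using measurable_sets[OF isometry_measurable[OF iso] A] by simp
  \<comment> \<open>\<open>emeasure_measure_of_conv\<close> evaluates \<open>measure_of\<close> by
    cases, with value 0 if the set function is not a measure; the two sides agree in either
    case.\<close>
  ultimately show ?thesis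
    using A by (simp add: hausdorff_measure_def emeasure_measure_of_conv sets.sigma_sets_eq[of borel, simplified])
qed

lemma closed_triangle_set: "closed (triangle_set :: ('a::euclidean_space \<times> 'a) set)"
proof -
  have eq: "triangle_set = {p :: 'a \<times> 'a. norm (fst p) = 1} \<inter> {p. norm (snd p) = 1} \<inter> {p. norm (fst p - snd p) = 1}"
    by (auto simp: triangle_set_def)
  show ?thesis
    unfolding eq by (intro closed_Int closed_Collect_eq continuous_intros)
qed

lemma triangle_set_borel [measurable]: "triangle_set \<in> sets borel"
  by (intro borel_closed closed_triangle_set)

lemma sets_triangle_measure [measurable_cong, simp]: "sets triangle_measure = sets borel"
  by (simp add: triangle_measure_def)

lemma space_triangle_measure [simp]: "space triangle_measure = UNIV"
  using sets_eq_imp_space_eq[OF sets_triangle_measure] by simp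

lemma emeasure_triangle_measure_UNIV_le: "emeasure (triangle_measure :: ('a::euclidean_space \<times> 'a) measure) UNIV \<le> 1"
proof -
  \<comment> \<open>In \<open>ennreal\<close> both 0 / 0 and \<open>top\<close> / \<open>top\<close>
    are 0: degenerate normalisation gives the zero measure, so the total mass is 0 or 1.\<close>
  have "x / x \<le> (1::ennreal)" for x
    by (cases "x = 0"; cases "x = top") (auto simp: ennreal_divide_self less_top)
  then show ?thesis by (simp add: triangle_measure_def)
qed

lemma finite_triangle_measure: "finite_measure (triangle_measure :: ('a::euclidean_space \<times> 'a) measure)"
  using emeasure_triangle_measure_UNIV_le[where 'a='a]
  by (intro finite_measureI) (auto simp: top_unique)

lemma AE_triangle_measure: "AE p in triangle_measure. p \<in> triangle_set"
  unfolding triangle_measure_def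
  by (rule AE_uniform_measureI) auto

lemma distr_triangle_measure_isometry:
  fixes \<phi> :: "'a::euclidean_space \<times> 'a \<Rightarrow> 'a \<times> 'a"
  assumes iso: "\<And>x y. dist (\<phi> x) (\<phi> y) = dist x y" and "surj \<phi>" and T: "\<phi> -` triangle_set = triangle_set"
  shows "distr triangle_measure borel \<phi> = triangle_measure"
proof (rule measure_eqI)
  have [measurable]: "\<phi> \<in> borel_measurable borel" by (rule isometry_measurable[OF iso])
  fix A assume "A \<in> sets (distr triangle_measure borel \<phi>)"
  then have A [measurable]: "A \<in> sets borel" by simp
  have "\<phi> -` A \<in> sets borel" 
    using measurable_sets[OF isometry_measurable[OF iso] A] by simp
  moreover have "triangle_set \<inter> \<phi> -` A = \<phi> -` (triangle_set \<inter> A)"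
    using T by auto
  moreover have "emeasure (hausdorff_measure m) (\<phi> -` (triangle_set \<inter> A)) = emeasure (hausdorff_measure m) (triangle_set \<inter> A)" for m
    by (rule emeasure_hausdorff_measure_vimage[OF iso \<open>surj \<phi>\<close>]) measurable
  ultimately show "emeasure (distr triangle_measure borel \<phi>) A = emeasure triangle_measure A"
    by (simp add: emeasure_distr del: vimage_Int) (simp add: triangle_measure_def del: vimage_Int)
qed simp

lemma triangle_measure_orthogonal:
  fixes U :: "'a::euclidean_space \<Rightarrow> 'a"
  assumes "orthogonal_transformation U"
  shows "distr triangle_measure borel (map_prod U U) = triangle_measure"
proof (rule distr_triangle_measure_isometry)
  have lin: "linear U" and n: "norm (U x) = norm x" for x
    using assms by (auto simp: orthogonal_transformation)
  have d: "dist (U x) (U y) = dist x y" for x y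
    using n[of "x - y"] by (simp add: dist_norm linear_diff[OF lin])
  show "dist (map_prod U U p) (map_prod U U p') = dist p p'" for p p'
    by (simp add: dist_prod_def d)
  show "surj (map_prod U U)"
    using orthogonal_transformation_surj[OF assms] by (simp add: map_prod_surj)
  show "map_prod U U -` triangle_set = triangle_set"
    using n by (auto simp: triangle_set_def simp flip: linear_diff[OF lin])
qed

lemma triangle_measure_swap:
  "distr (triangle_measure :: ('a::euclidean_space \<times> 'a) measure) borel prod.swap = triangle_measure"
proof (rule distr_triangle_measure_isometry)
  show "dist (prod.swap p) (prod.swap p') = dist p p'" for p p' :: "'a \<times> 'a"
    by (simp add: dist_prod_def add.commute)
qed (auto simp: triangle_set_def norm_minus_commute)

lemma orthogonal_transformation_measurable:
  fixes U :: "'a::euclidean_space \<Rightarrow> 'a"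
  assumes "orthogonal_transformation U"
  shows "U \<in> borel_measurable borel" "map_prod U U \<in> borel_measurable borel"
proof -
  have iso: "dist (U x) (U y) = dist x y" for x y
    using assms unfolding orthogonal_transformation dist_norm by (metis linear_diff)
  show "U \<in> borel_measurable borel" "map_prod U U \<in> borel_measurable borel"
    by (auto intro!: isometry_measurable simp: dist_prod_def iso)
qed

text \<open>The Householder reflection in the hyperplane orthogonal to a - b. That it fixes this
  hyperplane makes it possible to move one vertex of a triangle while another stays in
  place.\<close>

lemma ex_reflection:
  fixes a b :: "'a::euclidean_space"
  assumes "norm a = norm b"
  shows "\<exists>U. orthogonal_transformation U \<and> U a = b \<and> (\<forall>w. (a - b) \<bullet> w = 0 \<longrightarrow> U w = w)"
proof (cases "a = b")
  case True
  then show ?thesis by (intro exI[of _ "\<lambda>x. x"]) simp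
next
  case False
  define v where "v = a - b"
  have vv: "v \<bullet> v \<noteq> 0" using False by (simp add: v_def)
  define k where "k = 2 / (v \<bullet> v)"
  have k: "k * (v \<bullet> v) = 2" using vv by (simp add: k_def)
  define U where "U x = x - (k * (v \<bullet> x)) *\<^sub>R v" for x
  have lin: "linear U"
    by (rule linearI) (simp_all add: U_def inner_add_right algebra_simps)
  have ip: "U x \<bullet> U y = x \<bullet> y" for x y
  proof -
    have "U x \<bullet> U y = x \<bullet> y + (k * (v \<bullet> v) - 2) * (k * (v \<bullet> x) * (v \<bullet> y))"
      by (simp add: U_def inner_diff_left inner_diff_right inner_commute[of x v] algebra_simps)
    then show ?thesis by (simp add: k)
  qed
  have "a \<bullet> a = b \<bullet> b"
    using assms by (simp add: norm_eq)
  then have "2 * (v \<bullet> a) = v \<bullet> v"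
    by (simp add: v_def inner_diff_left inner_diff_right inner_commute[of a b])
  then have "k * (v \<bullet> a) = 1" using vv by (simp add: k_def)
  then have Ua: "U a = b" by (simp add: U_def) (simp add: v_def)
  have Uw: "U w = w" if "(a - b) \<bullet> w = 0" for w
    using that by (simp add: U_def v_def)
  show ?thesis
    using lin ip Ua Uw by (intro exI[of _ U] conjI) (simp_all add: orthogonal_transformation_def)
qed

text \<open>Two reflections suffice. The first sends y to y'. The image of z and the target z' both
  have inner product 1/2 with y', so their difference is orthogonal to y', and the reflection that
  exchanges them leaves y' alone.\<close>

lemma triangle_set_transitive:
  fixes p p' :: "'a::euclidean_space \<times> 'a"
  assumes "p \<in> triangle_set" "p' \<in> triangle_set"
  obtains U where "orthogonal_transformation U" "map_prod U U p = p'"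
proof -
  obtain y z y' z' where p: "p = (y, z)" "p' = (y', z')" by fastforce
  have n: "norm y = 1" "norm z = 1" "norm (y - z) = 1" "norm y' = 1" "norm z' = 1" "norm (y' - z') = 1"
    using assms by (auto simp: p triangle_set_def)
  have ip: "y \<bullet> z = 1/2" "y' \<bullet> z' = 1/2"
    using n dot_norm_neg[of y z] dot_norm_neg[of y' z'] by simp_all
  have "norm y = norm y'" using n by simp
  from ex_reflection[OF this] obtain U1 where U1: "orthogonal_transformation U1" "U1 y = y'"
    by blast
  have n1: "norm (U1 z) = norm z'"
    using U1 n by (simp add: orthogonal_transformation)
  have "y' \<bullet> U1 z = 1/2"
    using U1 ip unfolding orthogonal_transformation_def by metis
  then have "(U1 z - z') \<bullet> y' = 0"
    using ip by (simp add: inner_diff_left inner_diff_right inner_commute[of _ y'])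
  with ex_reflection[OF n1] obtain U2 where U2: "orthogonal_transformation U2" "U2 (U1 z) = z'" "U2 y' = y'"
    by blast
  have "map_prod (U2 \<circ> U1) (U2 \<circ> U1) p = p'"
    using U1 U2 by (simp add: p)
  with orthogonal_transformation_compose[OF U2(1) U1(1)] show ?thesis by (rule that)
qed

text \<open>All but three of the coordinates of a point of \<^const>\<open>triangle_set\<close> can be prescribed freely near \<open>0\<close>.\<close>

lemma triangle_set_lift:
  fixes q r :: "'a::euclidean_space"
  assumes b: "b\<^sub>1 \<in> Basis" "b\<^sub>2 \<in> Basis" "b\<^sub>1 \<noteq> b\<^sub>2"
    and v: "v = q - (q \<bullet> b\<^sub>1) *\<^sub>R b\<^sub>1" "(norm v)\<^sup>2 \<le> 1/10"
    and u: "u = r - (r \<bullet> b\<^sub>1) *\<^sub>R b\<^sub>1 - (r \<bullet> b\<^sub>2) *\<^sub>R b\<^sub>2" "(norm u)\<^sup>2 \<le> 1/10"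
  obtains y z where "(y, z) \<in> triangle_set" "\<And>b. b \<in> Basis \<Longrightarrow> b \<noteq> b\<^sub>1 \<Longrightarrow> y \<bullet> b = q \<bullet> b"
    "\<And>b. b \<in> Basis \<Longrightarrow> b \<noteq> b\<^sub>1 \<Longrightarrow> b \<noteq> b\<^sub>2 \<Longrightarrow> z \<bullet> b = r \<bullet> b"
proof -
  have [simp]: "b\<^sub>1 \<bullet> b\<^sub>1 = 1" "b\<^sub>2 \<bullet> b\<^sub>2 = 1" "b\<^sub>1 \<bullet> b\<^sub>2 = 0" "b\<^sub>2 \<bullet> b\<^sub>1 = 0"
    using b by (auto simp: inner_Basis)
  have [simp]: "v \<bullet> b\<^sub>1 = 0" "b\<^sub>1 \<bullet> v = 0" "u \<bullet> b\<^sub>1 = 0" "b\<^sub>1 \<bullet> u = 0" "u \<bullet> b\<^sub>2 = 0" "b\<^sub>2 \<bullet> u = 0"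
    by (auto simp: v(1) u(1) inner_simps inner_commute)
  have vv: "v \<bullet> v \<le> 1/10" and uu: "u \<bullet> u \<le> 1/10"
    using v(2) u(2) by (auto simp: power2_norm_eq_inner)
  define y1 where "y1 = sqrt (1 - v \<bullet> v)"
  define y2 where "y2 = v \<bullet> b\<^sub>2"
  have y1: "y1\<^sup>2 = 1 - v \<bullet> v" using vv by (simp add: y1_def)
  \<comment> \<open>With y = y1 b1 + v and z = z1 b1 + z2 b2 + u, the unknowns (z1, z2) must lie on
    the line with inner product c against (y1, y2), which encodes that y and z have inner product
    1/2, and on the circle of squared radius 1 - u \<bullet> u. The witness below has component k
    along (y1, y2) and h along its perpendicular (-y2, y1).\<close>
  define S where "S = y1\<^sup>2 + y2\<^sup>2"
  have S: "S \<ge> 9/10" unfolding S_def y1 using vv by (simp add: add_increasing2)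
  define c where "c = 1/2 - v \<bullet> u"
  have uv: "\<bar>v \<bullet> u\<bar> \<le> 1/10"
  proof (rule power2_le_imp_le)
    have "(v \<bullet> u)\<^sup>2 \<le> (v \<bullet> v) * (u \<bullet> u)" by (rule Cauchy_Schwarz_ineq)
    also have "\<dots> \<le> 1/10 * (1/10)" using vv uu by (intro mult_mono) auto
    finally show "\<bar>v \<bullet> u\<bar>\<^sup>2 \<le> (1/10)\<^sup>2" by (simp add: power2_eq_square)
  qed simp
  have c2: "c\<^sup>2 \<le> 36/100"
  proof -
    have "\<bar>c\<bar> \<le> 6/10" using uv by (simp add: c_def)
    then show ?thesis using power_mono[of "\<bar>c\<bar>" "6/10" 2] by (simp add: power2_eq_square)
  qed
  \<comment> \<open>The line meets the circle because its squared distance from the origin is at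
    most 0.4 while the squared radius is at least 0.9; this is what the smallness 1/10 of v and u is
    for.\<close>
  have "c\<^sup>2 / S \<le> 36/100 / (9/10)" using S c2 by (intro frac_le) auto
  then have h0: "(1 - u \<bullet> u - c\<^sup>2 / S) / S \<ge> 0" using uu S by simp
  define h where "h = sqrt ((1 - u \<bullet> u - c\<^sup>2 / S) / S)"
  have h2: "h\<^sup>2 * S = 1 - u \<bullet> u - c\<^sup>2 / S" using h0 S by (simp add: h_def)
  define k where "k = c / S"
  have kS: "k * S = c" using S by (simp add: k_def)
  define z1 where "z1 = k * y1 - h * y2"
  define z2 where "z2 = k * y2 + h * y1"
  have e1: "y1 * z1 + y2 * z2 = c"
    unfolding kS[symmetric] by (simp add: z1_def z2_def S_def algebra_simps power2_eq_square)
  have e2: "z1\<^sup>2 + z2\<^sup>2 = 1 - u \<bullet> u"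
  proof -
    have "z1\<^sup>2 + z2\<^sup>2 = k\<^sup>2 * S + h\<^sup>2 * S" by (simp add: z1_def z2_def S_def algebra_simps power2_eq_square)
    also have "k\<^sup>2 * S = c\<^sup>2 / S" using S by (simp add: k_def power2_eq_square)
    finally show ?thesis by (simp add: h2)
  qed
  define y where "y = y1 *\<^sub>R b\<^sub>1 + v"
  define z where "z = z1 *\<^sub>R b\<^sub>1 + z2 *\<^sub>R b\<^sub>2 + u"
  have "y \<bullet> y = 1"
    using y1 by (simp add: y_def inner_simps power2_eq_square)
  moreover have "z \<bullet> z = 1"
    using e2 by (simp add: z_def inner_simps power2_eq_square)
  moreover have "y \<bullet> z = 1/2"
    using e1 by (simp add: y_def z_def inner_simps y2_def c_def mult.commute)
  ultimately have "(y, z) \<in> triangle_set"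
    by (simp add: triangle_set_def norm_eq_1 inner_simps inner_commute)
  moreover have "y \<bullet> b = q \<bullet> b" if "b \<in> Basis" "b \<noteq> b\<^sub>1" for b
    using that b by (simp add: y_def v(1) inner_simps inner_Basis)
  moreover have "z \<bullet> b = r \<bullet> b" if "b \<in> Basis" "b \<noteq> b\<^sub>1" "b \<noteq> b\<^sub>2" for b
    using that b by (simp add: z_def u(1) inner_simps inner_Basis)
  ultimately show ?thesis by (rule that)
qed

section \<open>A Frostman condition for the triangle measure\<close>

lemma triangle_gaussian_const:
  fixes p q :: "'a::euclidean_space \<times> 'a"
  assumes "p \<in> triangle_set" "q \<in> triangle_set"
  shows "(\<integral>\<^sup>+ p'. ennreal (gaussian \<rho> (p - p')) \<partial>triangle_measure) = (\<integral>\<^sup>+ p'. ennreal (gaussian \<rho> (q - p')) \<partial>triangle_measure)"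
proof -
  obtain U where U: "orthogonal_transformation U" "map_prod U U p = q"
    using triangle_set_transitive[OF assms] by blast
  have lin: "linear U" and n: "norm (U x) = norm x" for x
    using U(1) by (auto simp: orthogonal_transformation)
  note m = orthogonal_transformation_measurable(2)[OF U(1)]
  have *: "norm (q - map_prod U U p') = norm (p - p')" for p'
    by (simp add: U(2)[symmetric] norm_prod_def n flip: linear_diff[OF lin])
  have "(\<integral>\<^sup>+ p'. ennreal (gaussian \<rho> (q - p')) \<partial>triangle_measure) =
      (\<integral>\<^sup>+ p'. ennreal (gaussian \<rho> (q - p')) \<partial>distr triangle_measure borel (map_prod U U))"
    by (simp only: triangle_measure_orthogonal[OF U(1)])
  also have "\<dots> = (\<integral>\<^sup>+ p'. ennreal (gaussian \<rho> (p - p')) \<partial>triangle_measure)"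
    using m by (subst nn_integral_distr) (auto simp: gaussian_def *)
  finally show ?thesis by simp
qed

lemma norm_sq_le_card:
  fixes v :: "'a::euclidean_space"
  assumes "\<And>b. b \<in> Basis \<Longrightarrow> \<bar>v \<bullet> b\<bar> \<le> c"
  shows "(norm v)\<^sup>2 \<le> real DIM('a) * c\<^sup>2"
proof -
  have "(norm v)\<^sup>2 = (\<Sum>b\<in>Basis. (v \<bullet> b)\<^sup>2)"
    unfolding power2_norm_eq_inner euclidean_inner[of v v] by (simp add: power2_eq_square)
  also have "\<dots> \<le> (\<Sum>b\<in>(Basis::'a set). c\<^sup>2)"
    using assms by (intro sum_mono abs_le_square_iff[THEN iffD1]) (smt (verit))
  finally show ?thesis by simp
qed

text \<open>The Gaussian average is constant on \<^const>\<open>triangle_set\<close> by rotation invariance; averaging it over lifts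
  of a cube in \<open>2d - 3\<close> free coordinates bounds it without any covering argument.\<close>

lemma triangle_frostman:
  fixes p :: "'a::euclidean_space \<times> 'a"
  assumes p: "p \<in> triangle_set" and \<rho>: "\<rho> > 0" and dim: "DIM('a) \<ge> 2"
  shows "(\<integral>\<^sup>+ p'. ennreal (gaussian \<rho> (p - p')) \<partial>triangle_measure)
    \<le> ennreal ((2 * real DIM('a) / \<rho>) ^ (2 * DIM('a) - 3))"
proof -
  let ?d = "real DIM('a)"
  obtain b1 b2 :: 'a where b: "b1 \<in> Basis" "b2 \<in> Basis" "b1 \<noteq> b2"
    using dim card_le_Suc0_iff_eq[of "Basis :: 'a set"] by fastforce
  \<comment> \<open>The three coordinates that the equations of a triangle determine: one of y and
    two of z. The remaining 2d - 3 coordinates in \<open>J\<close> are free.\<close>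
  define N :: "('a \<times> 'a) set" where "N = {(b1, 0), (0, b1), (0, b2)}"
  define J :: "('a \<times> 'a) set" where "J = Basis - N"
  have [simp]: "b1 \<noteq> 0" "b2 \<noteq> 0" using b by (auto simp: nonzero_Basis)
  have NB: "N \<subseteq> Basis" using b by (auto simp: N_def Basis_prod_def)
  have "card N = 3" using b by (simp add: N_def)
  then have cardJ: "card J = 2 * DIM('a) - 3"
    using NB by (simp add: J_def card_Diff_subset finite_subset[OF NB])
  \<comment> \<open>Half the side of the cube of free coordinates, so small that d * c^2 is at most
    1/10, as \<open>triangle_set_lift\<close> requires of v and u.\<close>
  define c where "c = 1 / (4 * ?d)"
  have c: "c > 0" using dim by (simp add: c_def)
  define S :: "'a \<times> 'a \<Rightarrow> real set" where "S B = (if B \<in> J then {-c..c} else {0..1})" for B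
  define Q :: "('a \<times> 'a) set" where "Q = {q. \<forall>B\<in>Basis. q \<bullet> B \<in> S B}"
  define V where "V = (\<integral>\<^sup>+ p'. ennreal (gaussian \<rho> (p - p')) \<partial>triangle_measure)"
  \<comment> \<open>Factor of the majorant in direction B. In the constrained directions the
    Gaussian factor is bounded by 1 and replaced by the indicator of a unit interval, so that these
    directions contribute exactly 1 to integrals over q, both here and in the volume of
    \<open>Q\<close>.\<close>
  define w where "w B s s' = (if B \<in> J then ennreal (exp (- pi * (\<rho> * (s - s'))\<^sup>2)) else indicator {0..1} s)"
    for B :: "'a \<times> 'a" and s s' :: real
  have wm [measurable]: "(\<lambda>s. w B s s') \<in> borel_measurable borel" for B s'
    unfolding w_def by (cases "B \<in> J") simp_all
  have Qint: "(\<integral>\<^sup>+ q. (\<Prod>B\<in>Basis. indicator (S B) (q \<bullet> B)) \<partial>lborel) = ennreal ((2 * c) ^ card J)"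
  proof -
    have "(\<integral>\<^sup>+ s. indicator (S B) s \<partial>lborel) = (if B \<in> J then ennreal (2 * c) else 1)" for B
      using c by (auto simp: S_def)
    then have "(\<integral>\<^sup>+ q. (\<Prod>B\<in>Basis. indicator (S B) (q \<bullet> B)) \<partial>lborel) = (\<Prod>B\<in>Basis. if B \<in> J then ennreal (2 * c) else 1)"
      by (subst nn_integral_lborel_prod) (auto simp: S_def)
    also have "\<dots> = (\<Prod>B\<in>J. ennreal (2 * c))"
      by (rule prod.mono_neutral_cong_right) (auto simp: J_def)
    also have "\<dots> = ennreal ((2 * c) ^ card J)"
      using c by (simp add: ennreal_power)
    finally show ?thesis .
  qed
  have wint: "(\<integral>\<^sup>+ q. (\<Prod>B\<in>Basis. w B (q \<bullet> B) (p' \<bullet> B)) \<partial>lborel) = ennreal ((1 / \<rho>) ^ card J)" for p' :: "'a \<times> 'a"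
  proof -
    have *: "(\<integral>\<^sup>+ s. w B s s' \<partial>lborel) = (if B \<in> J then ennreal (1 / \<rho>) else 1)" for B s'
    proof (cases "B \<in> J")
      case True
      have "w B s s' = ennreal (gaussian \<rho> (s' - s))" for s
        using True by (simp add: w_def gaussian_def power_mult_distrib power2_commute)
      then show ?thesis
        using nn_integral_gaussian[OF \<rho>, where 'a=real] True
        by (simp add: nn_integral_lborel_diff[of "\<lambda>s. ennreal (gaussian \<rho> s)"])
    next
      case False
      then have "w B s s' = indicator {0..1} s" for s by (simp add: w_def)
      with False show ?thesis by simp
    qed
    have "(\<integral>\<^sup>+ q. (\<Prod>B\<in>Basis. w B (q \<bullet> B) (p' \<bullet> B)) \<partial>lborel) = (\<Prod>B\<in>Basis. if B \<in> J then ennreal (1 / \<rho>) else 1)"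
      by (subst nn_integral_lborel_prod) (auto simp: *)
    also have "\<dots> = (\<Prod>B\<in>J. ennreal (1 / \<rho>))"
      by (rule prod.mono_neutral_cong_right) (auto simp: J_def)
    also have "\<dots> = ennreal ((1 / \<rho>) ^ card J)"
      using \<rho> by (simp add: ennreal_power)
    finally show ?thesis .
  qed
  \<comment> \<open>V does not change when p is moved along the set of triangles, so it may be
    evaluated at a lift (y, z) of q. The lift agrees with q in all directions of \<open>J\<close>,
    and only these enter the majorant.\<close>
  have V: "V \<le> (\<integral>\<^sup>+ p'. (\<Prod>B\<in>Basis. w B (q \<bullet> B) (p' \<bullet> B)) \<partial>triangle_measure)" if q: "q \<in> Q" for q
  proof -
    have qJ: "\<bar>q \<bullet> B\<bar> \<le> c" if "B \<in> J" for B
      using q that by (force simp: Q_def S_def J_def)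
    have q01: "q \<bullet> B \<in> {0..1}" if "B \<in> Basis" "B \<notin> J" for B
      using q that by (auto simp: Q_def S_def)
    define v where "v = fst q - (fst q \<bullet> b1) *\<^sub>R b1"
    define u where "u = snd q - (snd q \<bullet> b1) *\<^sub>R b1 - (snd q \<bullet> b2) *\<^sub>R b2"
    have d10: "?d * c\<^sup>2 \<le> 1/10"
      using dim by (simp add: c_def power2_eq_square field_simps)
    have fstJ: "(b', 0) \<in> J" if "b' \<in> Basis" "b' \<noteq> b1" for b'
      using that by (auto simp: J_def N_def Basis_prod_def)
    have sndJ: "(0, b') \<in> J" if "b' \<in> Basis" "b' \<noteq> b1" "b' \<noteq> b2" for b'
      using that by (auto simp: J_def N_def Basis_prod_def)
    have "\<bar>v \<bullet> b'\<bar> \<le> c" if "b' \<in> Basis" for b'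
      using qJ[OF fstJ[OF that]] that b c
      by (cases "b' = b1") (auto simp: v_def inner_diff_left inner_Basis inner_prod_def)
    from order_trans[OF norm_sq_le_card[OF this] d10] have v10: "(norm v)\<^sup>2 \<le> 1/10" by simp
    have "\<bar>u \<bullet> b'\<bar> \<le> c" if "b' \<in> Basis" for b'
      using qJ[OF sndJ[OF that]] that b c
      by (cases "b' = b1"; cases "b' = b2") (auto simp: u_def inner_diff_left inner_Basis inner_prod_def)
    from order_trans[OF norm_sq_le_card[OF this] d10] have u10: "(norm u)\<^sup>2 \<le> 1/10" by simp
    obtain y z where yz: "(y, z) \<in> triangle_set" "\<And>b. b \<in> Basis \<Longrightarrow> b \<noteq> b1 \<Longrightarrow> y \<bullet> b = fst q \<bullet> b"
      "\<And>b. b \<in> Basis \<Longrightarrow> b \<noteq> b1 \<Longrightarrow> b \<noteq> b2 \<Longrightarrow> z \<bullet> b = snd q \<bullet> b"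
      using triangle_set_lift[OF b v_def v10 u_def u10] by blast
    have yzJ: "(y, z) \<bullet> B = q \<bullet> B" if "B \<in> J" for B
      using that yz(2,3) by (cases B) (auto simp: J_def N_def Basis_prod_def inner_prod_def)
    have "V = (\<integral>\<^sup>+ p'. ennreal (gaussian \<rho> ((y, z) - p')) \<partial>triangle_measure)"
      unfolding V_def by (rule triangle_gaussian_const[OF p yz(1)])
    also have "\<dots> \<le> (\<integral>\<^sup>+ p'. (\<Prod>B\<in>Basis. w B (q \<bullet> B) (p' \<bullet> B)) \<partial>triangle_measure)"
    proof (rule nn_integral_mono)
      fix p' :: "'a \<times> 'a"
      have "ennreal (gaussian \<rho> ((y, z) - p')) = (\<Prod>B\<in>Basis. ennreal (exp (- pi * (\<rho> * (((y, z) - p') \<bullet> B))\<^sup>2)))"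
        unfolding gaussian_eq_prod by (rule prod_ennreal[symmetric]) simp
      also have "\<dots> \<le> (\<Prod>B\<in>Basis. w B (q \<bullet> B) (p' \<bullet> B))"
      proof (rule prod_mono_ennreal)
        fix B :: "'a \<times> 'a" assume B: "B \<in> Basis"
        show "ennreal (exp (- pi * (\<rho> * (((y, z) - p') \<bullet> B))\<^sup>2)) \<le> w B (q \<bullet> B) (p' \<bullet> B)"
        proof (cases "B \<in> J")
          case True
          then show ?thesis by (simp only: w_def inner_diff_left yzJ if_True)
        next
          case False
          then have "w B (q \<bullet> B) (p' \<bullet> B) = 1" using q01[OF B] by (simp add: w_def)
          then show ?thesis by simp
        qed
      qed
      finally show "ennreal (gaussian \<rho> ((y, z) - p')) \<le> (\<Prod>B\<in>Basis. w B (q \<bullet> B) (p' \<bullet> B))" .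
    qed
    finally show ?thesis .
  qed
  interpret T: finite_measure "triangle_measure :: ('a \<times> 'a) measure" by (rule finite_triangle_measure)
  interpret LT: pair_sigma_finite "lborel :: ('a \<times> 'a) measure" "triangle_measure :: ('a \<times> 'a) measure" ..
  have wm2: "(\<lambda>(q, p'). \<Prod>B\<in>Basis. w B (q \<bullet> B) (p' \<bullet> B)) \<in> borel_measurable (lborel \<Otimes>\<^sub>M triangle_measure)"
    unfolding split_beta
  proof (rule borel_measurable_prod_ennreal)
    fix B :: "'a \<times> 'a"
    show "(\<lambda>x. w B (fst x \<bullet> B) (snd x \<bullet> B)) \<in> borel_measurable (lborel \<Otimes>\<^sub>M triangle_measure)"
      unfolding w_def by (cases "B \<in> J") simp_all
  qed
  have Qm: "(\<lambda>q. \<Prod>B\<in>Basis. indicator (S B) (q \<bullet> B) :: ennreal) \<in> borel_measurable borel"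
  proof (rule borel_measurable_prod_ennreal)
    fix B :: "'a \<times> 'a"
    have [measurable]: "S B \<in> sets borel" by (simp add: S_def)
    show "(\<lambda>q. indicator (S B) (q \<bullet> B)) \<in> borel_measurable borel" by measurable
  qed
  \<comment> \<open>Averaging the bound over \<open>Q\<close> and exchanging integrals: for fixed p'
    each free direction integrates to 1 / \<rho>, and the measure has mass at most 1. Dividing by
    the side length 2c = 1 / (2d) gives the base 2d / \<rho>.\<close>
  have "V * ennreal ((2 * c) ^ card J) = (\<integral>\<^sup>+ q. V * (\<Prod>B\<in>Basis. indicator (S B) (q \<bullet> B)) \<partial>lborel)"
    by (subst nn_integral_cmult) (use Qm in \<open>simp_all add: Qint del: power_mult_distrib\<close>)
  also have "\<dots> \<le> (\<integral>\<^sup>+ q. (\<integral>\<^sup>+ p'. (\<Prod>B\<in>Basis. w B (q \<bullet> B) (p' \<bullet> B)) \<partial>triangle_measure) \<partial>lborel)"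
  proof (rule nn_integral_mono)
    fix q :: "'a \<times> 'a"
    show "V * (\<Prod>B\<in>Basis. indicator (S B) (q \<bullet> B)) \<le> (\<integral>\<^sup>+ p'. (\<Prod>B\<in>Basis. w B (q \<bullet> B) (p' \<bullet> B)) \<partial>triangle_measure)"
    proof (cases "q \<in> Q")
      case True
      then have "(\<Prod>B\<in>Basis. indicator (S B) (q \<bullet> B)) = (1::ennreal)" by (intro prod.neutral) (auto simp: Q_def)
      then show ?thesis using V[OF True] by simp
    next
      case False
      then obtain B where "B \<in> Basis" "q \<bullet> B \<notin> S B" unfolding Q_def by blast
      then have "(\<Prod>B\<in>Basis. indicator (S B) (q \<bullet> B)) = (0::ennreal)" by (intro prod_zero bexI[of _ B]) simp_all
      then show ?thesis by (simp only: mult_zero_right zero_le)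
    qed
  qed
  also have "\<dots> = (\<integral>\<^sup>+ p'. (\<integral>\<^sup>+ q. (\<Prod>B\<in>Basis. w B (q \<bullet> B) (p' \<bullet> B)) \<partial>lborel) \<partial>triangle_measure)"
    by (rule LT.Fubini'[OF wm2, symmetric])
  also have "\<dots> = ennreal ((1 / \<rho>) ^ card J) * emeasure (triangle_measure :: ('a \<times> 'a) measure) UNIV"
    by (simp add: wint)
  also have "\<dots> \<le> ennreal ((1 / \<rho>) ^ card J) * 1"
    by (intro mult_left_mono emeasure_triangle_measure_UNIV_le) simp
  finally have le: "V * ennreal ((2 * c) ^ card J) \<le> ennreal ((1 / \<rho>) ^ card J)" by simp
  have "ennreal ((2 * c) ^ card J) * ennreal ((1 / (2 * c)) ^ card J) = ennreal ((2 * c * (1 / (2 * c))) ^ card J)"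
    using c by (subst ennreal_mult[symmetric]) (auto simp only: power_mult_distrib zero_le_power zero_le_divide_1_iff less_imp_le mult_nonneg_nonneg zero_le_numeral)
  also have "2 * c * (1 / (2 * c)) = 1" using c by simp
  finally have "V = V * ennreal ((2 * c) ^ card J) * ennreal ((1 / (2 * c)) ^ card J)"
    by (simp only: mult.assoc) simp
  also have "\<dots> \<le> ennreal ((1 / \<rho>) ^ card J) * ennreal ((1 / (2 * c)) ^ card J)"
    by (intro mult_right_mono le) simp
  also have "\<dots> = ennreal ((1 / \<rho> * (1 / (2 * c))) ^ card J)"
    using c \<rho> by (subst ennreal_mult[symmetric]) (auto simp only: power_mult_distrib zero_le_power zero_le_divide_1_iff less_imp_le mult_nonneg_nonneg zero_le_numeral)
  also have "1 / \<rho> * (1 / (2 * c)) = 2 * ?d / \<rho>"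
    by (simp add: c_def)
  finally show ?thesis by (simp add: V_def cardJ)
qed

text \<open>The uniqueness argument for Haar measure: one convolution integral of A against the unit
  ball B is evaluated in two ways, giving the image measure of A times the volume of B, and the
  volume of A times the image measure of B. The ball is its own preimage under U, so its finite
  positive volume cancels.\<close>

lemma lborel_distr_orthogonal:
  fixes U :: "'a::euclidean_space \<Rightarrow> 'a"
  assumes U: "orthogonal_transformation U"
  shows "distr lborel borel U = lborel"
proof (rule measure_eqI)
  fix A assume "A \<in> sets (distr lborel borel U)"
  then have A [measurable]: "A \<in> sets borel" by simp
  have lin: "linear U" and n: "norm (U x) = norm x" for x
    using U by (auto simp: orthogonal_transformation)
  note [measurable] = orthogonal_transformation_measurable(1)[OF U]
  define \<nu> where "\<nu> = distr lborel borel U"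
  obtain V where V: "\<And>x. U (V x) = x" using orthogonal_transformation_surj[OF U] by (metis surj_def)
  define B where "B = ball (0::'a) 1"
  have \<nu>: "(\<integral>\<^sup>+ w. f w \<partial>\<nu>) = (\<integral>\<^sup>+ w. f (U w) \<partial>lborel)" if [measurable]: "f \<in> borel_measurable borel" for f
    by (simp add: \<nu>_def nn_integral_distr)
  \<comment> \<open>The image measure inherits invariance under w \<mapsto> y - w, because y - U w =
    U (V y - w) for a right inverse V of U.\<close>
  have refl: "(\<integral>\<^sup>+ w. f (y - U w) \<partial>lborel) = (\<integral>\<^sup>+ w. f (U w) \<partial>lborel)"
    if [measurable]: "f \<in> borel_measurable borel" for f :: "'a \<Rightarrow> ennreal" and y
  proof -
    have "(\<integral>\<^sup>+ w. f (y - U w) \<partial>lborel) = (\<integral>\<^sup>+ w. f (U (V y - w)) \<partial>lborel)"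
      by (simp add: linear_diff[OF lin] V)
    also have "\<dots> = (\<integral>\<^sup>+ w. f (U w) \<partial>lborel)"
      by (rule nn_integral_lborel_diff) measurable
    finally show ?thesis .
  qed
  have [measurable]: "B \<in> sets borel" by (simp add: B_def)
  let ?I = "\<integral>\<^sup>+ y. \<integral>\<^sup>+ x. indicator A (U x) * indicator B (y - U x) \<partial>lborel \<partial>lborel"
  have "?I = (\<integral>\<^sup>+ x. \<integral>\<^sup>+ y. indicator A (U x) * indicator B (y - U x) \<partial>lborel \<partial>lborel)"
    by (rule lborel_pair.Fubini') measurable
  also have "\<dots> = (\<integral>\<^sup>+ x. indicator A (U x) * emeasure lborel B \<partial>lborel)"
  proof (intro nn_integral_cong)
    fix x :: 'a
    have "(\<integral>\<^sup>+ y. indicator B (y - U x) \<partial>lborel) = (\<integral>\<^sup>+ y. indicator B y \<partial>(lborel::'a measure))"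
      using nn_integral_lborel_translate[of "indicator B" "- U x"] by simp
    then show "(\<integral>\<^sup>+ y. indicator A (U x) * indicator B (y - U x) \<partial>lborel) = indicator A (U x) * emeasure lborel B"
      by (simp add: nn_integral_cmult)
  qed
  also have "\<dots> = emeasure \<nu> A * emeasure lborel B"
    by (subst nn_integral_multc) (auto simp flip: \<nu> simp: \<nu>_def)
  finally have 1: "?I = emeasure \<nu> A * emeasure lborel B" .
  \<comment> \<open>Reflecting U x to y - U x exchanges the arguments of the two indicators; now it
    is A that is translated by the variable of Lebesgue measure.\<close>
  have "?I = (\<integral>\<^sup>+ y. \<integral>\<^sup>+ x. indicator A (y - U x) * indicator B (U x) \<partial>lborel \<partial>lborel)"
  proof (rule nn_integral_cong)
    fix y
    show "(\<integral>\<^sup>+ x. indicator A (U x) * indicator B (y - U x) \<partial>lborel) = (\<integral>\<^sup>+ x. indicator A (y - U x) * indicator B (U x) \<partial>lborel)"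
      using refl[of "\<lambda>w. indicator A w * indicator B (y - w)" y] by simp
  qed
  also have "\<dots> = (\<integral>\<^sup>+ x. \<integral>\<^sup>+ y. indicator A (y - U x) * indicator B (U x) \<partial>lborel \<partial>lborel)"
    by (rule lborel_pair.Fubini') measurable
  also have "\<dots> = (\<integral>\<^sup>+ x. emeasure lborel A * indicator B (U x) \<partial>lborel)"
  proof (intro nn_integral_cong)
    fix x :: 'a
    have "(\<integral>\<^sup>+ y. indicator A (y - U x) \<partial>lborel) = (\<integral>\<^sup>+ y. indicator A y \<partial>(lborel::'a measure))"
      using nn_integral_lborel_translate[of "indicator A" "- U x"] by simp
    then show "(\<integral>\<^sup>+ y. indicator A (y - U x) * indicator B (U x) \<partial>lborel) = emeasure lborel A * indicator B (U x)"
      by (simp add: nn_integral_multc)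
  qed
  also have "\<dots> = emeasure lborel A * emeasure \<nu> B"
    by (subst nn_integral_cmult) (auto simp flip: \<nu> simp: \<nu>_def)
  also have "emeasure \<nu> B = emeasure lborel B"
  proof -
    have "U -` B = B" by (auto simp: B_def n)
    then show ?thesis by (simp add: \<nu>_def emeasure_distr)
  qed
  finally have "emeasure \<nu> A * emeasure lborel B = emeasure lborel A * emeasure lborel B"
    using 1 by simp
  moreover have "emeasure lborel B \<noteq> 0" "emeasure lborel B \<noteq> top"
    using emeasure_lborel_ball_finite[of "0::'a" 1] unit_ball_vol_pos[of "real DIM('a)"]
    by (simp_all add: B_def emeasure_ball order_less_imp_not_eq2)
  ultimately show "emeasure (distr lborel borel U) A = emeasure lborel A"
    unfolding \<nu>_def[symmetric] by (metis ennreal_mult_cancel_left mult.commute)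
qed simp

section \<open>Square integrals of the multiplier\<close>

lemma ennreal_mult_mult: "0 \<le> a \<Longrightarrow> 0 \<le> b \<Longrightarrow> ennreal a * (ennreal b * x) = ennreal (a * b) * x"
  by (simp add: ennreal_mult mult.assoc)

lemma norm_fst_snd_le_1:
  assumes "p \<in> triangle_set" shows "norm (fst p) \<le> 1" "norm (snd p) \<le> 1"
  using assms by (auto simp: triangle_set_def)

lemma triangle_set_inner_Basis:
  fixes p :: "'a::euclidean_space \<times> 'a"
  assumes "p \<in> triangle_set" "B \<in> Basis" shows "\<bar>p \<bullet> B\<bar> \<le> 1"
proof -
  obtain b where b: "b \<in> Basis" "B = (b, 0) \<or> B = (0, b)"
    using assms(2) by (auto simp: Basis_prod_def)
  then show ?thesis
    using norm_fst_snd_le_1[OF assms(1)] Basis_le_norm[of b "fst p"] Basis_le_norm[of b "snd p"]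
    by (auto simp: inner_prod_def)
qed

text \<open>On the ball of radius R the Gaussian with parameter 1 / R is at least exp (- pi), hence
  the factor \<open>exp pi\<close>. The energy then carries R^(2d) times a Gaussian average, which
  \<open>triangle_frostman\<close> bounds by a multiple of R^(-(2d-3)). The amplitude is general
  because the derivative of the multiplier has coordinate functions as amplitudes.\<close>

lemma triangle_fourier_L2:
  fixes a :: "'a::euclidean_space \<times> 'a \<Rightarrow> complex"
  assumes [measurable]: "a \<in> borel_measurable borel" and a1: "\<And>p. p \<in> triangle_set \<Longrightarrow> cmod (a p) \<le> 1"
    and R: "R > 0" and dim: "DIM('a) \<ge> 2"
  shows "(\<integral>\<^sup>+ X. indicator (cball 0 R) X *
      csq (LINT p|triangle_measure. a p * cis (- 2 * pi * (X \<bullet> p))) \<partial>lborel)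
    \<le> ennreal (exp pi * (2 * real DIM('a)) ^ (2 * DIM('a) - 3) * R ^ 3)"
proof -
  let ?d = "real DIM('a)" and ?m = "2 * DIM('a) - 3"
  interpret T: finite_measure "triangle_measure :: ('a \<times> 'a) measure" by (rule finite_triangle_measure)
  have int: "integrable triangle_measure a"
  proof (rule T.integrable_const_bound)
    show "AE p in triangle_measure. cmod (a p) \<le> 1"
      using AE_triangle_measure by eventually_elim (rule a1)
  qed simp
  define A where "A X = (cmod (LINT p|triangle_measure. a p * cis (2 * pi * (X \<bullet> p))))\<^sup>2" for X
  have [measurable]: "A \<in> borel_measurable borel" unfolding A_def by measurable
  have [measurable]: "cball (0 :: 'a \<times> 'a) R \<in> sets borel" by simp
  \<comment> \<open>The reflection X \<mapsto> -X turns the phase of the Fourier transform into the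
    positive phase of \<open>gaussian_energy\<close>.\<close>
  have "(\<integral>\<^sup>+ X. indicator (cball 0 R) X *
      csq (LINT p|triangle_measure. a p * cis (- 2 * pi * (X \<bullet> p))) \<partial>lborel) =
      (\<integral>\<^sup>+ X. indicator (cball 0 R) (0 - X) * ennreal (A (0 - X)) \<partial>lborel)"
    by (intro nn_integral_cong arg_cong2[of _ _ _ _ "(*)"]) (auto simp: A_def indicator_def)
  also have "\<dots> = (\<integral>\<^sup>+ X. indicator (cball 0 R) X * ennreal (A X) \<partial>lborel)"
    by (rule nn_integral_lborel_diff) measurable
  also have "\<dots> \<le> (\<integral>\<^sup>+ X. ennreal (exp pi) * ennreal (gaussian (1 / R) X * A X) \<partial>lborel)"
  proof (rule nn_integral_mono)
    fix X :: "'a \<times> 'a"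
    show "indicator (cball 0 R) X * ennreal (A X) \<le> ennreal (exp pi) * ennreal (gaussian (1 / R) X * A X)"
    proof (cases "norm X \<le> R")
      case True
      then have "(1 / R * norm X)\<^sup>2 \<le> 1" using R by (simp add: power_le_one)
      then have "1 \<le> exp pi * gaussian (1 / R) X"
        by (simp add: gaussian_def flip: exp_add)
      then have "A X \<le> exp pi * (gaussian (1 / R) X * A X)"
        using mult_right_mono[of 1 "exp pi * gaussian (1 / R) X" "A X"] by (simp add: A_def mult.assoc)
      then show ?thesis using True by (simp add: A_def ennreal_leI flip: ennreal_mult)
    qed simp
  qed
  also have "\<dots> = ennreal (exp pi) * (\<integral>\<^sup>+ X. ennreal (gaussian (1 / R) X * A X) \<partial>lborel)"
    by (rule nn_integral_cmult) measurable
  also have "\<dots> \<le> ennreal (exp pi) * (\<integral>\<^sup>+ p. \<integral>\<^sup>+ p'. ennreal (cmod (a p) * cmod (a p') * (R ^ DIM('a \<times> 'a) * gaussian R (p - p'))) \<partial>triangle_measure \<partial>triangle_measure)"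
    unfolding A_def by (intro mult_left_mono gaussian_energy int R T.sigma_finite_measure_axioms) auto
  also have "\<dots> \<le> ennreal (exp pi) * (\<integral>\<^sup>+ p. ennreal (R ^ DIM('a \<times> 'a)) * ennreal ((2 * ?d / R) ^ ?m) \<partial>(triangle_measure :: ('a \<times> 'a) measure))"
  proof (intro mult_left_mono nn_integral_mono_AE)
    show "AE p in triangle_measure. (\<integral>\<^sup>+ p'. ennreal (cmod (a p) * cmod (a p') * (R ^ DIM('a \<times> 'a) * gaussian R (p - p'))) \<partial>triangle_measure)
        \<le> ennreal (R ^ DIM('a \<times> 'a)) * ennreal ((2 * ?d / R) ^ ?m)"
      using AE_triangle_measure
    proof eventually_elim
      fix p :: "'a \<times> 'a" assume p: "p \<in> triangle_set"
      have "(\<integral>\<^sup>+ p'. ennreal (cmod (a p) * cmod (a p') * (R ^ DIM('a \<times> 'a) * gaussian R (p - p'))) \<partial>triangle_measure)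
        \<le> (\<integral>\<^sup>+ p'. ennreal (R ^ DIM('a \<times> 'a)) * ennreal (gaussian R (p - p')) \<partial>triangle_measure)"
      proof (rule nn_integral_mono_AE)
        show "AE p' in triangle_measure. ennreal (cmod (a p) * cmod (a p') * (R ^ DIM('a \<times> 'a) * gaussian R (p - p')))
            \<le> ennreal (R ^ DIM('a \<times> 'a)) * ennreal (gaussian R (p - p'))"
          using AE_triangle_measure
        proof eventually_elim
          fix p' :: "'a \<times> 'a" assume p': "p' \<in> triangle_set"
          have "cmod (a p) * cmod (a p') \<le> 1" using a1[OF p] a1[OF p'] by (simp add: mult_le_one)
          then have "cmod (a p) * cmod (a p') * (R ^ DIM('a \<times> 'a) * gaussian R (p - p')) \<le> 1 * (R ^ DIM('a \<times> 'a) * gaussian R (p - p'))"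
            using R by (intro mult_right_mono) auto
          then show "ennreal (cmod (a p) * cmod (a p') * (R ^ DIM('a \<times> 'a) * gaussian R (p - p')))
            \<le> ennreal (R ^ DIM('a \<times> 'a)) * ennreal (gaussian R (p - p'))"
            using R by (subst ennreal_mult[symmetric]) (auto intro: ennreal_leI)
        qed
      qed
      also have "\<dots> = ennreal (R ^ DIM('a \<times> 'a)) * (\<integral>\<^sup>+ p'. ennreal (gaussian R (p - p')) \<partial>triangle_measure)"
        by (rule nn_integral_cmult) measurable
      also have "\<dots> \<le> ennreal (R ^ DIM('a \<times> 'a)) * ennreal ((2 * ?d / R) ^ ?m)"
        by (intro mult_left_mono triangle_frostman p R dim) simp
      finally show "(\<integral>\<^sup>+ p'. ennreal (cmod (a p) * cmod (a p') * (R ^ DIM('a \<times> 'a) * gaussian R (p - p'))) \<partial>triangle_measure)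
        \<le> ennreal (R ^ DIM('a \<times> 'a)) * ennreal ((2 * ?d / R) ^ ?m)" .
    qed
  qed simp
  also have "\<dots> \<le> ennreal (exp pi) * (ennreal (R ^ DIM('a \<times> 'a)) * ennreal ((2 * ?d / R) ^ ?m) * 1)"
    by (subst nn_integral_const) (intro mult_left_mono, use emeasure_triangle_measure_UNIV_le in auto)
  also have "\<dots> = ennreal (exp pi * (2 * ?d) ^ ?m * R ^ 3)"
  proof -
    have "DIM('a \<times> 'a) = ?m + 3" using dim by simp
    then have "R ^ DIM('a \<times> 'a) * (2 * ?d / R) ^ ?m = (2 * ?d) ^ ?m * R ^ 3"
      using R by (simp only: power_add power_divide) simp
    then have "exp pi * (R ^ DIM('a \<times> 'a) * (2 * ?d / R) ^ ?m) = exp pi * (2 * ?d) ^ ?m * R ^ 3"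
      by (simp only: mult.assoc)
    moreover have "ennreal (exp pi) * (ennreal (R ^ DIM('a \<times> 'a)) * ennreal ((2 * ?d / R) ^ ?m) * 1) =
        ennreal (exp pi * (R ^ DIM('a \<times> 'a) * (2 * ?d / R) ^ ?m))"
      using R by (subst ennreal_mult[symmetric], simp, simp, subst mult_1_right, subst ennreal_mult[symmetric]) simp_all
    ultimately show ?thesis by (simp only:)
  qed
  finally show ?thesis .
qed

definition tri_mult :: "'a::euclidean_space \<times> 'a \<Rightarrow> complex" where
  "tri_mult X = (LINT p|triangle_measure. cis (- 2 * pi * (X \<bullet> p)))"

text \<open>Up to the factor -2 pi i this is the radial derivative of the multiplier: the derivative
  of \<open>tri_mult (t *\<^sub>R X)\<close> in t at t = 1.\<close>

definition tri_mult_deriv :: "'a::euclidean_space \<times> 'a \<Rightarrow> complex" where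
  "tri_mult_deriv X = (LINT p|triangle_measure. complex_of_real (X \<bullet> p) * cis (- 2 * pi * (X \<bullet> p)))"

lemma tri_mult_measurable [measurable]: "tri_mult \<in> borel_measurable (borel :: ('a::euclidean_space \<times> 'a) measure)"
proof -
  interpret T: finite_measure "triangle_measure :: ('a \<times> 'a) measure" by (rule finite_triangle_measure)
  show ?thesis unfolding tri_mult_def[abs_def] by measurable
qed

lemma tri_mult_deriv_measurable [measurable]: "tri_mult_deriv \<in> borel_measurable (borel :: ('a::euclidean_space \<times> 'a) measure)"
proof -
  interpret T: finite_measure "triangle_measure :: ('a \<times> 'a) measure" by (rule finite_triangle_measure)
  show ?thesis unfolding tri_mult_deriv_def[abs_def] by measurable
qed

lemma triangle_integral_orthogonal:
  fixes f :: "'a::euclidean_space \<times> 'a \<Rightarrow> complex" and U :: "'a \<Rightarrow> 'a"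
  assumes U: "orthogonal_transformation U" and [measurable]: "f \<in> borel_measurable borel"
  shows "(LINT p|triangle_measure. f (map_prod U U p)) = (LINT p|triangle_measure. f p)"
proof -
  note m = orthogonal_transformation_measurable(2)[OF U]
  have "(LINT p|triangle_measure. f p) = (LINT p|distr triangle_measure borel (map_prod U U). f p)"
    by (simp only: triangle_measure_orthogonal[OF U])
  also have "\<dots> = (LINT p|triangle_measure. f (map_prod U U p))"
    using m by (intro integral_distr) auto
  finally show ?thesis by simp
qed

lemma inner_map_prod_orthogonal:
  assumes "orthogonal_transformation U"
  shows "map_prod U U X \<bullet> map_prod U U p = X \<bullet> p"
  using assms by (simp add: inner_prod_def orthogonal_transformation_def)

lemma tri_mult_orthogonal:
  fixes X :: "'a::euclidean_space \<times> 'a" and U :: "'a \<Rightarrow> 'a"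
  assumes "orthogonal_transformation U"
  shows "tri_mult (map_prod U U X) = tri_mult X" "tri_mult_deriv (map_prod U U X) = tri_mult_deriv X"
  unfolding tri_mult_def tri_mult_deriv_def
  by (subst triangle_integral_orthogonal[OF assms, symmetric]; simp add: inner_map_prod_orthogonal[OF assms])+

lemma tri_mult_L2:
  assumes "R > 0" "DIM('a::euclidean_space) \<ge> 2"
  shows "(\<integral>\<^sup>+ X. indicator (cball 0 R) X * csq (tri_mult (X :: 'a \<times> 'a)) \<partial>lborel)
    \<le> ennreal (exp pi * (2 * real DIM('a)) ^ (2 * DIM('a) - 3) * R ^ 3)"
  using triangle_fourier_L2[of "\<lambda>_. 1", OF _ _ assms] unfolding tri_mult_def by simp

text \<open>Expanding X \<bullet> p in coordinates and applying Cauchy--Schwarz to the sum separates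
  |X|^2, at most R^2, from 2d transforms whose amplitudes p \<bullet> B are bounded by 1 on
  triangles. This accounts for R^5 in place of R^3 and for one more factor 2d.\<close>

lemma tri_mult_deriv_L2:
  assumes R: "R > 0" and dim: "DIM('a::euclidean_space) \<ge> 2"
  shows "(\<integral>\<^sup>+ X. indicator (cball 0 R) X * csq (tri_mult_deriv (X :: 'a \<times> 'a)) \<partial>lborel)
    \<le> ennreal (exp pi * (2 * real DIM('a)) ^ (2 * DIM('a) - 2) * R ^ 5)"
proof -
  interpret T: finite_measure "triangle_measure :: ('a \<times> 'a) measure" by (rule finite_triangle_measure)
  define A where "A B X = (LINT p|triangle_measure. complex_of_real (p \<bullet> B) * cis (- 2 * pi * (X \<bullet> p)))" for B X :: "'a \<times> 'a"
  have [measurable]: "A B \<in> borel_measurable borel" for B unfolding A_def by measurable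
  have [measurable]: "cball (0 :: 'a \<times> 'a) R \<in> sets borel" by simp
  have int: "integrable triangle_measure (\<lambda>p. complex_of_real (p \<bullet> B) * cis (- 2 * pi * (X \<bullet> p)))" if "B \<in> Basis" for B X :: "'a \<times> 'a"
  proof (rule T.integrable_const_bound)
    show "AE p in triangle_measure. cmod (complex_of_real (p \<bullet> B) * cis (- 2 * pi * (X \<bullet> p))) \<le> 1"
      using AE_triangle_measure
      by eventually_elim (simp add: norm_mult triangle_set_inner_Basis that)
  qed simp
  have bd: "(cmod (tri_mult_deriv X))\<^sup>2 \<le> (norm X)\<^sup>2 * (\<Sum>B\<in>Basis. (cmod (A B X))\<^sup>2)" for X :: "'a \<times> 'a"
  proof -
    have "tri_mult_deriv X = (LINT p|triangle_measure. (\<Sum>B\<in>Basis. complex_of_real (X \<bullet> B) * (complex_of_real (p \<bullet> B) * cis (- 2 * pi * (X \<bullet> p)))))"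
      unfolding tri_mult_deriv_def
      by (intro Bochner_Integration.integral_cong refl)
         (subst (1) euclidean_inner, simp add: sum_distrib_right mult.assoc)
    also have "\<dots> = (\<Sum>B\<in>Basis. complex_of_real (X \<bullet> B) * A B X)"
      unfolding A_def by (subst Bochner_Integration.integral_sum; (intro integrable_mult_right int)?; simp)
    finally have "cmod (tri_mult_deriv X) \<le> (\<Sum>B\<in>Basis. \<bar>X \<bullet> B\<bar> * cmod (A B X))"
      by (simp add: order_trans[OF norm_sum] norm_mult)
    then have "(cmod (tri_mult_deriv X))\<^sup>2 \<le> (\<Sum>B\<in>Basis. \<bar>X \<bullet> B\<bar> * cmod (A B X))\<^sup>2"
      by (intro power_mono) auto
    also have "\<dots> \<le> (\<Sum>B\<in>Basis. \<bar>X \<bullet> B\<bar>\<^sup>2) * (\<Sum>B\<in>Basis. (cmod (A B X))\<^sup>2)"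
      by (rule Cauchy_Schwarz_ineq_sum)
    also have "(\<Sum>B\<in>Basis. \<bar>X \<bullet> B\<bar>\<^sup>2) = (norm X)\<^sup>2"
      unfolding power2_norm_eq_inner euclidean_inner[of X X] by (simp add: power2_eq_square)
    finally show ?thesis .
  qed
  let ?C = "exp pi * (2 * real DIM('a)) ^ (2 * DIM('a) - 3) * R ^ 3"
  have "(\<integral>\<^sup>+ X. indicator (cball 0 R) X * csq (tri_mult_deriv (X :: 'a \<times> 'a)) \<partial>lborel)
    \<le> (\<integral>\<^sup>+ X. ennreal (R\<^sup>2) * (\<Sum>B\<in>Basis. indicator (cball 0 R) X * csq (A B X)) \<partial>lborel)"
  proof (rule nn_integral_mono)
    fix X :: "'a \<times> 'a"
    show "indicator (cball 0 R) X * csq (tri_mult_deriv X) \<le> ennreal (R\<^sup>2) * (\<Sum>B\<in>Basis. indicator (cball 0 R) X * csq (A B X))"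
    proof (cases "norm X \<le> R")
      case True
      have "(cmod (tri_mult_deriv X))\<^sup>2 \<le> R\<^sup>2 * (\<Sum>B\<in>Basis. (cmod (A B X))\<^sup>2)"
        using True by (intro order_trans[OF bd] mult_right_mono power_mono sum_nonneg) auto
      then show ?thesis using True
        by (simp add: ennreal_leI sum_nonneg flip: ennreal_mult)
    qed simp
  qed
  also have "\<dots> = ennreal (R\<^sup>2) * (\<Sum>B\<in>Basis. \<integral>\<^sup>+ X. indicator (cball 0 R) X * csq (A B X) \<partial>lborel)"
    by (subst nn_integral_cmult, measurable, subst nn_integral_sum) auto
  also have "\<dots> \<le> ennreal (R\<^sup>2) * (\<Sum>B\<in>(Basis :: ('a \<times> 'a) set). ennreal ?C)"
  proof (intro mult_left_mono sum_mono)
    fix B :: "'a \<times> 'a" assume B: "B \<in> Basis"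
    show "(\<integral>\<^sup>+ X. indicator (cball 0 R) X * csq (A B X) \<partial>lborel) \<le> ennreal ?C"
      unfolding A_def by (rule triangle_fourier_L2[OF _ _ R dim]) (auto simp: triangle_set_inner_Basis B)
  qed simp
  also have "\<dots> = ennreal (R\<^sup>2 * (real (2 * DIM('a)) * ?C))"
  proof -
    have "(\<Sum>B\<in>(Basis :: ('a \<times> 'a) set). ennreal ?C) = ennreal (real (2 * DIM('a)) * ?C)"
      using R by (subst sum_ennreal, simp) (simp only: sum_constant DIM_prod mult_2)
    then show ?thesis
      using R by (simp only:) (subst ennreal_mult, auto)
  qed
  also have "R\<^sup>2 * (real (2 * DIM('a)) * ?C) = exp pi * (2 * real DIM('a)) ^ (2 * DIM('a) - 2) * R ^ 5"
  proof -
    have "2 * DIM('a) - 2 = Suc (2 * DIM('a) - 3)" using dim by simp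
    then show ?thesis by (simp add: numeral_eq_Suc)
  qed
  finally show ?thesis .
qed

text \<open>Integrating over dilations \<open>t\<close> and using rotation invariance replaces a pointwise decay estimate
  at \<open>\<xi>\<close> by an average over a ball of comparable frequencies.\<close>

lemma dilation_average:
  fixes \<Phi> :: "'a::euclidean_space \<times> 'a \<Rightarrow> ennreal"
  assumes [measurable]: "\<Phi> \<in> borel_measurable borel"
    and inv: "\<And>U X. orthogonal_transformation U \<Longrightarrow> \<Phi> (map_prod U U X) = \<Phi> X"
    and r: "norm \<xi> = r" "r > 0"
  shows "(\<integral>\<^sup>+ t. indicator {1..2} t * (\<integral>\<^sup>+ \<eta>. indicator {\<eta>. norm \<eta> \<le> norm \<xi>} \<eta> * \<Phi> (t *\<^sub>R \<xi>, t *\<^sub>R \<eta>) \<partial>lborel) \<partial>lborel)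
    \<le> ennreal (4 * 4 ^ DIM('a) / (unit_ball_vol (real DIM('a)) * r ^ DIM('a))) *
       (\<integral>\<^sup>+ X. indicator (cball 0 (8 * r)) X * \<Phi> X \<partial>lborel)" (is "?J \<le> _ * ?M")
proof -
  let ?d = "DIM('a)"
  \<comment> \<open>The slice of the integral at first frequency x. Rotating both frequencies
    together preserves \<Phi>, the constraint on y and Lebesgue measure, so \<kappa> depends only on
    the norm of x.\<close>
  define \<kappa> where "\<kappa> x = (\<integral>\<^sup>+ y. indicator {y. norm y \<le> norm x} y * \<Phi> (x, y) \<partial>lborel)" for x
  have [measurable]: "\<kappa> \<in> borel_measurable borel"
    unfolding \<kappa>_def indicator_def mem_Collect_eq by measurable
  have \<kappa>U: "\<kappa> (U x) = \<kappa> x" if U: "orthogonal_transformation U" for U x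
  proof -
    have n: "norm (U x) = norm x" for x
      using U by (auto simp: orthogonal_transformation)
    note [measurable] = orthogonal_transformation_measurable(1)[OF U]
    have "\<kappa> (U x) = (\<integral>\<^sup>+ y. indicator {y. norm y \<le> norm (U x)} y * \<Phi> (U x, y) \<partial>distr lborel borel U)"
      unfolding \<kappa>_def by (simp only: lborel_distr_orthogonal[OF U])
    also have "\<dots> = (\<integral>\<^sup>+ y. indicator {y. norm y \<le> norm (U x)} (U y) * \<Phi> (U x, U y) \<partial>lborel)"
      by (rule nn_integral_distr) (simp, simp add: indicator_def)
    also have "\<dots> = \<kappa> x"
      unfolding \<kappa>_def using inv[OF U, of "(x, _)"] by (simp add: n indicator_def)
    finally show ?thesis .
  qed
  have \<kappa>eq: "\<kappa> x = \<kappa> y" if "norm x = norm y" for x y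
    using ex_reflection[OF that] \<kappa>U by metis
  define L where "L = (\<integral>\<^sup>+ t. indicator {1..2} t * \<kappa> (t *\<^sub>R \<xi>) \<partial>lborel)"
  \<comment> \<open>The substitution of t \<eta> for y produces the factor t^d, which is at least 1
    on the interval of dilations.\<close>
  have "?J \<le> L"
    unfolding L_def
  proof (rule nn_integral_mono)
    fix t :: real
    show "indicator {1..2} t * (\<integral>\<^sup>+ \<eta>. indicator {\<eta>. norm \<eta> \<le> norm \<xi>} \<eta> * \<Phi> (t *\<^sub>R \<xi>, t *\<^sub>R \<eta>) \<partial>lborel) \<le> indicator {1..2} t * \<kappa> (t *\<^sub>R \<xi>)"
    proof (cases "t \<in> {1..2}")
      case True
      then have t: "t \<ge> 1" "t \<noteq> 0" by auto
      have "\<kappa> (t *\<^sub>R \<xi>) = ennreal (\<bar>t\<bar> ^ ?d) * (\<integral>\<^sup>+ \<eta>. indicator {y. norm y \<le> norm (t *\<^sub>R \<xi>)} (0 + t *\<^sub>R \<eta>) * \<Phi> (t *\<^sub>R \<xi>, 0 + t *\<^sub>R \<eta>) \<partial>lborel)"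
        unfolding \<kappa>_def using t by (intro nn_integral_lborel_affine) auto
      also have "\<dots> = ennreal (\<bar>t\<bar> ^ ?d) * (\<integral>\<^sup>+ \<eta>. indicator {\<eta>. norm \<eta> \<le> norm \<xi>} \<eta> * \<Phi> (t *\<^sub>R \<xi>, t *\<^sub>R \<eta>) \<partial>lborel)"
        using t by (simp add: indicator_def)
      also have "\<dots> \<ge> 1 * (\<integral>\<^sup>+ \<eta>. indicator {\<eta>. norm \<eta> \<le> norm \<xi>} \<eta> * \<Phi> (t *\<^sub>R \<xi>, t *\<^sub>R \<eta>) \<partial>lborel)"
        using t by (intro mult_right_mono) (auto simp: one_le_power)
      finally show ?thesis using True by simp
    qed simp
  qed
  obtain e :: 'a where e: "norm e = 1" using vector_choose_size[of 1] by auto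
  \<comment> \<open>The ball of radius r / 2 about this point lies in the shell of norms between r
    and 2 r. Its points x will replace \<xi>, which creates an integration over a region of volume
    comparable to r^d.\<close>
  define a where "a = (3 / 2 * r) *\<^sub>R e"
  have na: "norm a = 3 / 2 * r" using r e by (simp add: a_def)
  have ball: "r \<le> norm x" "norm x \<le> 2 * r" if "x \<in> ball a (r/2)" for x
    using that norm_triangle_ineq2[of a x] norm_triangle_ineq2[of x a] na
    by (auto simp: dist_norm norm_minus_commute)
  \<comment> \<open>Since \<kappa> is radial, its value at t \<xi> is its value at u x with t = l u
    and l = |x| / r between 1 and 2. Hence u stays between 1/2 and 2, and the Jacobian l is at most
    2.\<close>
  have L1: "L \<le> 2 * (\<integral>\<^sup>+ u. indicator {1/2..2} u * \<kappa> (u *\<^sub>R x) \<partial>lborel)" if x: "x \<in> ball a (r/2)" for x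
  proof -
    define l where "l = norm x / r"
    have l: "1 \<le> l" "l \<le> 2" using ball[OF x] r by (auto simp: l_def field_simps)
    have "L = ennreal (\<bar>l\<bar> ^ DIM(real)) * (\<integral>\<^sup>+ u. indicator {1..2} (0 + l *\<^sub>R u) * \<kappa> ((0 + l *\<^sub>R u) *\<^sub>R \<xi>) \<partial>lborel)"
      unfolding L_def using l by (intro nn_integral_lborel_affine) auto
    also have "\<dots> \<le> 2 * (\<integral>\<^sup>+ u. indicator {1/2..2} u * \<kappa> (u *\<^sub>R x) \<partial>lborel)"
    proof (rule mult_mono[OF _ nn_integral_mono])
      show "ennreal (\<bar>l\<bar> ^ DIM(real)) \<le> 2"
        using l by (metis (no_types) DIM_real abs_of_nonneg ennreal_leI ennreal_numeral order_trans power_one_right zero_le_numeral zero_le_one)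
      fix u :: real
      have "indicator {1..2} (l * u) \<le> (indicator {1/2..2} u :: ennreal)"
      proof (cases "l * u \<in> {1..2}")
        case True
        then have "u > 0" using l by (smt (verit) atLeastAtMost_iff zero_less_mult_pos)
        have a: "u \<le> l * u" "l * u \<le> 2 * u" using \<open>u > 0\<close> l by auto
        have b: "1 \<le> l * u" "l * u \<le> 2" using True by auto
        have "u \<le> 2" using a(1) b(2) by (rule order_trans)
        moreover have "1/2 \<le> u" using order_trans[OF b(1) a(2)] by simp
        ultimately have "u \<in> {1/2..2}" by simp
        then show ?thesis by (simp add: indicator_def)
      qed simp
      moreover have "\<kappa> ((l * u) *\<^sub>R \<xi>) = \<kappa> (u *\<^sub>R x)"
        using r l by (intro \<kappa>eq) (auto simp: abs_mult l_def)
      ultimately show "indicator {1..2} (0 + l *\<^sub>R u) * \<kappa> ((0 + l *\<^sub>R u) *\<^sub>R \<xi>) \<le> indicator {1/2..2} u * \<kappa> (u *\<^sub>R x)"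
        by (simp add: mult_right_mono)
    qed auto
    finally show ?thesis .
  qed
  have [measurable]: "cball (0 :: 'a \<times> 'a) (8 * r) \<in> sets borel" by simp
  have [measurable]: "cball (0 :: 'a) (4 * r) \<in> sets borel" by simp
  have [measurable]: "ball a (r/2) \<in> sets borel" by simp
  have \<kappa>M: "(\<integral>\<^sup>+ x. indicator (cball 0 (4 * r)) x * \<kappa> x \<partial>lborel) \<le> ?M"
  proof -
    have "(\<integral>\<^sup>+ x. indicator (cball 0 (4 * r)) x * \<kappa> x \<partial>lborel) =
        (\<integral>\<^sup>+ x. \<integral>\<^sup>+ y. indicator (cball 0 (4 * r)) x * (indicator {y. norm y \<le> norm x} y * \<Phi> (x, y)) \<partial>lborel \<partial>lborel)"
      unfolding \<kappa>_def by (intro nn_integral_cong nn_integral_cmult[symmetric]) (auto simp: indicator_def)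
    also have "\<dots> \<le> (\<integral>\<^sup>+ x. \<integral>\<^sup>+ y. indicator (cball 0 (8 * r)) (x, y) * \<Phi> (x, y) \<partial>lborel \<partial>lborel)"
    proof (intro nn_integral_mono)
      fix x y :: 'a
      have "norm (x, y) \<le> 8 * r" if "norm x \<le> 4 * r" "norm y \<le> norm x"
        using norm_Pair_le[of x y] that by linarith
      then show "indicator (cball 0 (4 * r)) x * (indicator {y. norm y \<le> norm x} y * \<Phi> (x, y)) \<le> indicator (cball 0 (8 * r)) (x, y) * \<Phi> (x, y)"
        by (auto simp: indicator_def)
    qed
    also have "\<dots> = (\<integral>\<^sup>+ X. indicator (cball 0 (8 * r)) X * \<Phi> X \<partial>(lborel \<Otimes>\<^sub>M lborel))"
      by (rule lborel.nn_integral_fst[of "\<lambda>X. indicator (cball 0 (8 * r)) X * \<Phi> X"])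
         (simp only: lborel_prod, measurable)
    also have "\<dots> = ?M" by (simp only: lborel_prod)
    finally show ?thesis .
  qed
  have L2: "(\<integral>\<^sup>+ x. indicator (ball a (r/2)) x * \<kappa> (u *\<^sub>R x) \<partial>lborel) \<le> ennreal (2 ^ ?d) * ?M" if u: "u \<in> {1/2..2}" for u
  proof -
    have "(\<integral>\<^sup>+ x. indicator (ball a (r/2)) x * \<kappa> (u *\<^sub>R x) \<partial>lborel) \<le> (\<integral>\<^sup>+ x. indicator (cball 0 (4 * r)) (u *\<^sub>R x) * \<kappa> (u *\<^sub>R x) \<partial>lborel)"
    proof (intro nn_integral_mono mult_right_mono)
      fix x
      have "norm (u *\<^sub>R x) \<le> 2 * (2 * r)" if "x \<in> ball a (r/2)"
        unfolding norm_scaleR using ball[OF that] u r by (intro mult_mono) auto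
      then show "indicator (ball a (r/2)) x \<le> (indicator (cball 0 (4 * r)) (u *\<^sub>R x) :: ennreal)"
        by (auto simp: indicator_def)
    qed simp
    also have "\<dots> = ennreal ((1/u) ^ ?d) * (ennreal (\<bar>u\<bar> ^ ?d) * (\<integral>\<^sup>+ x. indicator (cball 0 (4 * r)) (0 + u *\<^sub>R x) * \<kappa> (0 + u *\<^sub>R x) \<partial>lborel))"
      using u by (simp add: power_one_over flip: mult.assoc ennreal_mult)
    also have "\<dots> = ennreal ((1/u) ^ ?d) * (\<integral>\<^sup>+ x. indicator (cball 0 (4 * r)) x * \<kappa> x \<partial>lborel)"
      by (subst nn_integral_lborel_affine[symmetric], measurable) (use u in auto)
    also have "\<dots> \<le> ennreal (2 ^ ?d) * ?M"
    proof (intro mult_mono \<kappa>M ennreal_leI power_mono)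
      show "1 / u \<le> 2" "0 \<le> 1 / u" using u by (auto simp: field_simps)
    qed auto
    finally show ?thesis .
  qed
  \<comment> \<open>Integrate \<open>L1\<close> over the ball, exchange the order and apply
    \<open>L2\<close> for each u. The constant collects 2 from the Jacobian, the length 3/2 of the
    u-interval rounded up to 2, and 2^d from rescaling by u; the volume of a ball of radius r / 2
    then contributes another 2^d.\<close>
  have "emeasure lborel (ball a (r/2)) * L = (\<integral>\<^sup>+ x. indicator (ball a (r/2)) x * L \<partial>lborel)"
    by (subst nn_integral_multc) (auto intro!: borel_measurable_indicator)
  also have "\<dots> \<le> (\<integral>\<^sup>+ x. \<integral>\<^sup>+ u. 2 * (indicator {1/2..2} u * (indicator (ball a (r/2)) x * \<kappa> (u *\<^sub>R x))) \<partial>lborel \<partial>lborel)"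
  proof (rule nn_integral_mono)
    fix x
    show "indicator (ball a (r/2)) x * L \<le> (\<integral>\<^sup>+ u. 2 * (indicator {1/2..2} u * (indicator (ball a (r/2)) x * \<kappa> (u *\<^sub>R x))) \<partial>lborel)"
      by (cases "x \<in> ball a (r/2)") (use L1 in \<open>auto simp: nn_integral_cmult\<close>)
  qed
  also have "\<dots> = (\<integral>\<^sup>+ u. \<integral>\<^sup>+ x. 2 * (indicator {1/2..2} u * (indicator (ball a (r/2)) x * \<kappa> (u *\<^sub>R x))) \<partial>lborel \<partial>lborel)"
    by (rule lborel_pair.Fubini') measurable
  also have "\<dots> = (\<integral>\<^sup>+ u. 2 * (indicator {1/2..2} u * (\<integral>\<^sup>+ x. indicator (ball a (r/2)) x * \<kappa> (u *\<^sub>R x) \<partial>lborel)) \<partial>lborel)"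
    by (simp add: nn_integral_cmult)
  also have "\<dots> \<le> (\<integral>\<^sup>+ u. indicator {1/2..2::real} u * (2 * (ennreal (2 ^ ?d) * ?M)) \<partial>lborel)"
  proof (rule nn_integral_mono)
    fix u :: real
    show "2 * (indicator {1/2..2} u * (\<integral>\<^sup>+ x. indicator (ball a (r/2)) x * \<kappa> (u *\<^sub>R x) \<partial>lborel)) \<le> indicator {1/2..2} u * (2 * (ennreal (2 ^ ?d) * ?M))"
      by (cases "u \<in> {1/2..2}") (use L2 in \<open>auto intro: mult_left_mono\<close>)
  qed
  also have "\<dots> = ennreal (3/2) * (2 * (ennreal (2 ^ ?d) * ?M))"
    by (simp add: nn_integral_multc)
  also have "\<dots> \<le> ennreal 2 * (ennreal 2 * (ennreal (2 ^ ?d) * ?M))"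
    by (intro mult_mono ennreal_leI) auto
  also have "\<dots> = ennreal (2 * (2 * 2 ^ ?d)) * ?M"
    by (subst (1 2) ennreal_mult_mult) simp_all
  also have "2 * (2 * 2 ^ ?d) = 4 * (2::real) ^ ?d" by simp
  finally have fin: "emeasure lborel (ball a (r/2)) * L \<le> ennreal (4 * 2 ^ ?d) * ?M" .
  let ?v = "unit_ball_vol (real ?d) * (r/2) ^ ?d"
  have v: "?v > 0" using r unit_ball_vol_pos[of "real ?d"] by simp
  have ev: "emeasure lborel (ball a (r/2)) = ennreal ?v" using r by (simp add: emeasure_ball)
  have "L = ennreal (1 / ?v) * (ennreal ?v * L)"
  proof -
    have "1 / w * w = 1" if "w > 0" for w :: real using that by simp
    note this[OF v]
    then show ?thesis by (subst ennreal_mult_mult) (simp_all only: order_less_imp_le[OF v] zero_le_divide_1_iff ennreal_1 mult_1_left)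
  qed
  also have "\<dots> \<le> ennreal (1 / ?v) * (ennreal (4 * 2 ^ ?d) * ?M)"
    using fin unfolding ev by (rule mult_left_mono) simp
  also have "\<dots> = ennreal (1 / ?v * (4 * 2 ^ ?d)) * ?M"
    using v by (subst ennreal_mult_mult) simp_all
  also have "1 / ?v * (4 * 2 ^ ?d) = 4 * 4 ^ ?d / (unit_ball_vol (real ?d) * r ^ ?d)"
  proof -
    have "(4::real) ^ ?d = 2 ^ ?d * 2 ^ ?d" by (simp flip: power_mult_distrib)
    then show ?thesis by (simp add: power_divide)
  qed
  finally show ?thesis using \<open>?J \<le> L\<close> by (rule order_trans[rotated])
qed

section \<open>Bilinear multipliers and the supremum over dilations\<close>

lemma measurable_kernel:
  fixes k :: "real \<Rightarrow> 'a::euclidean_space \<times> 'a \<Rightarrow> complex"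
  assumes k: "case_prod k \<in> borel_measurable (borel \<Otimes>\<^sub>M borel)"
    and [measurable]: "f \<in> borel_measurable N" "g \<in> borel_measurable N" "h \<in> borel_measurable N"
  shows "(\<lambda>x. k (f x) (g x, h x)) \<in> borel_measurable N"
proof -
  have "(\<lambda>x. (f x, (g x, h x))) \<in> measurable N (borel \<Otimes>\<^sub>M borel)"
    by (simp add: borel_prod[symmetric])
  from measurable_compose[OF this k] show ?thesis by simp
qed

lemma borel_measurable_fst_snd [measurable]:
  "fst \<in> borel_measurable (borel :: ('a::second_countable_topology \<times> 'b::second_countable_topology) measure)"
  "snd \<in> borel_measurable (borel :: ('a::second_countable_topology \<times> 'b::second_countable_topology) measure)"
  by (auto intro!: borel_measurable_continuous_onI continuous_intros)

lemma nn_integral_shear: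
  fixes f :: "'a::euclidean_space \<times> 'a \<Rightarrow> ennreal"
  assumes f [measurable]: "f \<in> borel_measurable borel"
  shows "(\<integral>\<^sup>+ X. f (fst X - snd X, snd X) \<partial>lborel) = (\<integral>\<^sup>+ X. f X \<partial>lborel)"
proof -
  have [measurable]: "f \<in> borel_measurable (borel \<Otimes>\<^sub>M borel)" using f by (simp add: borel_prod)
  have "(\<integral>\<^sup>+ X. f (fst X - snd X, snd X) \<partial>(lborel \<Otimes>\<^sub>M lborel)) = (\<integral>\<^sup>+ y. \<integral>\<^sup>+ x. f (x - y, y) \<partial>lborel \<partial>lborel)"
    by (subst lborel_pair.nn_integral_snd[symmetric]) simp_all
  also have "\<dots> = (\<integral>\<^sup>+ y. \<integral>\<^sup>+ x. f (x, y) \<partial>lborel \<partial>lborel)"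
  proof (rule nn_integral_cong)
    fix y
    show "(\<integral>\<^sup>+ x. f (x - y, y) \<partial>lborel) = (\<integral>\<^sup>+ x. f (x, y) \<partial>lborel)"
      using nn_integral_lborel_translate[of "\<lambda>x. f (x, y)" "- y"] by simp
  qed
  also have "\<dots> = (\<integral>\<^sup>+ X. f X \<partial>(lborel \<Otimes>\<^sub>M lborel))"
    by (subst lborel_pair.nn_integral_snd) simp_all
  finally show ?thesis by (simp add: lborel_prod)
qed

lemma distr_lborel_shear:
  "distr lborel borel (\<lambda>X. (fst X - snd X, snd X)) = (lborel :: ('a::euclidean_space \<times> 'a) measure)"
proof (rule measure_eqI)
  let ?S = "\<lambda>X::'a \<times> 'a. (fst X - snd X, snd X)"
  have [measurable]: "?S \<in> borel_measurable borel"
    by (intro borel_measurable_continuous_onI continuous_intros)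
  fix A assume "A \<in> sets (distr lborel borel ?S)"
  then have A [measurable]: "A \<in> sets borel" by simp
  have "emeasure (distr lborel borel ?S) A = (\<integral>\<^sup>+ X. indicator A X \<partial>distr lborel borel ?S)"
    by simp
  also have "\<dots> = (\<integral>\<^sup>+ X. indicator A (?S X) \<partial>lborel)"
    by (rule nn_integral_distr) simp_all
  also have "\<dots> = (\<integral>\<^sup>+ X. indicator A X \<partial>lborel)"
    by (rule nn_integral_shear) measurable
  finally show "emeasure (distr lborel borel ?S) A = emeasure lborel A" by simp
qed simp

text \<open>The factor \<open>F\<close> carries the larger frequency: the Cauchy--Schwarz inequality is applied on the
  product of all variables, so that only the \<open>L\<^sup>2\<close> norm of the kernel in \<open>(t, \<eta>)\<close> at fixed \<open>\<xi>\<close> enters.\<close>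

lemma bilinear_kernel_L2:
  fixes F G :: "'a::euclidean_space \<Rightarrow> complex" and k :: "real \<Rightarrow> 'a \<times> 'a \<Rightarrow> complex"
  assumes T: "finite_measure T" and T_sets [measurable_cong]: "sets T = sets borel"
    and F: "integrable lborel F" and G: "integrable lborel G" and BF: "\<And>\<xi>. cmod (F \<xi>) \<le> BF"
    and km: "case_prod k \<in> borel_measurable (borel \<Otimes>\<^sub>M borel)" and B: "\<And>t X. cmod (k t X) \<le> B"
    and S: "\<And>\<xi>. (\<integral>\<^sup>+ t. \<integral>\<^sup>+ \<eta>. csq (k t (\<xi>, \<eta>)) \<partial>lborel \<partial>T) \<le> S"
  shows "(\<integral>\<^sup>+ x. \<integral>\<^sup>+ t. csq (LINT X|lborel. F (fst X) * G (snd X) * k t X *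
        cis (2 * pi * (x \<bullet> (fst X + snd X)))) \<partial>T \<partial>lborel)
    \<le> S * (\<integral>\<^sup>+ \<xi>. csq (F \<xi>) \<partial>lborel) * (\<integral>\<^sup>+ \<eta>. csq (G \<eta>) \<partial>lborel)"
proof -
  interpret T: finite_measure T by fact
  interpret TL: pair_sigma_finite T "lborel :: 'a measure" ..
  interpret LT: pair_sigma_finite "lborel :: 'a measure" T ..
  have Fm [measurable]: "F \<in> borel_measurable borel" and Gm [measurable]: "G \<in> borel_measurable borel"
    using F G by auto
  note km' [measurable] = measurable_kernel[OF km]
  have B0: "B \<ge> 0" using B[of 0 0] norm_ge_zero[of "k 0 0"] by linarith
  define \<Psi> where "\<Psi> t X = F (fst X) * G (snd X) * k t X" for t X
  \<comment> \<open>The Fourier transform in x of the bilinear expression, at output frequency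
    \<zeta> = \<xi> + \<eta>; \<open>u_eq\<close> confirms it, so \<open>plancherel_le\<close>
    reduces the claim to a bound for the square integral X of H.\<close>
  define H where "H t \<zeta> = (LINT \<eta>|lborel. \<Psi> t (\<zeta> - \<eta>, \<eta>))" for t \<zeta>
  define u where "u t x = (LINT X|lborel. \<Psi> t X * cis (2 * pi * (x \<bullet> (fst X + snd X))))" for t x
  have kX [measurable]: "k t \<in> borel_measurable borel" for t
    using measurable_compose[OF measurable_Pair1'[of t borel borel] km] by simp
  have kX' [measurable]: "k t \<in> borel_measurable (borel \<Otimes>\<^sub>M borel)" for t
    using kX by (simp add: borel_prod)
  have \<Psi>m [measurable]: "(\<lambda>x. \<Psi> (f x) (g x, h x)) \<in> borel_measurable N"
    if [measurable]: "f \<in> borel_measurable N" "g \<in> borel_measurable N" "h \<in> borel_measurable N" for N :: "'z measure" and f g h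
    unfolding \<Psi>_def by simp
  have Hm [measurable]: "(\<lambda>(t, \<zeta>). H t \<zeta>) \<in> borel_measurable (borel \<Otimes>\<^sub>M borel)"
    unfolding H_def by measurable
  have FG: "integrable lborel (\<lambda>X. F (fst X) * G (snd X))"
    using lborel_pair.integrable_pair_mult[OF F G] by (simp add: lborel_prod split_beta')
  have \<Psi>X [measurable]: "\<Psi> t \<in> borel_measurable borel" for t
    using \<Psi>m[of "\<lambda>_. t" "borel" fst snd] by (simp add: borel_prod[symmetric])
  have \<Psi>int: "integrable lborel (\<Psi> t)" for t
  proof (rule Bochner_Integration.integrable_bound)
    show "integrable lborel (\<lambda>X. complex_of_real B * (F (fst X) * G (snd X)))"
      using FG by (rule integrable_mult_right)
    show "AE X in lborel. norm (\<Psi> t X) \<le> norm (complex_of_real B * (F (fst X) * G (snd X)))"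
      using B B0 by (intro always_eventually allI) (simp add: \<Psi>_def norm_mult mult.commute mult_left_mono mult_right_mono)
  qed simp
  have Sm: "(\<lambda>X::'a \<times> 'a. (fst X - snd X, snd X)) \<in> measurable lborel borel"
  proof -
    have "(\<lambda>X::'a \<times> 'a. (fst X - snd X, snd X)) \<in> borel_measurable borel"
      by (intro borel_measurable_continuous_onI continuous_intros)
    then show ?thesis by simp
  qed
  have shint: "integrable lborel (\<lambda>X. \<Psi> t (fst X - snd X, snd X))" for t
    using \<Psi>int[of t] integrable_distr_eq[OF Sm, of "\<Psi> t"] by (simp add: distr_lborel_shear)
  have Hint: "integrable lborel (H t)" for t
    using lborel_pair.integrable_fst'[of "\<lambda>X. \<Psi> t (fst X - snd X, snd X)"] shint[of t]
    by (simp add: lborel_prod H_def[abs_def])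
  have u_eq: "u t x = (LINT \<zeta>|lborel. H t \<zeta> * cis (2 * pi * (x \<bullet> \<zeta>)))" for t x
  proof -
    have "u t x = (LINT X|distr lborel borel (\<lambda>X. (fst X - snd X, snd X)). \<Psi> t X * cis (2 * pi * (x \<bullet> (fst X + snd X))))"
      by (simp only: u_def distr_lborel_shear)
    also have "\<dots> = (LINT X|lborel. \<Psi> t (fst X - snd X, snd X) * cis (2 * pi * (x \<bullet> fst X)))"
      by (subst integral_distr[OF Sm]) simp_all
    also have "\<dots> = (LINT \<zeta>|lborel. LINT \<eta>|lborel. \<Psi> t (\<zeta> - \<eta>, \<eta>) * cis (2 * pi * (x \<bullet> \<zeta>)))"
    proof (subst lborel_pair.integral_fst'[of "\<lambda>X. \<Psi> t (fst X - snd X, snd X) * cis (2 * pi * (x \<bullet> fst X))", symmetric, simplified lborel_prod fst_conv snd_conv])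
      show "integrable lborel (\<lambda>X. \<Psi> t (fst X - snd X, snd X) * cis (2 * pi * (x \<bullet> fst X)))"
        by (rule Bochner_Integration.integrable_bound[OF shint[of t]]) (auto simp: norm_mult)
    qed simp
    also have "\<dots> = (LINT \<zeta>|lborel. H t \<zeta> * cis (2 * pi * (x \<bullet> \<zeta>)))"
      unfolding H_def by (intro Bochner_Integration.integral_cong refl integral_mult_left_zero)
    finally show ?thesis .
  qed
  define X where "X = (\<integral>\<^sup>+ t. \<integral>\<^sup>+ \<zeta>. csq (H t \<zeta>) \<partial>lborel \<partial>T)"
  define nF where "nF = (\<integral>\<^sup>+ \<xi>. csq (F \<xi>) \<partial>lborel)"
  define nG where "nG = (\<integral>\<^sup>+ \<eta>. csq (G \<eta>) \<partial>lborel)"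
  have um: "(\<lambda>(x, t). u t x) \<in> borel_measurable (lborel \<Otimes>\<^sub>M T)"
    unfolding u_eq by measurable
  have "(\<integral>\<^sup>+ x. \<integral>\<^sup>+ t. csq (u t x) \<partial>T \<partial>lborel) = (\<integral>\<^sup>+ t. \<integral>\<^sup>+ x. csq (u t x) \<partial>lborel \<partial>T)"
    using um by (intro LT.Fubini'[symmetric]) simp
  also have "\<dots> \<le> X"
    unfolding X_def u_eq by (intro nn_integral_mono plancherel_le Hint)
  finally have uX: "(\<integral>\<^sup>+ x. \<integral>\<^sup>+ t. csq (u t x) \<partial>T \<partial>lborel) \<le> X" .
  have Hbd: "ennreal (cmod (H t \<zeta>)) \<le> (\<integral>\<^sup>+ \<eta>. ennreal (cmod (\<Psi> t (\<zeta> - \<eta>, \<eta>))) \<partial>lborel)" for t \<zeta>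
  proof (cases "integrable lborel (\<lambda>\<eta>. \<Psi> t (\<zeta> - \<eta>, \<eta>))")
    case True
    then show ?thesis unfolding H_def by (rule integral_norm_bound_ennreal)
  next
    \<comment> \<open>The Bochner integral of a non-integrable function is 0 by convention, so the
      bound is trivial for such \<zeta>.\<close>
    case False
    then show ?thesis by (simp add: H_def not_integrable_integral_eq)
  qed
  \<comment> \<open>Finiteness allows one factor X to be cancelled at the end. The pointwise bounds
    B and BF are used only qualitatively and do not enter the final constant.\<close>
  have X_fin: "X < \<infinity>"
  proof -
    obtain nG1 where nG1: "(\<integral>\<^sup>+ \<eta>. ennreal (cmod (G \<eta>)) \<partial>lborel) = ennreal nG1" "nG1 \<ge> 0"
      using G by (cases "(\<integral>\<^sup>+ \<eta>. ennreal (cmod (G \<eta>)) \<partial>lborel)") (auto simp: integrable_iff_bounded)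
    have BF0: "BF \<ge> 0" using BF[of 0] norm_ge_zero[of "F 0"] by linarith
    define c where "c = BF * B * nG1"
    have c0: "c \<ge> 0" using BF0 B0 nG1 by (simp add: c_def)
    have Hc: "cmod (H t \<zeta>) \<le> c" for t \<zeta>
    proof -
      have "ennreal (cmod (H t \<zeta>)) \<le> (\<integral>\<^sup>+ \<eta>. ennreal (BF * B) * ennreal (cmod (G \<eta>)) \<partial>lborel)"
      proof (intro order_trans[OF Hbd] nn_integral_mono)
        fix \<eta>
        have "cmod (\<Psi> t (\<zeta> - \<eta>, \<eta>)) \<le> BF * cmod (G \<eta>) * B"
          unfolding \<Psi>_def norm_mult using BF B BF0 by (intro mult_mono) auto
        then show "ennreal (cmod (\<Psi> t (\<zeta> - \<eta>, \<eta>))) \<le> ennreal (BF * B) * ennreal (cmod (G \<eta>))"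
          using BF0 B0 by (simp add: ennreal_leI mult_ac flip: ennreal_mult)
      qed
      also have "\<dots> = ennreal c"
        using BF0 B0 nG1 by (subst nn_integral_cmult) (simp_all add: c_def ennreal_mult)
      finally show ?thesis using c0 by simp
    qed
    have "X \<le> (\<integral>\<^sup>+ t. \<integral>\<^sup>+ \<zeta>. ennreal c * (\<integral>\<^sup>+ \<eta>. ennreal (B * cmod (F (\<zeta> - \<eta>) * G \<eta>)) \<partial>lborel) \<partial>lborel \<partial>T)"
      unfolding X_def
    proof (intro nn_integral_mono)
      fix t \<zeta>
      have "csq (H t \<zeta>) \<le> ennreal c * ennreal (cmod (H t \<zeta>))"
        using Hc[of t \<zeta>] c0 by (simp add: power2_eq_square ennreal_leI mult_right_mono flip: ennreal_mult)
      also have "\<dots> \<le> ennreal c * (\<integral>\<^sup>+ \<eta>. ennreal (B * cmod (F (\<zeta> - \<eta>) * G \<eta>)) \<partial>lborel)"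
      proof (intro mult_left_mono order_trans[OF Hbd] nn_integral_mono ennreal_leI)
        fix \<eta>
        show "cmod (\<Psi> t (\<zeta> - \<eta>, \<eta>)) \<le> B * cmod (F (\<zeta> - \<eta>) * G \<eta>)"
          using mult_left_mono[OF B[of t "(\<zeta> - \<eta>, \<eta>)"], of "cmod (F (\<zeta> - \<eta>) * G \<eta>)"]
          by (simp add: \<Psi>_def norm_mult mult_ac)
      qed simp
      finally show "csq (H t \<zeta>) \<le> ennreal c * (\<integral>\<^sup>+ \<eta>. ennreal (B * cmod (F (\<zeta> - \<eta>) * G \<eta>)) \<partial>lborel)" .
    qed
    also have "\<dots> = (\<integral>\<^sup>+ t. ennreal c * (\<integral>\<^sup>+ \<zeta>. \<integral>\<^sup>+ \<eta>. ennreal (B * cmod (F (\<zeta> - \<eta>) * G \<eta>)) \<partial>lborel \<partial>lborel) \<partial>T)"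
      by (intro nn_integral_cong nn_integral_cmult) measurable
    also have "(\<integral>\<^sup>+ \<zeta>. \<integral>\<^sup>+ \<eta>. ennreal (B * cmod (F (\<zeta> - \<eta>) * G \<eta>)) \<partial>lborel \<partial>lborel) =
        (\<integral>\<^sup>+ X. ennreal (B * cmod (F (fst X - snd X) * G (snd X))) \<partial>(lborel \<Otimes>\<^sub>M lborel))"
      by (subst lborel.nn_integral_fst[symmetric]) simp_all
    also have "\<dots> = (\<integral>\<^sup>+ X. ennreal (B * cmod (F (fst X) * G (snd X))) \<partial>lborel)"
      using nn_integral_shear[of "\<lambda>X. ennreal (B * cmod (F (fst X) * G (snd X)))"]
      by (simp add: lborel_prod borel_prod[symmetric])
    also have "(\<integral>\<^sup>+ t. ennreal c * \<dots> \<partial>T) < \<infinity>"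
    proof -
      have "integrable lborel (\<lambda>X. complex_of_real B * (F (fst X) * G (snd X)))"
        using FG by (rule integrable_mult_right)
      then have "(\<integral>\<^sup>+ X. ennreal (B * cmod (F (fst X) * G (snd X))) \<partial>lborel) < \<infinity>"
        using B0 by (simp add: integrable_iff_bounded norm_mult)
      then show ?thesis
        using T.emeasure_finite[of "space T"] by (auto simp: ennreal_mult_eq_top_iff less_top[symmetric])
    qed
    finally show ?thesis .
  qed
  \<comment> \<open>H is tested against itself: one factor |H| is kept and the other is bounded by
    the integral of |\<Psi>|, which after the shear gives the integral of f g. The square of f
    integrates to at most S nF because S is uniform in \<xi>, and that of g to nG X by translation
    invariance. Thus X^2 is at most S nF nG X.\<close>
  define f where "f = (\<lambda>(t, \<xi>, \<eta>). ennreal (cmod (F \<xi>) * cmod (k t (\<xi>, \<eta>))))"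
  define g where "g = (\<lambda>(t, \<xi>, \<eta>). ennreal (cmod (G \<eta>) * cmod (H t (\<xi> + \<eta>))))"
  let ?N = "T \<Otimes>\<^sub>M (lborel \<Otimes>\<^sub>M lborel :: ('a \<times> 'a) measure)"
  note LL_fst = sigma_finite_measure.nn_integral_fst[OF lborel_pair.P.sigma_finite_measure_axioms]
  have fm [measurable]: "f \<in> borel_measurable ?N" unfolding f_def by measurable
  have gm [measurable]: "g \<in> borel_measurable ?N" unfolding g_def by measurable
  have "X \<le> (\<integral>\<^sup>+ z. f z * g z \<partial>?N)"
  proof -
    have "X \<le> (\<integral>\<^sup>+ t. \<integral>\<^sup>+ \<zeta>. \<integral>\<^sup>+ \<eta>. ennreal (cmod (H t \<zeta>)) * ennreal (cmod (\<Psi> t (\<zeta> - \<eta>, \<eta>))) \<partial>lborel \<partial>lborel \<partial>T)"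
      unfolding X_def
    proof (intro nn_integral_mono)
      fix t \<zeta>
      have "csq (H t \<zeta>) = ennreal (cmod (H t \<zeta>)) * ennreal (cmod (H t \<zeta>))"
        by (simp add: power2_eq_square ennreal_mult)
      also have "\<dots> \<le> ennreal (cmod (H t \<zeta>)) * (\<integral>\<^sup>+ \<eta>. ennreal (cmod (\<Psi> t (\<zeta> - \<eta>, \<eta>))) \<partial>lborel)"
        by (intro mult_left_mono Hbd) simp
      also have "\<dots> = (\<integral>\<^sup>+ \<eta>. ennreal (cmod (H t \<zeta>)) * ennreal (cmod (\<Psi> t (\<zeta> - \<eta>, \<eta>))) \<partial>lborel)"
        by (rule nn_integral_cmult[symmetric]) measurable
      finally show "csq (H t \<zeta>) \<le> (\<integral>\<^sup>+ \<eta>. ennreal (cmod (H t \<zeta>)) * ennreal (cmod (\<Psi> t (\<zeta> - \<eta>, \<eta>))) \<partial>lborel)" .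
    qed
    also have "\<dots> = (\<integral>\<^sup>+ t. \<integral>\<^sup>+ z. f (t, z) * g (t, z) \<partial>(lborel \<Otimes>\<^sub>M lborel) \<partial>T)"
    proof (rule nn_integral_cong)
      fix t
      have Ht [measurable]: "H t \<in> borel_measurable borel" using Hint[of t] by simp
      define q where "q X = ennreal (cmod (H t (fst X + snd X))) * ennreal (cmod (\<Psi> t (fst X, snd X)))" for X
      have qm [measurable]: "q \<in> borel_measurable (borel \<Otimes>\<^sub>M borel)" unfolding q_def by measurable
      have "(\<integral>\<^sup>+ \<zeta>. \<integral>\<^sup>+ \<eta>. ennreal (cmod (H t \<zeta>)) * ennreal (cmod (\<Psi> t (\<zeta> - \<eta>, \<eta>))) \<partial>lborel \<partial>lborel) =
         (\<integral>\<^sup>+ X. q (fst X - snd X, snd X) \<partial>(lborel \<Otimes>\<^sub>M lborel))"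
        by (subst lborel.nn_integral_fst[symmetric]) (simp_all add: q_def)
      also have "\<dots> = (\<integral>\<^sup>+ X. q X \<partial>(lborel \<Otimes>\<^sub>M lborel))"
        using nn_integral_shear[of q] qm by (simp add: lborel_prod borel_prod[symmetric])
      also have "\<dots> = (\<integral>\<^sup>+ z. f (t, z) * g (t, z) \<partial>(lborel \<Otimes>\<^sub>M lborel))"
        by (intro nn_integral_cong)
           (simp add: q_def f_def g_def \<Psi>_def norm_mult split_beta mult_ac flip: ennreal_mult)
      finally show "(\<integral>\<^sup>+ \<zeta>. \<integral>\<^sup>+ \<eta>. ennreal (cmod (H t \<zeta>)) * ennreal (cmod (\<Psi> t (\<zeta> - \<eta>, \<eta>))) \<partial>lborel \<partial>lborel) =
        (\<integral>\<^sup>+ z. f (t, z) * g (t, z) \<partial>(lborel \<Otimes>\<^sub>M lborel))" .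
    qed
    also have "\<dots> = (\<integral>\<^sup>+ z. f z * g z \<partial>?N)"
      by (rule LL_fst) measurable
    finally show ?thesis .
  qed
  then have "X\<^sup>2 \<le> (\<integral>\<^sup>+ z. f z * g z \<partial>?N)\<^sup>2" by (rule power_mono) simp
  also have "\<dots> \<le> (\<integral>\<^sup>+ z. (f z)\<^sup>2 \<partial>?N) * (\<integral>\<^sup>+ z. (g z)\<^sup>2 \<partial>?N)"
    by (rule Cauchy_Schwarz_nn_integral) measurable
  also have "(\<integral>\<^sup>+ z. (f z)\<^sup>2 \<partial>?N) \<le> S * nF"
  proof -
    have "(\<integral>\<^sup>+ z. (f z)\<^sup>2 \<partial>?N) = (\<integral>\<^sup>+ t. \<integral>\<^sup>+ X. (f (t, X))\<^sup>2 \<partial>(lborel \<Otimes>\<^sub>M lborel) \<partial>T)"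
      by (rule LL_fst[symmetric]) measurable
    also have "\<dots> = (\<integral>\<^sup>+ t. \<integral>\<^sup>+ \<xi>. \<integral>\<^sup>+ \<eta>. csq (F \<xi>) * csq (k t (\<xi>, \<eta>)) \<partial>lborel \<partial>lborel \<partial>T)"
      by (intro nn_integral_cong, subst lborel.nn_integral_fst[symmetric])
         (simp_all add: f_def split_beta ennreal_power power_mult_distrib flip: ennreal_mult)
    also have "\<dots> = (\<integral>\<^sup>+ \<xi>. \<integral>\<^sup>+ t. \<integral>\<^sup>+ \<eta>. csq (F \<xi>) * csq (k t (\<xi>, \<eta>)) \<partial>lborel \<partial>T \<partial>lborel)"
      by (rule LT.Fubini') measurable
    also have "\<dots> = (\<integral>\<^sup>+ \<xi>. csq (F \<xi>) * (\<integral>\<^sup>+ t. \<integral>\<^sup>+ \<eta>. csq (k t (\<xi>, \<eta>)) \<partial>lborel \<partial>T) \<partial>lborel)"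
      by (simp add: nn_integral_cmult)
    also have "\<dots> \<le> (\<integral>\<^sup>+ \<xi>. csq (F \<xi>) * S \<partial>lborel)"
      by (intro nn_integral_mono mult_left_mono S) simp
    also have "\<dots> = S * nF" by (simp add: nn_integral_cmult nF_def mult.commute[of _ S])
    finally show ?thesis .
  qed
  also have "(\<integral>\<^sup>+ z. (g z)\<^sup>2 \<partial>?N) = nG * X"
  proof -
    have "(\<integral>\<^sup>+ z. (g z)\<^sup>2 \<partial>?N) = (\<integral>\<^sup>+ t. \<integral>\<^sup>+ X. (g (t, X))\<^sup>2 \<partial>(lborel \<Otimes>\<^sub>M lborel) \<partial>T)"
      by (rule LL_fst[symmetric]) measurable
    also have "\<dots> = (\<integral>\<^sup>+ t. \<integral>\<^sup>+ \<eta>. \<integral>\<^sup>+ \<xi>. csq (G \<eta>) * csq (H t (\<xi> + \<eta>)) \<partial>lborel \<partial>lborel \<partial>T)"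
      by (intro nn_integral_cong, subst lborel_pair.nn_integral_snd[symmetric])
         (simp_all add: g_def split_beta ennreal_power power_mult_distrib flip: ennreal_mult)
    also have "\<dots> = (\<integral>\<^sup>+ t. nG * (\<integral>\<^sup>+ \<zeta>. csq (H t \<zeta>) \<partial>lborel) \<partial>T)"
    proof (rule nn_integral_cong)
      fix t
      have Ht [measurable]: "H t \<in> borel_measurable borel" using Hint[of t] by simp
      show "(\<integral>\<^sup>+ \<eta>. \<integral>\<^sup>+ \<xi>. csq (G \<eta>) * csq (H t (\<xi> + \<eta>)) \<partial>lborel \<partial>lborel)
        = nG * (\<integral>\<^sup>+ \<zeta>. csq (H t \<zeta>) \<partial>lborel)"
        by (simp add: nn_integral_cmult nn_integral_multc nG_def
          nn_integral_lborel_translate[of "\<lambda>\<zeta>. csq (H t \<zeta>)"])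
    qed
    also have "\<dots> = nG * X" by (simp add: nn_integral_cmult X_def)
    finally show ?thesis .
  qed
  finally have XX: "X\<^sup>2 \<le> S * nF * (nG * X)" by (simp add: mult_right_mono)
  have "X \<le> S * nF * nG"
  proof (cases "X = 0")
    case False
    have "X * X \<le> (S * nF * nG) * X" using XX by (simp add: power2_eq_square mult_ac)
    then have "X * X / X \<le> (S * nF * nG) * X / X" by (rule divide_right_mono_ennreal)
    moreover have "x * X / X = x" for x
      using False X_fin by (intro ennreal_mult_divide_eq) auto
    ultimately show ?thesis by (simp only:)
  qed simp
  with uX show ?thesis unfolding u_def \<Psi>_def nF_def nG_def by (rule order_trans)
qed

section \<open>Sobolev inequality in the dilation parameter\<close>

lemma integral_cis_diff:
  fixes \<theta> :: real
  assumes "s \<le> t"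
  shows "(LINT r|lborel. indicator {s..t} r *\<^sub>R (\<i> * complex_of_real \<theta> * cis (r * \<theta>))) = cis (t * \<theta>) - cis (s * \<theta>)"
proof -
  have "((\<lambda>r. cis (r * \<theta>)) has_vector_derivative (\<i> * complex_of_real \<theta> * cis (r * \<theta>))) (at r within {s..t})" for r
    using exp_scaleR_has_vector_derivative_right[of "\<i> * complex_of_real \<theta>" r "{s..t}"]
    by (simp add: cis_conv_exp scaleR_conv_of_real mult_ac)
  moreover have "continuous_on {s..t} (\<lambda>r. \<i> * complex_of_real \<theta> * cis (r * \<theta>))"
    by (intro continuous_intros)
  ultimately show ?thesis
    using integral_FTC_atLeastAtMost[OF assms, of "\<lambda>r. cis (r * \<theta>)" "\<lambda>r. \<i> * complex_of_real \<theta> * cis (r * \<theta>)"]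
    by simp
qed

text \<open>The difference of the two exponentials is written as an integral over r for each y, and
  Fubini's theorem moves that integral outside. This takes the place of differentiating under the
  integral sign.\<close>

lemma oscillatory_diff_bound:
  fixes c :: "'b \<Rightarrow> complex" and \<theta> :: "'b \<Rightarrow> real"
  assumes "sigma_finite_measure M" and c: "integrable M c" and c\<theta>: "integrable M (\<lambda>y. \<theta> y * c y)"
    and [measurable]: "\<theta> \<in> borel_measurable M" and st: "s \<le> t"
  shows "ennreal (cmod ((LINT y|M. c y * cis (t * \<theta> y)) - (LINT y|M. c y * cis (s * \<theta> y))))
    \<le> (\<integral>\<^sup>+ r. indicator {s..t} r * ennreal (cmod (LINT y|M. \<theta> y * c y * cis (r * \<theta> y))) \<partial>lborel)"
proof -
  interpret M: sigma_finite_measure M by fact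
  interpret LM: pair_sigma_finite "lborel :: real measure" M ..
  have [measurable]: "c \<in> borel_measurable M" using c by simp
  define h where "h = (\<lambda>(r, y). indicator {s..t} r *\<^sub>R (\<i> * (\<theta> y * c y) * cis (r * \<theta> y)))"
  have hm [measurable]: "h \<in> borel_measurable (lborel \<Otimes>\<^sub>M M)" unfolding h_def by measurable
  have h: "integrable (lborel \<Otimes>\<^sub>M M) h"
  proof (rule Bochner_Integration.integrable_bound[OF _ hm])
    have "integrable lborel (\<lambda>r. complex_of_real (indicator {s..t} r))"
      by (intro integrable_of_real integrable_real_indicator) (simp_all add: emeasure_lborel_Icc_eq)
    then show "integrable (lborel \<Otimes>\<^sub>M M) (\<lambda>(r, y). complex_of_real (indicator {s..t} r) * (\<theta> y * c y))"
      by (rule LM.integrable_pair_mult[OF _ c\<theta>])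
  qed (auto simp: h_def norm_mult indicator_def)
  have ci: "integrable M (\<lambda>y. c y * cis (r * \<theta> y))" for r
    by (rule Bochner_Integration.integrable_bound[OF c]) (auto simp: norm_mult)
  have "(LINT y|M. c y * cis (t * \<theta> y)) - (LINT y|M. c y * cis (s * \<theta> y)) = (LINT y|M. c y * (cis (t * \<theta> y) - cis (s * \<theta> y)))"
    by (subst Bochner_Integration.integral_diff[symmetric, OF ci ci]) (simp add: algebra_simps)
  also have "\<dots> = (LINT y|M. LINT r|lborel. h (r, y))"
  proof (intro Bochner_Integration.integral_cong refl)
    fix y
    have "(LINT r|lborel. h (r, y)) = (LINT r|lborel. c y * (indicator {s..t} r *\<^sub>R (\<i> * complex_of_real (\<theta> y) * cis (r * \<theta> y))))"
      by (simp add: h_def mult_ac scaleR_conv_of_real)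
    also have "\<dots> = c y * (cis (t * \<theta> y) - cis (s * \<theta> y))"
      by (simp only: integral_mult_right_zero integral_cis_diff[OF st])
    finally show "c y * (cis (t * \<theta> y) - cis (s * \<theta> y)) = (LINT r|lborel. h (r, y))" ..
  qed
  also have "\<dots> = (LINT r|lborel. LINT y|M. h (r, y))"
    using LM.Fubini_integral[of "\<lambda>r y. h (r, y)"] h by simp
  finally have eq: "(LINT y|M. c y * cis (t * \<theta> y)) - (LINT y|M. c y * cis (s * \<theta> y)) = (LINT r|lborel. LINT y|M. h (r, y))" .
  have "ennreal (cmod (LINT r|lborel. LINT y|M. h (r, y))) \<le> (\<integral>\<^sup>+ r. ennreal (cmod (LINT y|M. h (r, y))) \<partial>lborel)"
    by (rule integral_norm_bound_ennreal) (rule LM.integrable_fst, simp add: h)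
  also have "\<dots> = (\<integral>\<^sup>+ r. indicator {s..t} r * ennreal (cmod (LINT y|M. \<theta> y * c y * cis (r * \<theta> y))) \<partial>lborel)"
  proof (intro nn_integral_cong)
    fix r
    have "(LINT y|M. h (r, y)) = (LINT y|M. (indicator {s..t} r * \<i>) * (\<theta> y * c y * cis (r * \<theta> y)))"
      by (intro Bochner_Integration.integral_cong refl) (simp add: h_def indicator_def)
    also have "\<dots> = (indicator {s..t} r * \<i>) * (LINT y|M. \<theta> y * c y * cis (r * \<theta> y))"
      by (rule integral_mult_right_zero)
    finally show "ennreal (cmod (LINT y|M. h (r, y))) = indicator {s..t} r * ennreal (cmod (LINT y|M. \<theta> y * c y * cis (r * \<theta> y)))"
      by (simp add: norm_mult indicator_def)
  qed
  finally show ?thesis by (simp only: eq)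
qed

text \<open>On an interval of length 1 / R the value of u at t differs from any other value by at
  most the integral of |v|, whose square is at most 1 / R times the integral of |v|^2; averaging
  over the interval gives the claim. The length 1 / R balances the two terms when v is of size R
  times u.\<close>

lemma sup_interval_bound:
  fixes u v :: "real \<Rightarrow> complex"
  assumes [measurable]: "u \<in> borel_measurable borel" "v \<in> borel_measurable borel"
    and uv: "\<And>s t. 1 \<le> s \<Longrightarrow> s \<le> t \<Longrightarrow> t \<le> 2 \<Longrightarrow>
      ennreal (cmod (u t - u s)) \<le> (\<integral>\<^sup>+ r. indicator {s..t} r * ennreal (cmod (v r)) \<partial>lborel)"
    and R: "R \<ge> 1" and t: "1 \<le> t" "t \<le> 2"
  shows "csq (u t) \<le>
     ennreal (2 * R) * (\<integral>\<^sup>+ r. indicator {1..2} r * csq (u r) \<partial>lborel) +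
     ennreal (2 / R) * (\<integral>\<^sup>+ r. indicator {1..2} r * csq (v r) \<partial>lborel)"
proof -
  \<comment> \<open>The left end is t, moved back near 2 so that the interval of length 1 / R stays
    inside {1..2} and still contains t.\<close>
  define a where "a = min t (2 - 1 / R)"
  define I where "I = {a..a + 1 / R}"
  have R1: "0 < 1 / R" "1 / R \<le> 1" using R by auto
  have I: "t \<in> I" "I \<subseteq> {1..2}" 
  proof -
    define q where "q = 1 / R"
    show "t \<in> I" "I \<subseteq> {1..2}" using t R1 unfolding I_def a_def q_def[symmetric] by auto
  qed
  have [measurable]: "I \<in> sets borel" by (simp add: I_def)
  have emI: "emeasure lborel I = ennreal (1 / R)" using R1 by (simp add: I_def)
  define V where "V = (\<integral>\<^sup>+ r. indicator I r * ennreal (cmod (v r)) \<partial>lborel)"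
  define V2 where "V2 = (\<integral>\<^sup>+ r. indicator I r * csq (v r) \<partial>lborel)"
  have VV: "V\<^sup>2 \<le> ennreal (1 / R) * V2"
  proof -
    have "V\<^sup>2 \<le> (\<integral>\<^sup>+ r. (indicator I r)\<^sup>2 \<partial>lborel) * (\<integral>\<^sup>+ r. (indicator I r * ennreal (cmod (v r)))\<^sup>2 \<partial>lborel)"
    proof -
      have "V = (\<integral>\<^sup>+ r. indicator I r * (indicator I r * ennreal (cmod (v r))) \<partial>lborel)"
        unfolding V_def by (intro nn_integral_cong) (auto simp: indicator_def)
      then show ?thesis by (simp only:) (rule Cauchy_Schwarz_nn_integral; measurable)
    qed
    also have "(\<integral>\<^sup>+ r. (indicator I r)\<^sup>2 \<partial>lborel) = ennreal (1 / R)"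
    proof -
      have "(\<integral>\<^sup>+ r. (indicator I r)\<^sup>2 \<partial>lborel) = (\<integral>\<^sup>+ r. indicator I r \<partial>lborel)"
        by (intro nn_integral_cong) (auto simp: indicator_def)
      then show ?thesis using emI by simp
    qed
    also have "(\<integral>\<^sup>+ r. (indicator I r * ennreal (cmod (v r)))\<^sup>2 \<partial>lborel) = V2"
      unfolding V2_def by (intro nn_integral_cong) (auto simp: indicator_def ennreal_power)
    finally show ?thesis .
  qed
  have pt: "csq (u t) \<le> ennreal 2 * csq (u s) + ennreal 2 * V\<^sup>2" if s: "s \<in> I" for s
  proof (cases "V = \<infinity>")
    case False
    then obtain w where w: "V = ennreal w" "w \<ge> 0" by (cases V) auto
    have "ennreal (cmod (u (max s t) - u (min s t))) \<le> (\<integral>\<^sup>+ r. indicator {min s t..max s t} r * ennreal (cmod (v r)) \<partial>lborel)"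
      using s I by (intro uv) (auto simp: min_def max_def)
    also have "\<dots> \<le> V"
      unfolding V_def using s I(1) by (intro nn_integral_mono mult_right_mono) (auto simp: I_def indicator_def)
    finally have "cmod (u (max s t) - u (min s t)) \<le> w" using w by simp
    then have "cmod (u t - u s) \<le> w"
      by (cases "s \<le> t") (auto simp: max_def min_def norm_minus_commute)
    then have "cmod (u t) \<le> cmod (u s) + w" using norm_triangle_ineq2[of "u t" "u s"] by linarith
    then have "(cmod (u t))\<^sup>2 \<le> (cmod (u s) + w)\<^sup>2" by (intro power_mono) auto
    also have "\<dots> \<le> 2 * (cmod (u s))\<^sup>2 + 2 * w\<^sup>2"
      using sum_squares_bound[of "cmod (u s)" w] by (simp add: power2_sum)
    finally have "csq (u t) \<le> ennreal (2 * (cmod (u s))\<^sup>2 + 2 * w\<^sup>2)" by (rule ennreal_leI)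
    also have "\<dots> = ennreal 2 * csq (u s) + ennreal 2 * V\<^sup>2"
      using w by (simp add: ennreal_power ennreal_plus ennreal_mult del: ennreal_numeral)
    finally show ?thesis .
  qed simp
  have "ennreal (1 / R) * csq (u t) = (\<integral>\<^sup>+ s. indicator I s * csq (u t) \<partial>lborel)"
    by (subst nn_integral_multc) (simp_all add: emI)
  also have "\<dots> \<le> (\<integral>\<^sup>+ s. ennreal 2 * (indicator {1..2} s * csq (u s)) + indicator I s * (ennreal 2 * V\<^sup>2) \<partial>lborel)"
  proof (rule nn_integral_mono)
    fix s
    show "indicator I s * csq (u t) \<le> ennreal 2 * (indicator {1..2} s * csq (u s)) + indicator I s * (ennreal 2 * V\<^sup>2)"
      using pt[of s] I(2) by (cases "s \<in> I") (auto simp: subset_iff)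
  qed
  also have "\<dots> = ennreal 2 * (\<integral>\<^sup>+ s. indicator {1..2} s * csq (u s) \<partial>lborel) + ennreal (1 / R) * (ennreal 2 * V\<^sup>2)"
    by (subst nn_integral_add) (simp_all add: nn_integral_cmult nn_integral_multc emI)
  also have "\<dots> \<le> ennreal 2 * (\<integral>\<^sup>+ s. indicator {1..2} s * csq (u s) \<partial>lborel) +
      ennreal (1 / R) * (ennreal 2 * (ennreal (1 / R) * (\<integral>\<^sup>+ r. indicator {1..2} r * csq (v r) \<partial>lborel)))"
  proof (intro add_left_mono mult_left_mono order_trans[OF VV])
    show "V2 \<le> (\<integral>\<^sup>+ r. indicator {1..2} r * csq (v r) \<partial>lborel)"
      unfolding V2_def using I(2) by (intro nn_integral_mono mult_right_mono) (auto simp: indicator_def)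
  qed auto
  finally have le: "ennreal (1 / R) * csq (u t) \<le> ennreal 2 * (\<integral>\<^sup>+ s. indicator {1..2} s * csq (u s) \<partial>lborel) +
      ennreal (1 / R) * (ennreal 2 * (ennreal (1 / R) * (\<integral>\<^sup>+ r. indicator {1..2} r * csq (v r) \<partial>lborel)))" (is "_ \<le> ennreal 2 * ?A + ennreal (1 / R) * (ennreal 2 * (ennreal (1 / R) * ?B))") .
  have "csq (u t) = ennreal R * (ennreal (1 / R) * csq (u t))"
    using R by (subst ennreal_mult_mult) auto
  also have "\<dots> \<le> ennreal R * (ennreal 2 * ?A + ennreal (1 / R) * (ennreal 2 * (ennreal (1 / R) * ?B)))"
    by (intro mult_left_mono le) simp
  also have "\<dots> = ennreal (R * 2) * ?A + ennreal (R * (1 / R * (2 * (1 / R)))) * ?B"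
    using R by (simp add: distrib_left ennreal_mult_mult del: ennreal_numeral)
  also have "R * (1 / R * (2 * (1 / R))) = 2 / R" using R by simp
  finally show ?thesis by (simp add: mult.commute)
qed

section \<open>Kernel bounds on dyadic shells\<close>

definition unit_dilations :: "real measure" where
  "unit_dilations = density lborel (indicator {1..2})"

lemma sets_unit_dilations [measurable_cong, simp]: "sets unit_dilations = sets borel"
  by (simp add: unit_dilations_def)

lemma space_unit_dilations [simp]: "space unit_dilations = UNIV"
  by (simp add: unit_dilations_def)

lemma emeasure_unit_dilations_UNIV: "emeasure unit_dilations UNIV = 1"
  by (simp add: unit_dilations_def emeasure_density)

lemma finite_unit_dilations: "finite_measure unit_dilations"
  by (rule finite_measureI) (simp add: emeasure_unit_dilations_UNIV)

lemma nn_integral_unit_dilations: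
  "f \<in> borel_measurable borel \<Longrightarrow> (\<integral>\<^sup>+ t. f t \<partial>unit_dilations) = (\<integral>\<^sup>+ t. indicator {1..2} t * f t \<partial>lborel)"
  by (simp add: unit_dilations_def nn_integral_density)

lemma power_quotient_mono:
  fixes r R :: real
  assumes "R \<le> r" "R > 0" "m \<le> d"
  shows "r ^ m / r ^ d \<le> R ^ m / R ^ d"
proof -
  have "x ^ m / x ^ d = 1 / x ^ (d - m)" if "x > 0" for x :: real
    using that assms(3) by (simp add: power_diff)
  then show ?thesis
    using assms by (simp add: power_mono frac_le)
qed

text \<open>The first frequency dominates and determines the scale. At R = 1 its lower bound is
  dropped, so that the lowest shell may also carry all small frequencies.\<close>

definition dyadic_shell :: "real \<Rightarrow> ('a::euclidean_space \<times> 'a) set" where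
  "dyadic_shell R = {X. norm (snd X) \<le> norm (fst X) \<and> norm (fst X) \<le> 2 * R \<and> (R \<le> norm (fst X) \<or> R = 1)}"

text \<open>Serves the multiplier (m = 3) and its derivative (m = 5). If |\<xi>| = r is at least R,
  \<open>dilation_average\<close> gives r^(m-d), which is at most R^(m-d) because m is at most d.
  Small frequencies, present only for R = 1, are treated by the size of the kernel alone; the two
  constants are added.\<close>

lemma shell_kernel_bound:
  fixes \<kappa> :: "real \<Rightarrow> 'a::euclidean_space \<times> 'a \<Rightarrow> complex" and \<Phi> :: "'a \<times> 'a \<Rightarrow> ennreal"
  assumes \<Phi>m: "\<Phi> \<in> borel_measurable borel"
    and inv: "\<And>U X. orthogonal_transformation U \<Longrightarrow> \<Phi> (map_prod U U X) = \<Phi> X"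
    and A: "A \<ge> 0" "\<And>\<rho>. \<rho> > 0 \<Longrightarrow> (\<integral>\<^sup>+ X. indicator (cball 0 \<rho>) X * \<Phi> X \<partial>lborel) \<le> ennreal (A * \<rho> ^ m)"
    and m: "m \<le> DIM('a)"
    and \<kappa>m: "case_prod \<kappa> \<in> borel_measurable (borel \<Otimes>\<^sub>M borel)"
    and \<kappa>\<Phi>: "\<And>t X. t \<in> {1..2} \<Longrightarrow> csq (\<kappa> t X) \<le> \<Phi> (t *\<^sub>R X)"
    and \<kappa>8: "\<And>t X. norm X \<le> 4 \<Longrightarrow> cmod (\<kappa> t X) \<le> 8"
    and Dm: "D \<in> sets borel" and R: "R \<ge> 1"
    and D_sub: "D \<subseteq> dyadic_shell R"
  shows "(\<integral>\<^sup>+ t. \<integral>\<^sup>+ \<eta>. csq (indicator D (\<xi>, \<eta>) * \<kappa> t (\<xi>, \<eta>)) \<partial>lborel \<partial>unit_dilations)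
    \<le> ennreal ((4 * 4 ^ DIM('a) / unit_ball_vol (real DIM('a)) * A * 8 ^ m + 64 * unit_ball_vol (real DIM('a)) * 2 ^ DIM('a))
        * (R ^ m / R ^ DIM('a)))" (is "?I \<le> ennreal ((?C1 + ?C2) * ?q)")
proof -
  let ?d = "DIM('a)" and ?\<omega> = "unit_ball_vol (real DIM('a))"
  have \<omega>: "?\<omega> > 0" by simp
  have C12: "?C1 \<ge> 0" "?C2 \<ge> 0" "?q \<ge> 0" using A(1) R \<omega> by auto
  have [measurable]: "D \<in> sets (borel \<Otimes>\<^sub>M borel)" unfolding borel_prod by (rule Dm)
  note [measurable] = measurable_kernel[OF \<kappa>m]
  have D: "norm (snd X) \<le> norm (fst X) \<and> norm (fst X) \<le> 2 * R \<and> (R \<le> norm (fst X) \<or> R = 1)" if "X \<in> D" for X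
    using D_sub that by (auto simp: dyadic_shell_def)
  have I_eq: "?I = (\<integral>\<^sup>+ t. indicator {1..2} t * (\<integral>\<^sup>+ \<eta>. csq (indicator D (\<xi>, \<eta>) * \<kappa> t (\<xi>, \<eta>)) \<partial>lborel) \<partial>lborel)"
    by (rule nn_integral_unit_dilations) measurable
  consider "\<And>\<eta>. (\<xi>, \<eta>) \<notin> D" | "R \<le> norm \<xi>" | "R = 1" "norm \<xi> \<le> 2"
    using D R by fastforce
  then show ?thesis
  proof cases
    case 1
    then show ?thesis by simp
  next
    case 2
    define r where "r = norm \<xi>"
    have r: "r \<ge> R" "r > 0" using 2 R by (auto simp: r_def)
    have "?I \<le> (\<integral>\<^sup>+ t. indicator {1..2} t * (\<integral>\<^sup>+ \<eta>. indicator {\<eta>. norm \<eta> \<le> norm \<xi>} \<eta> * \<Phi> (t *\<^sub>R \<xi>, t *\<^sub>R \<eta>) \<partial>lborel) \<partial>lborel)"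
      unfolding I_eq
    proof (rule nn_integral_mono)
      fix t :: real
      show "indicator {1..2} t * (\<integral>\<^sup>+ \<eta>. csq (indicator D (\<xi>, \<eta>) * \<kappa> t (\<xi>, \<eta>)) \<partial>lborel)
        \<le> indicator {1..2} t * (\<integral>\<^sup>+ \<eta>. indicator {\<eta>. norm \<eta> \<le> norm \<xi>} \<eta> * \<Phi> (t *\<^sub>R \<xi>, t *\<^sub>R \<eta>) \<partial>lborel)"
      proof (cases "t \<in> {1..2}")
        case True
        show ?thesis
        proof (intro mult_left_mono nn_integral_mono)
          fix \<eta>
          show "csq (indicator D (\<xi>, \<eta>) * \<kappa> t (\<xi>, \<eta>)) \<le> indicator {\<eta>. norm \<eta> \<le> norm \<xi>} \<eta> * \<Phi> (t *\<^sub>R \<xi>, t *\<^sub>R \<eta>)"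
            using D[of "(\<xi>, \<eta>)"] \<kappa>\<Phi>[OF True, of "(\<xi>, \<eta>)"] by (cases "(\<xi>, \<eta>) \<in> D") auto
        qed simp
      qed simp
    qed
    also have "\<dots> \<le> ennreal (4 * 4 ^ ?d / (?\<omega> * r ^ ?d)) * (\<integral>\<^sup>+ X. indicator (cball 0 (8 * r)) X * \<Phi> X \<partial>lborel)"
      using r by (intro dilation_average \<Phi>m inv) (auto simp: r_def)
    also have "\<dots> \<le> ennreal (4 * 4 ^ ?d / (?\<omega> * r ^ ?d)) * ennreal (A * (8 * r) ^ m)"
      using r by (intro mult_left_mono A(2)) auto
    also have "\<dots> = ennreal (4 * 4 ^ ?d / (?\<omega> * r ^ ?d) * (A * (8 * r) ^ m))"
      using r A(1) \<omega> by (intro ennreal_mult[symmetric]) auto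
    also have "4 * 4 ^ ?d / (?\<omega> * r ^ ?d) * (A * (8 * r) ^ m) = ?C1 * (r ^ m / r ^ ?d)"
      by (simp add: power_mult_distrib)
    also have "ennreal (?C1 * (r ^ m / r ^ ?d)) \<le> ennreal ((?C1 + ?C2) * ?q)"
      using C12 r R m by (intro ennreal_leI mult_mono power_quotient_mono) auto
    finally show ?thesis .
  next
    case 3
    \<comment> \<open>The averaging bound degenerates as \<xi> tends to 0. Here both frequencies
      have norm at most 2, so the bound 8 for the kernel, squared, is integrated over a ball of
      radius 2.\<close>
    have "?I \<le> (\<integral>\<^sup>+ t. (\<integral>\<^sup>+ \<eta>. ennreal 64 * indicator (cball (0::'a) 2) \<eta> \<partial>lborel) \<partial>unit_dilations)"
    proof (intro nn_integral_mono)
      fix t \<eta>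
      show "csq (indicator D (\<xi>, \<eta>) * \<kappa> t (\<xi>, \<eta>)) \<le> ennreal 64 * indicator (cball (0::'a) 2) \<eta>"
      proof (cases "(\<xi>, \<eta>) \<in> D")
        case True
        then have \<eta>: "norm \<eta> \<le> 2" using D[OF True] 3 by auto
        then have "cmod (\<kappa> t (\<xi>, \<eta>)) \<le> 8" using 3 norm_Pair_le[of \<xi> \<eta>] by (intro \<kappa>8) linarith
        then have "(cmod (\<kappa> t (\<xi>, \<eta>)))\<^sup>2 \<le> 8\<^sup>2" by (intro power_mono) auto
        then show ?thesis using True \<eta> by (simp add: ennreal_leI del: ennreal_numeral)
      qed simp
    qed
    also have "\<dots> = ennreal 64 * emeasure lborel (cball (0::'a) 2)"
      by (subst nn_integral_cmult_indicator) (auto simp: emeasure_unit_dilations_UNIV)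
    also have "\<dots> = ennreal ?C2"
      by (simp add: emeasure_cball ennreal_mult mult.assoc del: ennreal_numeral)
    also have "\<dots> \<le> ennreal ((?C1 + ?C2) * ?q)"
      using 3 C12 by (intro ennreal_leI) simp
    finally show ?thesis .
  qed
qed

text \<open>Up to the factor -2 pi i, the derivative of \<open>tri_mult (t *\<^sub>R X)\<close> in
  t. It differs from \<open>tri_mult_deriv (t *\<^sub>R X)\<close> by a factor t, harmless for t
  between 1 and 2, and is the form in which the derivative enters the Sobolev inequality.\<close>

definition tri_phase :: "real \<Rightarrow> 'a::euclidean_space \<times> 'a \<Rightarrow> complex" where
  "tri_phase t X = (LINT p|triangle_measure. complex_of_real (X \<bullet> p) * cis (t * (- 2 * pi * (X \<bullet> p))))"

lemma tri_mult_deriv_eq: "tri_mult_deriv (t *\<^sub>R X) = complex_of_real t * tri_phase t X"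
  unfolding tri_mult_deriv_def tri_phase_def
  by (subst integral_mult_right_zero[symmetric]) (simp add: mult_ac)

lemma tri_phase_measurable: "case_prod tri_phase \<in> borel_measurable (borel \<Otimes>\<^sub>M (borel :: ('a::euclidean_space \<times> 'a) measure))"
proof -
  interpret T: finite_measure "triangle_measure :: ('a \<times> 'a) measure" by (rule finite_triangle_measure)
  show ?thesis unfolding tri_phase_def[abs_def] by measurable
qed

lemma tri_mult_dilate_measurable: "(\<lambda>(t, X). tri_mult (t *\<^sub>R X)) \<in> borel_measurable (borel \<Otimes>\<^sub>M (borel :: ('a::euclidean_space \<times> 'a) measure))"
  by measurable

lemma norm_triangle_set_le:
  assumes "p \<in> triangle_set" shows "norm p \<le> 2"
  using norm_Pair_le[of "fst p" "snd p"] norm_fst_snd_le_1[OF assms] by simp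

lemma triangle_integral_norm_le:
  fixes f :: "'a::euclidean_space \<times> 'a \<Rightarrow> complex"
  assumes "\<And>p. p \<in> triangle_set \<Longrightarrow> cmod (f p) \<le> B" "B \<ge> 0" and [measurable]: "f \<in> borel_measurable borel"
  shows "cmod (LINT p|triangle_measure. f p) \<le> B"
proof -
  interpret T: finite_measure "triangle_measure :: ('a \<times> 'a) measure" by (rule finite_triangle_measure)
  have AE: "AE p in triangle_measure. cmod (f p) \<le> B"
    using AE_triangle_measure by eventually_elim (rule assms)
  have "integrable triangle_measure f"
    using AE by (intro T.integrable_const_bound[of _ B]) auto
  then have "ennreal (cmod (LINT p|triangle_measure. f p)) \<le> (\<integral>\<^sup>+ p. ennreal (cmod (f p)) \<partial>triangle_measure)"
    by (rule integral_norm_bound_ennreal)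
  also have "\<dots> \<le> (\<integral>\<^sup>+ p. ennreal B \<partial>(triangle_measure :: ('a \<times> 'a) measure))"
    using AE by (intro nn_integral_mono_AE) (auto intro: ennreal_leI elim: eventually_mono)
  also have "\<dots> \<le> ennreal B * 1"
    by (subst nn_integral_const) (intro mult_left_mono, use emeasure_triangle_measure_UNIV_le in auto)
  finally show ?thesis using assms(2) by simp
qed

lemma cmod_tri_mult_le: "cmod (tri_mult X) \<le> 1"
  unfolding tri_mult_def by (rule triangle_integral_norm_le) auto

lemma cmod_tri_phase_le: "cmod (tri_phase t X) \<le> 2 * norm X"
  unfolding tri_phase_def
proof (rule triangle_integral_norm_le)
  fix p :: "'a \<times> 'a" assume p: "p \<in> triangle_set"
  have "\<bar>X \<bullet> p\<bar> \<le> norm X * 2"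
    using norm_triangle_set_le[OF p] by (intro order_trans[OF Cauchy_Schwarz_ineq2] mult_left_mono) auto
  then show "cmod (complex_of_real (X \<bullet> p) * cis (t * (- 2 * pi * (X \<bullet> p)))) \<le> 2 * norm X"
    by (simp add: norm_mult)
qed auto

text \<open>The quantity that \<open>bilinear_kernel_L2\<close> requires to be bounded uniformly in
  \<xi>.\<close>

definition kernel_norm2 :: "(real \<Rightarrow> 'a::euclidean_space \<times> 'a \<Rightarrow> complex) \<Rightarrow> 'a \<Rightarrow> ennreal" where
  "kernel_norm2 k \<xi> = (\<integral>\<^sup>+ t. \<integral>\<^sup>+ \<eta>. csq (k t (\<xi>, \<eta>)) \<partial>lborel \<partial>unit_dilations)"

text \<open>The exponents 3 and 5 come from \<open>tri_mult_L2\<close> and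
  \<open>tri_mult_deriv_L2\<close>. The dimension must be at least 5 because the derivative bound is
  monotone in |\<xi>| only for 5 at most d.\<close>

lemma tri_kernel_bounds:
  assumes dim: "DIM('a::euclidean_space) \<ge> 5"
  shows "\<exists>C>0. \<forall>(D :: ('a \<times> 'a) set) R \<xi>. D \<in> sets borel \<longrightarrow> R \<ge> 1 \<longrightarrow> D \<subseteq> dyadic_shell R \<longrightarrow>
    kernel_norm2 (\<lambda>t X. indicator D X * tri_mult (t *\<^sub>R X)) \<xi> \<le> ennreal (C * (R ^ 3 / R ^ DIM('a))) \<and>
    kernel_norm2 (\<lambda>t X. indicator D X * tri_phase t X) \<xi> \<le> ennreal (C * (R ^ 5 / R ^ DIM('a)))"
proof -
  let ?d = "DIM('a)" and ?\<omega> = "unit_ball_vol (real DIM('a))"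
  define A3 where "A3 = exp pi * (2 * real ?d) ^ (2 * ?d - 3)"
  define A5 where "A5 = exp pi * (2 * real ?d) ^ (2 * ?d - 2)"
  define C3 where "C3 = 4 * 4 ^ ?d / ?\<omega> * A3 * 8 ^ 3 + 64 * ?\<omega> * 2 ^ ?d"
  define C5 where "C5 = 4 * 4 ^ ?d / ?\<omega> * A5 * 8 ^ 5 + 64 * ?\<omega> * 2 ^ ?d"
  have \<omega>: "?\<omega> > 0" by simp
  have A: "A3 \<ge> 0" "A5 \<ge> 0" by (auto simp: A3_def A5_def)
  have C: "C3 > 0" "C5 > 0" using A \<omega> unfolding C3_def C5_def by (auto intro!: add_nonneg_pos)
  show ?thesis
  proof (intro exI[of _ "C3 + C5"] conjI allI impI)
    show "C3 + C5 > 0" using C by simp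
    fix D :: "('a \<times> 'a) set" and R :: real and \<xi> :: 'a
    assume Dm: "D \<in> sets borel" and R: "R \<ge> 1"
      and D: "D \<subseteq> dyadic_shell R"
    have "kernel_norm2 (\<lambda>t X. indicator D X * tri_mult (t *\<^sub>R X)) \<xi> \<le> ennreal (C3 * (R ^ 3 / R ^ DIM('a)))"
      unfolding C3_def kernel_norm2_def
    proof (rule shell_kernel_bound[where \<Phi> = "\<lambda>X. csq (tri_mult X)" and \<kappa> = "\<lambda>t X. tri_mult (t *\<^sub>R X)"])
      show "(\<integral>\<^sup>+ X. indicator (cball 0 \<rho>) X * csq (tri_mult (X :: 'a \<times> 'a)) \<partial>lborel) \<le> ennreal (A3 * \<rho> ^ 3)"
        if "\<rho> > 0" for \<rho>
        using tri_mult_L2[OF that, where 'a='a] dim by (simp add: A3_def)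
      show "cmod (tri_mult (t *\<^sub>R X)) \<le> 8" for t and X :: "'a \<times> 'a"
        using cmod_tri_mult_le[of "t *\<^sub>R X"] by linarith
    qed (use A dim D Dm R in \<open>auto simp: tri_mult_orthogonal tri_mult_dilate_measurable\<close>)
    also have "\<dots> \<le> ennreal ((C3 + C5) * (R ^ 3 / R ^ DIM('a)))"
      using C R by (intro ennreal_leI mult_right_mono) auto
    finally show "kernel_norm2 (\<lambda>t X. indicator D X * tri_mult (t *\<^sub>R X)) \<xi> \<le> ennreal ((C3 + C5) * (R ^ 3 / R ^ DIM('a)))" .
    have "kernel_norm2 (\<lambda>t X. indicator D X * tri_phase t X) \<xi> \<le> ennreal (C5 * (R ^ 5 / R ^ DIM('a)))"
      unfolding C5_def kernel_norm2_def
    proof (rule shell_kernel_bound[where \<Phi> = "\<lambda>X. csq (tri_mult_deriv X)"])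
      show "(\<integral>\<^sup>+ X. indicator (cball 0 \<rho>) X * csq (tri_mult_deriv (X :: 'a \<times> 'a)) \<partial>lborel) \<le> ennreal (A5 * \<rho> ^ 5)"
        if "\<rho> > 0" for \<rho>
        using tri_mult_deriv_L2[OF that, where 'a='a] dim by (simp add: A5_def)
      show "cmod (tri_phase t X) \<le> 8" if "norm X \<le> 4" for t and X :: "'a \<times> 'a"
        using cmod_tri_phase_le[of t X] that by linarith
      show "csq (tri_phase t X) \<le> csq (tri_mult_deriv (t *\<^sub>R X))"
        if "t \<in> {1..2}" for t and X :: "'a \<times> 'a"
      proof (intro ennreal_leI power_mono)
        show "cmod (tri_phase t X) \<le> cmod (tri_mult_deriv (t *\<^sub>R X))"
          using that mult_right_mono[of 1 "\<bar>t\<bar>" "cmod (tri_phase t X)"]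
          by (simp add: tri_mult_deriv_eq norm_mult)
      qed simp
    qed (use A dim D Dm R in \<open>auto simp: tri_mult_orthogonal tri_phase_measurable\<close>)
    also have "\<dots> \<le> ennreal ((C3 + C5) * (R ^ 5 / R ^ DIM('a)))"
      using C R by (intro ennreal_leI mult_right_mono) auto
    finally show "kernel_norm2 (\<lambda>t X. indicator D X * tri_phase t X) \<xi> \<le> ennreal ((C3 + C5) * (R ^ 5 / R ^ DIM('a)))" .
  qed
qed

text \<open>The triangle average on the Fourier side, with F and G in the place of the Fourier
  transforms and the pair of frequencies restricted to D; see
  \<open>triangle_avg_eq_tri_form\<close>.\<close>

definition tri_form :: "('a::euclidean_space \<times> 'a) set \<Rightarrow> ('a \<Rightarrow> complex) \<Rightarrow> ('a \<Rightarrow> complex) \<Rightarrow> real \<Rightarrow> 'a \<Rightarrow> complex" where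
  "tri_form D F G t x = (LINT X|lborel. F (fst X) * G (snd X) * (indicator D X * tri_mult (t *\<^sub>R X)) *
     cis (2 * pi * (x \<bullet> (fst X + snd X))))"

text \<open>Up to the factor -2 pi i, the derivative of \<open>tri_form\<close> in t.\<close>

definition tri_form_deriv :: "('a::euclidean_space \<times> 'a) set \<Rightarrow> ('a \<Rightarrow> complex) \<Rightarrow> ('a \<Rightarrow> complex) \<Rightarrow> real \<Rightarrow> 'a \<Rightarrow> complex" where
  "tri_form_deriv D F G t x = (LINT X|lborel. F (fst X) * G (snd X) * (indicator D X * tri_phase t X) *
     cis (2 * pi * (x \<bullet> (fst X + snd X))))"

lemma integrable_tensor:
  fixes F G :: "'a::euclidean_space \<Rightarrow> complex"
  assumes "integrable lborel F" "integrable lborel G"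
  shows "integrable lborel (\<lambda>X. F (fst X) * G (snd X))"
  using lborel_pair.integrable_pair_mult[OF assms] by (simp add: lborel_prod split_beta')

text \<open>\<open>oscillatory_diff_bound\<close> on the product of frequency space and the triangle
  measure, with phase -2 pi (X \<bullet> p). Boundedness of D makes the phase bounded by 4 pi
  \<rho>, triangles having norm at most 2, and so secures integrability of the derivative.\<close>

lemma tri_form_diff:
  fixes F G :: "'a::euclidean_space \<Rightarrow> complex"
  assumes F: "integrable lborel F" and G: "integrable lborel G" and [measurable]: "D \<in> sets borel"
    and D: "\<And>X. X \<in> D \<Longrightarrow> norm X \<le> \<rho>" and st: "s \<le> t"
  shows "ennreal (cmod (tri_form D F G t x - tri_form D F G s x))
    \<le> (\<integral>\<^sup>+ r. indicator {s..t} r * ennreal (cmod (2 * pi * tri_form_deriv D F G r x)) \<partial>lborel)"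
proof -
  interpret T: finite_measure "triangle_measure :: ('a \<times> 'a) measure" by (rule finite_triangle_measure)
  interpret LT: pair_sigma_finite "lborel :: ('a \<times> 'a) measure" "triangle_measure :: ('a \<times> 'a) measure" ..
  have [measurable]: "F \<in> borel_measurable borel" "G \<in> borel_measurable borel"
    using F G by auto
  define M where "M = (lborel :: ('a \<times> 'a) measure) \<Otimes>\<^sub>M (triangle_measure :: ('a \<times> 'a) measure)"
  define c1 where "c1 X = F (fst X) * G (snd X) * indicator D X * cis (2 * pi * (x \<bullet> (fst X + snd X)))" for X
  define c where "c = (\<lambda>y :: ('a \<times> 'a) \<times> ('a \<times> 'a). c1 (fst y))"
  define \<theta> where "\<theta> = (\<lambda>y :: ('a \<times> 'a) \<times> ('a \<times> 'a). - 2 * pi * (fst y \<bullet> snd y))"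
  have [measurable]: "c1 \<in> borel_measurable borel" unfolding c1_def by measurable
  have c1: "integrable lborel c1"
    by (rule Bochner_Integration.integrable_bound[OF integrable_tensor[OF F G]]) (auto simp: c1_def norm_mult indicator_def)
  have cM: "integrable M c"
    using LT.integrable_pair_mult[OF c1, of "\<lambda>_. 1"] by (simp add: M_def c_def split_beta')
  have c\<theta>: "integrable M (\<lambda>y. \<theta> y * c y)"
  proof (rule Bochner_Integration.integrable_bound)
    show "integrable M (\<lambda>y. complex_of_real (4 * pi * \<rho>) * c y)" using cM by (rule integrable_mult_right)
    show "(\<lambda>y. \<theta> y * c y) \<in> borel_measurable M" unfolding \<theta>_def c_def M_def by measurable
    have "AE y in M. snd y \<in> triangle_set"
      unfolding M_def
    proof (rule LT.AE_pair_measure)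
      show "{x \<in> space (lborel \<Otimes>\<^sub>M triangle_measure). snd x \<in> triangle_set} \<in> sets ((lborel :: ('a \<times> 'a) measure) \<Otimes>\<^sub>M (triangle_measure :: ('a \<times> 'a) measure))"
        by measurable
    qed (simp add: AE_triangle_measure)
    then show "AE y in M. norm (\<theta> y * c y) \<le> norm (complex_of_real (4 * pi * \<rho>) * c y)"
    proof eventually_elim
      case (elim y)
      show ?case
      proof (cases "fst y \<in> D")
        case True
        have "\<bar>fst y \<bullet> snd y\<bar> \<le> \<rho> * 2"
          using D[OF True] norm_triangle_set_le[OF elim] order_trans[OF norm_ge_zero D[OF True]]
          by (intro order_trans[OF Cauchy_Schwarz_ineq2] mult_mono) auto
        then have "\<bar>\<theta> y\<bar> \<le> \<bar>4 * pi * \<rho>\<bar>" using order_trans[OF norm_ge_zero D[OF True]]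
          by (simp add: \<theta>_def abs_mult)
        then show ?thesis unfolding norm_mult norm_of_real by (intro mult_right_mono) auto
      qed (simp add: c_def c1_def)
    qed
  qed
  have u: "(LINT y|M. c y * cis (r * \<theta> y)) = tri_form D F G r x" for r
  proof -
    have "integrable M (\<lambda>y. c y * cis (r * \<theta> y))"
      by (rule Bochner_Integration.integrable_bound[OF cM]) (auto simp: norm_mult c_def \<theta>_def M_def)
    then have "(LINT y|M. c y * cis (r * \<theta> y)) = (LINT X|lborel. LINT p|triangle_measure. c1 X * cis (- 2 * pi * ((r *\<^sub>R X) \<bullet> p)))"
      unfolding M_def by (subst LT.integral_fst'[symmetric]) (simp_all add: c_def \<theta>_def mult_ac)
    also have "\<dots> = tri_form D F G r x"
      unfolding tri_form_def tri_mult_def by (intro Bochner_Integration.integral_cong refl) (simp add: c1_def mult_ac)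
    finally show ?thesis .
  qed
  have v: "(LINT y|M. \<theta> y * c y * cis (r * \<theta> y)) = - (2 * pi * tri_form_deriv D F G r x)" for r
  proof -
    have "integrable M (\<lambda>y. \<theta> y * c y * cis (r * \<theta> y))"
      by (rule Bochner_Integration.integrable_bound[OF c\<theta>]) (auto simp: norm_mult c_def \<theta>_def M_def)
    then have "(LINT y|M. \<theta> y * c y * cis (r * \<theta> y)) =
        (LINT X|lborel. LINT p|triangle_measure. (- 2 * pi * c1 X) * (complex_of_real (X \<bullet> p) * cis (r * (- 2 * pi * (X \<bullet> p)))))"
      unfolding M_def by (subst LT.integral_fst'[symmetric]) (simp_all add: c_def \<theta>_def mult_ac)
    also have "\<dots> = (LINT X|lborel. (- 2 * pi) * (F (fst X) * G (snd X) * (indicator D X * tri_phase r X) * cis (2 * pi * (x \<bullet> (fst X + snd X)))))"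
      unfolding tri_phase_def
      by (intro Bochner_Integration.integral_cong refl, subst integral_mult_right_zero) (simp add: c1_def mult_ac)
    also have "\<dots> = - (2 * pi * tri_form_deriv D F G r x)"
      unfolding tri_form_deriv_def by (subst integral_mult_right_zero) simp
    finally show ?thesis .
  qed
  have "sigma_finite_measure M" unfolding M_def by (rule LT.P.sigma_finite_measure_axioms)
  from oscillatory_diff_bound[OF this cM c\<theta> _ st] show ?thesis
    unfolding u v norm_minus_cancel by (simp add: M_def \<theta>_def)
qed

section \<open>Summation over dyadic shells\<close>

text \<open>The square of the Sobolev norm of order -s when F is a Fourier transform; as an integral
  it needs no square root until the very end.\<close>

definition weighted_norm2 :: "real \<Rightarrow> ('a::euclidean_space \<Rightarrow> complex) \<Rightarrow> ennreal" where
  "weighted_norm2 s F = (\<integral>\<^sup>+ \<xi>. (ennreal (cmod (complex_of_real ((1 + (norm \<xi>)\<^sup>2) powr (- s / 2)) * F \<xi>)))\<^sup>2 \<partial>lborel)"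

lemma truncated_norm_le:
  fixes F :: "'a::euclidean_space \<Rightarrow> complex"
  assumes [measurable]: "F \<in> borel_measurable borel" and s: "s \<ge> 0" and R: "R \<ge> 1"
  shows "(\<integral>\<^sup>+ \<xi>. csq (indicator (cball 0 (2 * R)) \<xi> * F \<xi>) \<partial>lborel)
    \<le> ennreal ((5 * R\<^sup>2) powr s) * weighted_norm2 s F"
proof -
  have "(\<integral>\<^sup>+ \<xi>. csq (indicator (cball 0 (2 * R)) \<xi> * F \<xi>) \<partial>lborel) \<le>
     (\<integral>\<^sup>+ \<xi>. ennreal ((5 * R\<^sup>2) powr s) * (ennreal (cmod (complex_of_real ((1 + (norm \<xi>)\<^sup>2) powr (- s / 2)) * F \<xi>)))\<^sup>2 \<partial>lborel)"
  proof (rule nn_integral_mono)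
    fix \<xi> :: 'a
    let ?w = "1 + (norm \<xi>)\<^sup>2"
    have w: "?w > 0" by (simp add: add_pos_nonneg)
    have rhs: "ennreal ((5 * R\<^sup>2) powr s) * (ennreal (cmod (complex_of_real (?w powr (- s / 2)) * F \<xi>)))\<^sup>2 =
        ennreal ((5 * R\<^sup>2) powr s * (?w powr (- s) * (cmod (F \<xi>))\<^sup>2))"
      by (simp add: norm_mult ennreal_power ennreal_mult power_mult_distrib flip: powr_add powr_power)
         (simp add: power2_eq_square flip: powr_add ennreal_mult)
    show "csq (indicator (cball 0 (2 * R)) \<xi> * F \<xi>) \<le>
       ennreal ((5 * R\<^sup>2) powr s) * (ennreal (cmod (complex_of_real (?w powr (- s / 2)) * F \<xi>)))\<^sup>2"
    proof (cases "norm \<xi> \<le> 2 * R")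
      case True
      have "(norm \<xi>)\<^sup>2 \<le> (2 * R)\<^sup>2" using True by (intro power_mono) auto
      moreover have "1 \<le> R\<^sup>2" using R by (simp add: one_le_power)
      \<comment> \<open>1 + 4 R^2 is at most 5 R^2 since R is at least 1; hence the factor 5 in all
        later constants.\<close>
      ultimately have "?w \<le> 5 * R\<^sup>2" by (simp add: power_mult_distrib)
      then have "?w powr s \<le> (5 * R\<^sup>2) powr s" using w s by (intro powr_mono2) auto
      then have "?w powr s * ?w powr (- s) \<le> (5 * R\<^sup>2) powr s * ?w powr (- s)" by (intro mult_right_mono) auto
      then have "1 \<le> (5 * R\<^sup>2) powr s * ?w powr (- s)" using w by (simp add: powr_add[symmetric])
      then have "1 * (cmod (F \<xi>))\<^sup>2 \<le> (5 * R\<^sup>2) powr s * ?w powr (- s) * (cmod (F \<xi>))\<^sup>2"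
        by (intro mult_right_mono) auto
      then show ?thesis unfolding rhs using True by (simp add: ennreal_leI mult.assoc)
    qed simp
  qed
  also have "\<dots> = ennreal ((5 * R\<^sup>2) powr s) * weighted_norm2 s F"
    unfolding weighted_norm2_def by (rule nn_integral_cmult) measurable
  finally show ?thesis .
qed

lemma tri_form_measurable:
  assumes "F \<in> borel_measurable borel" "G \<in> borel_measurable borel" "D \<in> sets borel"
  shows "(\<lambda>(x, t). tri_form D F G t x) \<in> borel_measurable (borel \<Otimes>\<^sub>M borel)"
    "(\<lambda>(x, t). tri_form_deriv D F G t x) \<in> borel_measurable (borel \<Otimes>\<^sub>M borel)"
proof -
  note assms [measurable] tri_phase_measurable [measurable]
  show "(\<lambda>(x, t). tri_form D F G t x) \<in> borel_measurable (borel \<Otimes>\<^sub>M borel)"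
    unfolding tri_form_def by measurable
  show "(\<lambda>(x, t). tri_form_deriv D F G t x) \<in> borel_measurable (borel \<Otimes>\<^sub>M borel)"
    unfolding tri_form_deriv_def by measurable
qed

lemma tri_form_truncate:
  assumes "\<And>X. X \<in> D \<Longrightarrow> fst X \<in> A \<and> snd X \<in> B"
  shows "tri_form D F G t x = tri_form D (\<lambda>\<xi>. indicator A \<xi> * F \<xi>) (\<lambda>\<eta>. indicator B \<eta> * G \<eta>) t x"
    "tri_form_deriv D F G t x = tri_form_deriv D (\<lambda>\<xi>. indicator A \<xi> * F \<xi>) (\<lambda>\<eta>. indicator B \<eta> * G \<eta>) t x"
  unfolding tri_form_def tri_form_deriv_def
  by (intro Bochner_Integration.integral_cong refl; use assms in \<open>auto simp: indicator_def\<close>)+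

text \<open>An L2 bound for the supremum over all dilations, expressed by a measurable majorant W of
  the squares. The supremum itself is uncountable, whereas majorants combine under sums and lower
  limits without further measurability questions.\<close>

definition tri_form_dominated :: "('a::euclidean_space \<times> 'a) set \<Rightarrow> ('a \<Rightarrow> complex) \<Rightarrow> ('a \<Rightarrow> complex) \<Rightarrow> ennreal \<Rightarrow> bool" where
  "tri_form_dominated D F G M \<longleftrightarrow> (\<exists>W\<in>borel_measurable borel.
     (\<forall>t\<in>{1..2}. \<forall>x. csq (tri_form D F G t x) \<le> W x) \<and> (\<integral>\<^sup>+ x. W x \<partial>lborel) \<le> M)"

definition bounded_integrable :: "('a::euclidean_space \<Rightarrow> complex) \<Rightarrow> bool" where
  "bounded_integrable F \<longleftrightarrow> integrable lborel F \<and> (\<exists>B. \<forall>\<xi>. cmod (F \<xi>) \<le> B)"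

text \<open>The Sobolev inequality at scale 1 / R is applied for each x, and the resulting integrals
  over t and x are bounded by \<open>bilinear_kernel_L2\<close>. Both terms are then of order
  R^(4-d), and restoring the Sobolev weights on frequencies up to 2 R adds the exponent 2 (s1 +
  s2).\<close>

lemma dyadic_piece:
  assumes dim: "DIM('a::euclidean_space) \<ge> 5" and s: "s\<^sub>1 \<ge> 0" "s\<^sub>2 \<ge> 0"
  shows "\<exists>C>0. \<forall>(D :: ('a \<times> 'a) set) R F G. D \<in> sets borel \<longrightarrow> R \<ge> 1 \<longrightarrow> D \<subseteq> dyadic_shell R \<longrightarrow>
    bounded_integrable F \<longrightarrow> bounded_integrable G \<longrightarrow>
    tri_form_dominated D F G (ennreal (C * R powr (4 - real DIM('a) + 2 * (s\<^sub>1 + s\<^sub>2))) * (weighted_norm2 s\<^sub>1 F * weighted_norm2 s\<^sub>2 G))"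
proof -
  let ?d = "DIM('a)"
  obtain C0 where C0: "C0 > 0" and bd: "\<And>(D :: ('a \<times> 'a) set) R \<xi>. D \<in> sets borel \<Longrightarrow> R \<ge> 1 \<Longrightarrow> D \<subseteq> dyadic_shell R \<Longrightarrow>
    kernel_norm2 (\<lambda>t X. indicator D X * tri_mult (t *\<^sub>R X)) \<xi> \<le> ennreal (C0 * (R ^ 3 / R ^ DIM('a))) \<and>
    kernel_norm2 (\<lambda>t X. indicator D X * tri_phase t X) \<xi> \<le> ennreal (C0 * (R ^ 5 / R ^ DIM('a)))"
    using tri_kernel_bounds[OF dim] by blast
  \<comment> \<open>2 and 8 pi^2 = 2 (2 pi)^2 stem from the two terms of
    \<open>sup_interval_bound\<close>, the latter through the factor 2 pi of the t-derivative; the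
    power of 5 comes from \<open>truncated_norm_le\<close>.\<close>
  define C where "C = (2 + 8 * pi\<^sup>2) * C0 * 5 powr (s\<^sub>1 + s\<^sub>2)"
  show ?thesis
  proof (intro exI[of _ C] conjI allI impI)
    show "C > 0" using C0 by (auto simp: C_def intro!: mult_pos_pos add_pos_nonneg)
    fix D :: "('a \<times> 'a) set" and R :: real and F G :: "'a \<Rightarrow> complex"
    assume Dm: "D \<in> sets borel" and R: "R \<ge> 1"
      and D_sub: "D \<subseteq> dyadic_shell R" and FG: "bounded_integrable F" "bounded_integrable G"
    then have D: "\<And>X. X \<in> D \<Longrightarrow> norm (snd X) \<le> norm (fst X) \<and> norm (fst X) \<le> 2 * R"
      and F: "integrable lborel F" and G: "integrable lborel G" and FB: "\<exists>B. \<forall>\<xi>. cmod (F \<xi>) \<le> B"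
      by (auto simp: dyadic_shell_def bounded_integrable_def)
    note Dm [measurable] tri_phase_measurable [measurable]
    have Fm [measurable]: "F \<in> borel_measurable borel" and Gm [measurable]: "G \<in> borel_measurable borel"
      using F G by auto
    let ?Q = "cball (0::'a) (2 * R)"
    have [measurable]: "?Q \<in> sets borel" by simp
    \<comment> \<open>D forces both frequencies into this ball, so truncating F and G leaves the
      form unchanged and replaces their L2 norms by localised ones, which negative Sobolev norms
      control.\<close>
    define F' where "F' = (\<lambda>\<xi>. indicator ?Q \<xi> * F \<xi>)"
    define G' where "G' = (\<lambda>\<eta>. indicator ?Q \<eta> * G \<eta>)"
    have DQ: "fst X \<in> ?Q \<and> snd X \<in> ?Q" if "X \<in> D" for X
      using D[OF that] by simp
    have trunc: "tri_form D F G t x = tri_form D F' G' t x" "tri_form_deriv D F G t x = tri_form_deriv D F' G' t x" for t x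
      unfolding F'_def G'_def by (rule tri_form_truncate, rule DQ, assumption)+
    have F': "integrable lborel F'" and G': "integrable lborel G'"
      unfolding F'_def G'_def
      by (rule Bochner_Integration.integrable_bound[OF F] Bochner_Integration.integrable_bound[OF G]; auto simp: indicator_def)+
    obtain BF where "\<And>\<xi>. cmod (F \<xi>) \<le> BF" using FB by blast
    moreover have "BF \<ge> 0" using calculation[of 0] norm_ge_zero[of "F 0"] by linarith
    ultimately have BF: "cmod (F' \<xi>) \<le> BF" for \<xi> by (auto simp: F'_def indicator_def)
    define nF where "nF = (\<integral>\<^sup>+ \<xi>. csq (F' \<xi>) \<partial>lborel)"
    define nG where "nG = (\<integral>\<^sup>+ \<xi>. csq (G' \<xi>) \<partial>lborel)"
    define U where "U x = (\<integral>\<^sup>+ t. csq (tri_form D F G t x) \<partial>unit_dilations)" for x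
    define V where "V x = (\<integral>\<^sup>+ t. csq (tri_form_deriv D F G t x) \<partial>unit_dilations)" for x
    interpret UD: finite_measure unit_dilations by (rule finite_unit_dilations)
    have tfm [measurable]: "(\<lambda>(x, t). tri_form D F G t x) \<in> borel_measurable (borel \<Otimes>\<^sub>M borel)"
      "(\<lambda>(x, t). tri_form_deriv D F G t x) \<in> borel_measurable (borel \<Otimes>\<^sub>M borel)"
      by (intro tri_form_measurable Fm Gm Dm)+
    have Um [measurable]: "U \<in> borel_measurable borel" and Vm [measurable]: "V \<in> borel_measurable borel"
      unfolding U_def V_def by measurable
    have nD: "norm X \<le> 4 * R" if "X \<in> D" for X
      using D[OF that] norm_Pair_le[of "fst X" "snd X"] by simp
    have Ule: "(\<integral>\<^sup>+ x. U x \<partial>lborel) \<le> ennreal (C0 * (R ^ 3 / R ^ ?d)) * nF * nG"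
      unfolding U_def trunc unfolding tri_form_def nF_def nG_def
    proof (rule bilinear_kernel_L2[OF finite_unit_dilations sets_unit_dilations F' G' BF])
      show "(\<lambda>(t, X). indicator D X * tri_mult (t *\<^sub>R X)) \<in> borel_measurable (borel \<Otimes>\<^sub>M borel)"
        by measurable
      show "cmod (indicator D X * tri_mult (t *\<^sub>R X)) \<le> 1" for t X
        using cmod_tri_mult_le[of "t *\<^sub>R X"] by (simp add: norm_mult indicator_def)
    qed (use bd[OF Dm R D_sub] in \<open>simp add: kernel_norm2_def\<close>)
    have Vle: "(\<integral>\<^sup>+ x. V x \<partial>lborel) \<le> ennreal (C0 * (R ^ 5 / R ^ ?d)) * nF * nG"
      unfolding V_def trunc unfolding tri_form_deriv_def nF_def nG_def
    proof (rule bilinear_kernel_L2[OF finite_unit_dilations sets_unit_dilations F' G' BF])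
      show "(\<lambda>(t, X). indicator D X * tri_phase t X) \<in> borel_measurable (borel \<Otimes>\<^sub>M borel)"
        by measurable
      show "cmod (indicator D X * tri_phase t X) \<le> 8 * R" for t X
        using cmod_tri_phase_le[of t X] nD[of X] R by (auto simp: norm_mult indicator_def)
    qed (use bd[OF Dm R D_sub] in \<open>simp add: kernel_norm2_def\<close>)
    define W where "W x = ennreal (2 * R) * U x + ennreal (2 / R) * (ennreal ((2 * pi)\<^sup>2) * V x)" for x
    have "csq (tri_form D F G t x) \<le> W x" if t: "t \<in> {1..2}" for t x
    proof -
      have [measurable]: "(\<lambda>t. tri_form D F G t x) \<in> borel_measurable borel" "(\<lambda>t. tri_form_deriv D F G t x) \<in> borel_measurable borel"
        using measurable_compose[OF measurable_Pair1'[of x borel borel] tfm(1)] measurable_compose[OF measurable_Pair1'[of x borel borel] tfm(2)] by auto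
      have "csq (tri_form D F G t x) \<le>
         ennreal (2 * R) * (\<integral>\<^sup>+ r. indicator {1..2} r * csq (tri_form D F G r x) \<partial>lborel) +
         ennreal (2 / R) * (\<integral>\<^sup>+ r. indicator {1..2} r * csq (2 * pi * tri_form_deriv D F G r x) \<partial>lborel)"
        using t R by (intro sup_interval_bound tri_form_diff[OF F G Dm nD]) auto
      also have "\<dots> = W x"
        by (simp add: W_def U_def V_def nn_integral_unit_dilations norm_mult power_mult_distrib ennreal_mult mult.left_commute flip: nn_integral_cmult)
      finally show ?thesis .
    qed
    moreover have "(\<integral>\<^sup>+ x. W x \<partial>lborel) \<le> ennreal (C * R powr (4 - real DIM('a) + 2 * (s\<^sub>1 + s\<^sub>2))) * (weighted_norm2 s\<^sub>1 F * weighted_norm2 s\<^sub>2 G)"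
    proof -
      let ?q = "R ^ 4 / R ^ ?d"
      have "(\<integral>\<^sup>+ x. W x \<partial>lborel) = ennreal (2 * R) * (\<integral>\<^sup>+ x. U x \<partial>lborel) + ennreal (2 / R) * (ennreal ((2 * pi)\<^sup>2) * (\<integral>\<^sup>+ x. V x \<partial>lborel))"
        unfolding W_def by (simp add: nn_integral_add nn_integral_cmult)
      also have "\<dots> \<le> ennreal (2 * R) * (ennreal (C0 * (R ^ 3 / R ^ ?d)) * nF * nG) + ennreal (2 / R) * (ennreal ((2 * pi)\<^sup>2) * (ennreal (C0 * (R ^ 5 / R ^ ?d)) * nF * nG))"
        by (intro add_mono mult_left_mono Ule Vle) auto
      also have "\<dots> = ennreal (2 * R * (C0 * (R ^ 3 / R ^ ?d))) * (nF * nG) + ennreal (2 / R * ((2 * pi)\<^sup>2 * (C0 * (R ^ 5 / R ^ ?d)))) * (nF * nG)"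
      proof -
        have a2: "ennreal a * (ennreal b * nF * nG) = ennreal (a * b) * (nF * nG)" if "0 \<le> a" "0 \<le> b" for a b
          using that by (simp add: ennreal_mult mult.assoc)
        have a3: "ennreal a * (ennreal b * (ennreal c * nF * nG)) = ennreal (a * (b * c)) * (nF * nG)" if "0 \<le> a" "0 \<le> b" "0 \<le> c" for a b c
          using that by (simp add: ennreal_mult mult.assoc)
        show ?thesis using R C0 by (subst a2, simp, simp, subst a3, simp_all)
      qed
      also have "\<dots> = ennreal (2 * R * (C0 * (R ^ 3 / R ^ ?d)) + 2 / R * ((2 * pi)\<^sup>2 * (C0 * (R ^ 5 / R ^ ?d)))) * (nF * nG)"
        using R C0 by (subst ennreal_plus) (auto simp: distrib_right)
      also have "2 * R * (C0 * (R ^ 3 / R ^ ?d)) + 2 / R * ((2 * pi)\<^sup>2 * (C0 * (R ^ 5 / R ^ ?d))) = (2 + 8 * pi\<^sup>2) * C0 * ?q"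
        using R by (simp add: field_simps power_mult_distrib eval_nat_numeral)
      also have "ennreal ((2 + 8 * pi\<^sup>2) * C0 * ?q) * (nF * nG) \<le> ennreal ((2 + 8 * pi\<^sup>2) * C0 * ?q) *
          ((ennreal ((5 * R\<^sup>2) powr s\<^sub>1) * weighted_norm2 s\<^sub>1 F) * (ennreal ((5 * R\<^sup>2) powr s\<^sub>2) * weighted_norm2 s\<^sub>2 G))"
        unfolding nF_def nG_def F'_def G'_def using s R by (intro mult_left_mono mult_mono truncated_norm_le) auto
      also have "\<dots> = (ennreal ((2 + 8 * pi\<^sup>2) * C0 * ?q) * (ennreal ((5 * R\<^sup>2) powr s\<^sub>1) * ennreal ((5 * R\<^sup>2) powr s\<^sub>2))) * (weighted_norm2 s\<^sub>1 F * weighted_norm2 s\<^sub>2 G)"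
        by (simp add: mult_ac)
      also have "ennreal ((2 + 8 * pi\<^sup>2) * C0 * ?q) * (ennreal ((5 * R\<^sup>2) powr s\<^sub>1) * ennreal ((5 * R\<^sup>2) powr s\<^sub>2)) =
          ennreal ((2 + 8 * pi\<^sup>2) * C0 * ?q * ((5 * R\<^sup>2) powr s\<^sub>1 * (5 * R\<^sup>2) powr s\<^sub>2))"
      proof -
        have "ennreal a * (ennreal b * ennreal c) = ennreal (a * (b * c))" if "0 \<le> a" "0 \<le> b" "0 \<le> c" for a b c
          using that by (simp add: ennreal_mult)
        then show ?thesis using C0 R by simp
      qed
      also have "(2 + 8 * pi\<^sup>2) * C0 * ?q * ((5 * R\<^sup>2) powr s\<^sub>1 * (5 * R\<^sup>2) powr s\<^sub>2) = C * R powr (4 - real DIM('a) + 2 * (s\<^sub>1 + s\<^sub>2))"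
      proof -
        have "?q = R powr (4 - real ?d)" using R by (simp add: powr_diff powr_realpow)
        moreover have "(5 * R\<^sup>2) powr s\<^sub>1 * (5 * R\<^sup>2) powr s\<^sub>2 = 5 powr (s\<^sub>1 + s\<^sub>2) * R powr (2 * (s\<^sub>1 + s\<^sub>2))"
        proof -
          have "(5 * R\<^sup>2) powr s = 5 powr s * R powr (2 * s)" for s
          proof -
            have "(5 * R\<^sup>2) powr s = (5 * R powr 2) powr s" using R by simp
            also have "\<dots> = 5 powr s * R powr (2 * s)"
              using R by (simp add: powr_mult powr_powr del: powr_numeral)
            finally show ?thesis .
          qed
          then show ?thesis by (simp add: powr_add distrib_left mult_ac)
        qed
        ultimately show ?thesis by (simp add: C_def powr_add)
      qed
      finally show ?thesis .
    qed
    moreover have "W \<in> borel_measurable borel" unfolding W_def by measurable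
    ultimately show "tri_form_dominated D F G (ennreal (C * R powr (4 - real DIM('a) + 2 * (s\<^sub>1 + s\<^sub>2))) * (weighted_norm2 s\<^sub>1 F * weighted_norm2 s\<^sub>2 G))"
      unfolding tri_form_dominated_def by blast
  qed
qed

text \<open>Half-open annuli in the first frequency, the zeroth one being a full ball: the shells
  are disjoint and exhaust D.\<close>

definition shell :: "('a::euclidean_space \<times> 'a) set \<Rightarrow> nat \<Rightarrow> ('a \<times> 'a) set" where
  "shell D k = D \<inter> {X. (2 ^ k \<le> norm (fst X) \<or> k = 0) \<and> norm (fst X) < 2 ^ Suc k}"

lemma sum_indicator_shell:
  "(\<Sum>k<Suc n. indicator (shell D k) X) = (indicator (D \<inter> {X. norm (fst X) < 2 ^ Suc n}) X :: complex)"
proof (induction n)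
  case 0
  show ?case by (simp add: shell_def)
next
  case (Suc n)
  have "indicator (D \<inter> {X. norm (fst X) < 2 ^ Suc n}) X + indicator (shell D (Suc n)) X =
      (indicator (D \<inter> {X. norm (fst X) < 2 ^ Suc (Suc n)}) X :: complex)"
    using less_le_trans[of "norm (fst X)" "2 ^ Suc n" "2 ^ Suc (Suc n)"]
    by (auto simp: shell_def indicator_def)
  then show ?case using Suc by simp
qed

definition tri_integrand :: "('a::euclidean_space \<Rightarrow> complex) \<Rightarrow> ('a \<Rightarrow> complex) \<Rightarrow> real \<Rightarrow> 'a \<Rightarrow> 'a \<times> 'a \<Rightarrow> complex" where
  "tri_integrand F G t x X = F (fst X) * G (snd X) * tri_mult (t *\<^sub>R X) * cis (2 * pi * (x \<bullet> (fst X + snd X)))"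

lemma tri_form_eq_integrand: "tri_form A F G t x = (LINT X|lborel. indicator A X * tri_integrand F G t x X)"
  unfolding tri_form_def tri_integrand_def by (simp add: mult_ac)

lemma integrable_tri_integrand:
  fixes F G :: "'a::euclidean_space \<Rightarrow> complex"
  assumes F: "integrable lborel F" and G: "integrable lborel G" and [measurable]: "A \<in> sets borel"
  shows "integrable lborel (\<lambda>X. indicator A X * tri_integrand F G t x X)"
proof (rule Bochner_Integration.integrable_bound[OF integrable_tensor[OF F G]])
  have [measurable]: "F \<in> borel_measurable borel" "G \<in> borel_measurable borel" using F G by auto
  show "(\<lambda>X. indicator A X * tri_integrand F G t x X) \<in> borel_measurable lborel"
    unfolding tri_integrand_def by measurable
  show "AE X in lborel. norm (indicator A X * tri_integrand F G t x X) \<le> norm (F (fst X) * G (snd X))"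
    by (intro always_eventually allI)
       (simp add: tri_integrand_def indicator_def norm_mult mult_left_le cmod_tri_mult_le)
qed

lemma tri_form_shell_sums:
  fixes F G :: "'a::euclidean_space \<Rightarrow> complex"
  assumes F: "integrable lborel F" and G: "integrable lborel G" and Dm [measurable]: "D \<in> sets borel"
  shows "(\<lambda>k. tri_form (shell D k) F G t x) sums tri_form D F G t x"
proof -
  have [measurable]: "shell D k \<in> sets borel" for k
    unfolding shell_def by measurable
  define h where "h = tri_integrand F G t x"
  note hD = integrable_tri_integrand[OF F G, of _ t x, folded h_def]
  note tf = tri_form_eq_integrand[of _ F G t x, folded h_def]
  have hi: "integrable lborel h" using hD[of UNIV] by simp
  then have [measurable]: "h \<in> borel_measurable borel" by simp
  have "(\<lambda>n. LINT X|lborel. indicator (D \<inter> {X. norm (fst X) < 2 ^ Suc n}) X * h X) \<longlonglongrightarrow> (LINT X|lborel. indicator D X * h X)"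
  proof (rule integral_dominated_convergence[where w = "\<lambda>X. norm (h X)"])
    show "AE X in lborel. (\<lambda>n. indicator (D \<inter> {X. norm (fst X) < 2 ^ Suc n}) X * h X) \<longlonglongrightarrow> indicator D X * h X"
    proof (intro always_eventually allI tendsto_mult tendsto_const)
      fix X :: "'a \<times> 'a"
      obtain N where N: "norm (fst X) < 2 ^ N" using real_arch_pow[of 2 "norm (fst X)"] by auto
      have "eventually (\<lambda>n. (indicator (D \<inter> {X. norm (fst X) < 2 ^ Suc n}) X :: complex) = indicator D X) sequentially"
        using eventually_ge_at_top[of N]
      proof eventually_elim
        case (elim n)
        have "(2::real) ^ N \<le> 2 ^ Suc n" using elim by (intro power_increasing) auto
        then have "norm (fst X) < 2 ^ Suc n" using N by linarith
        then show ?case by (simp add: indicator_def)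
      qed
      then show "(\<lambda>n. indicator (D \<inter> {X. norm (fst X) < 2 ^ Suc n}) X :: complex) \<longlonglongrightarrow> indicator D X"
        by (rule tendsto_eventually)
    qed
    show "integrable lborel (\<lambda>X. norm (h X))" using hi by simp
    show "AE X in lborel. norm (indicator (D \<inter> {X. norm (fst X) < 2 ^ Suc n}) X * h X) \<le> norm (h X)" for n
      by (auto simp: indicator_def)
  qed measurable
  moreover have "(LINT X|lborel. indicator (D \<inter> {X. norm (fst X) < 2 ^ Suc n}) X * h X) = (\<Sum>k<Suc n. tri_form (shell D k) F G t x)" for n
    unfolding tf sum_indicator_shell[symmetric] sum_distrib_right
    by (intro Bochner_Integration.integral_sum hD) measurable
  ultimately have "(\<lambda>n. \<Sum>k<Suc n. tri_form (shell D k) F G t x) \<longlonglongrightarrow> tri_form D F G t x"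
    by (simp only: tf[of D])
  then show ?thesis unfolding sums_def by (rule LIMSEQ_imp_Suc)
qed

text \<open>The dyadic pieces have squares of geometrically decaying total size, but the modulus of
  their sum has to be squared. Cauchy--Schwarz with geometric weights p^k handles this: one factor
  sums to at most K, and the loss p^(-2k) in the other uses up only half of the decay.\<close>

lemma half_form_bound:
  assumes dim: "DIM('a::euclidean_space) \<ge> 5" and s: "s\<^sub>1 \<ge> 0" "s\<^sub>2 \<ge> 0" "s\<^sub>1 + s\<^sub>2 < (real DIM('a) - 4) / 2"
  shows "\<exists>C>0. \<forall>(D :: ('a \<times> 'a) set) F G. D \<in> sets borel \<longrightarrow> (\<forall>X\<in>D. norm (snd X) \<le> norm (fst X)) \<longrightarrow>
    bounded_integrable F \<longrightarrow> bounded_integrable G \<longrightarrow>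
    tri_form_dominated D F G (ennreal C * (weighted_norm2 s\<^sub>1 F * weighted_norm2 s\<^sub>2 G))"
proof -
  obtain C0 where C0: "C0 > 0" and piece: "\<And>(D :: ('a \<times> 'a) set) R F G. D \<in> sets borel \<Longrightarrow> R \<ge> 1 \<Longrightarrow> D \<subseteq> dyadic_shell R \<Longrightarrow>
    bounded_integrable F \<Longrightarrow> bounded_integrable G \<Longrightarrow>
    tri_form_dominated D F G (ennreal (C0 * R powr (4 - real DIM('a) + 2 * (s\<^sub>1 + s\<^sub>2))) * (weighted_norm2 s\<^sub>1 F * weighted_norm2 s\<^sub>2 G))"
    using dyadic_piece[OF dim s(1,2)] by blast
  define \<gamma> where "\<gamma> = real DIM('a) - 4 - 2 * (s\<^sub>1 + s\<^sub>2)"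
  have \<gamma>: "\<gamma> > 0" using s(3) by (simp add: \<gamma>_def)
  \<comment> \<open>Chosen so that the k-th piece decays like p^(4k): after division by p^(2k) there
    remains p^(2k), a convergent geometric series with the same sum K as the weights.\<close>
  define p where "p = 2 powr (- \<gamma> / 4)"
  have p: "p > 0" "p < 1" using \<gamma> by (auto simp: p_def powr_less_one)
  have p2: "p\<^sup>2 > 0" "p\<^sup>2 < 1" using p by (auto simp: abs_square_less_1)
  define K where "K = 1 / (1 - p\<^sup>2)"
  have K: "K > 0" using p2 by (simp add: K_def)
  have Kge: "(\<Sum>k<n. (p\<^sup>2) ^ k) \<le> K" for n
    using p2 sum_le_suminf[OF summable_geometric, of "p\<^sup>2" "{..<n}"] suminf_geometric[of "p\<^sup>2"] by (simp add: K_def)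
  have pow: "(2 ^ k) powr (4 - real DIM('a) + 2 * (s\<^sub>1 + s\<^sub>2)) = (p\<^sup>2) ^ k * (p\<^sup>2) ^ k" for k
  proof -
    have "(2 ^ k) powr (4 - real DIM('a) + 2 * (s\<^sub>1 + s\<^sub>2)) = (2 powr real k) powr (- \<gamma>)"
      by (simp add: powr_realpow \<gamma>_def algebra_simps)
    also have "\<dots> = (2 powr (- \<gamma>)) ^ k" by (simp add: powr_powr mult.commute flip: powr_realpow)
    also have "2 powr (- \<gamma>) = p\<^sup>2 * p\<^sup>2" by (simp add: p_def power2_eq_square flip: powr_add)
    finally show ?thesis by (simp only: power_mult_distrib)
  qed
  show ?thesis
  proof (intro exI[of _ "K * (C0 * K)"] conjI allI impI)
    show "K * (C0 * K) > 0" using K C0 by simp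
    fix D :: "('a \<times> 'a) set" and F G :: "'a \<Rightarrow> complex"
    assume Dm [measurable]: "D \<in> sets borel" and D: "\<forall>X\<in>D. norm (snd X) \<le> norm (fst X)"
      and FG: "bounded_integrable F" "bounded_integrable G"
    then have F: "integrable lborel F" and G: "integrable lborel G" by (auto simp: bounded_integrable_def)
    define N where "N = weighted_norm2 s\<^sub>1 F * weighted_norm2 s\<^sub>2 G"
    have "tri_form_dominated (shell D k) F G (ennreal (C0 * (2 ^ k) powr (4 - real DIM('a) + 2 * (s\<^sub>1 + s\<^sub>2))) * N)" for k
      unfolding N_def
    proof (rule piece[OF _ _ _ FG])
      show "shell D k \<in> sets borel" unfolding shell_def by measurable
      show "shell D k \<subseteq> dyadic_shell (2 ^ k)"
        using D by (auto simp: shell_def dyadic_shell_def)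
    qed simp
    then obtain W where Wm [measurable]: "\<And>k. W k \<in> borel_measurable borel"
      and W: "\<And>k t x. t \<in> {1..2} \<Longrightarrow> csq (tri_form (shell D k) F G t x) \<le> W k x"
      and WI: "\<And>k. (\<integral>\<^sup>+ x. W k x \<partial>lborel) \<le> ennreal (C0 * ((p\<^sup>2) ^ k * (p\<^sup>2) ^ k)) * N"
      unfolding tri_form_dominated_def pow Bex_def by metis
    define \<Omega> where "\<Omega> x = ennreal K * (\<Sum>k. ennreal (1 / (p\<^sup>2) ^ k) * W k x)" for x
    have "csq (tri_form D F G t x) \<le> \<Omega> x" if t: "t \<in> {1..2}" for t x
    proof -
      let ?u = "\<lambda>k. tri_form (shell D k) F G t x"
      have le: "csq (\<Sum>k<n. ?u k) \<le> \<Omega> x" for n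
      proof -
        have "cmod (\<Sum>k<n. ?u k) \<le> (\<Sum>k<n. p ^ k * (cmod (?u k) / p ^ k))"
          using p by (simp add: norm_sum)
        then have "(cmod (\<Sum>k<n. ?u k))\<^sup>2 \<le> (\<Sum>k<n. p ^ k * (cmod (?u k) / p ^ k))\<^sup>2"
          by (intro power_mono) auto
        also have "\<dots> \<le> (\<Sum>k<n. (p ^ k)\<^sup>2) * (\<Sum>k<n. (cmod (?u k) / p ^ k)\<^sup>2)"
          by (rule Cauchy_Schwarz_ineq_sum)
        also have "\<dots> \<le> K * (\<Sum>k<n. (cmod (?u k) / p ^ k)\<^sup>2)"
          using Kge[of n] by (intro mult_right_mono sum_nonneg) (auto simp: power_even_eq power_mult[symmetric] mult.commute)
        also have "(\<Sum>k<n. (cmod (?u k) / p ^ k)\<^sup>2) = (\<Sum>k<n. 1 / (p\<^sup>2) ^ k * (cmod (?u k))\<^sup>2)"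
          by (simp add: power_divide power_mult[symmetric] mult.commute)
        finally have "csq (\<Sum>k<n. ?u k) \<le> ennreal (K * (\<Sum>k<n. 1 / (p\<^sup>2) ^ k * (cmod (?u k))\<^sup>2))"
          by (rule ennreal_leI)
        also have "\<dots> = ennreal K * (\<Sum>k<n. ennreal (1 / (p\<^sup>2) ^ k) * csq (?u k))"
          using K p by (subst ennreal_mult) (auto intro!: sum_nonneg simp: ennreal_mult[symmetric] sum_ennreal)
        also have "\<dots> \<le> ennreal K * (\<Sum>k<n. ennreal (1 / (p\<^sup>2) ^ k) * W k x)"
          by (intro mult_left_mono sum_mono W t) auto
        also have "\<dots> \<le> \<Omega> x"
          unfolding \<Omega>_def by (intro mult_left_mono sum_le_suminf) auto
        finally show ?thesis .
      qed
      have "(\<lambda>n. csq (\<Sum>k<n. ?u k)) \<longlonglongrightarrow> csq (tri_form D F G t x)"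
        using tri_form_shell_sums[OF F G Dm, of t x] unfolding sums_def by (intro tendsto_ennrealI tendsto_intros)
      then show ?thesis by (rule LIMSEQ_le_const2) (use le in blast)
    qed
    moreover have "(\<integral>\<^sup>+ x. \<Omega> x \<partial>lborel) \<le> ennreal (K * (C0 * K)) * N"
    proof -
      have "(\<integral>\<^sup>+ x. \<Omega> x \<partial>lborel) = ennreal K * (\<Sum>k. ennreal (1 / (p\<^sup>2) ^ k) * (\<integral>\<^sup>+ x. W k x \<partial>lborel))"
        unfolding \<Omega>_def by (simp add: nn_integral_cmult nn_integral_suminf)
      also have "\<dots> \<le> ennreal K * (\<Sum>k. ennreal (1 / (p\<^sup>2) ^ k) * (ennreal (C0 * ((p\<^sup>2) ^ k * (p\<^sup>2) ^ k)) * N))"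
        by (intro mult_left_mono suminf_le WI) auto
      also have "\<dots> = ennreal K * (\<Sum>k. ennreal (C0 * (p\<^sup>2) ^ k) * N)"
        using p C0 by (subst ennreal_mult_mult) (auto simp: field_simps)
      also have "\<dots> = ennreal K * ((\<Sum>k. ennreal (C0 * (p\<^sup>2) ^ k)) * N)"
        by simp
      also have "(\<Sum>k. ennreal (C0 * (p\<^sup>2) ^ k)) = ennreal (C0 * K)"
      proof -
        have "(\<lambda>k. C0 * (p\<^sup>2) ^ k) sums (C0 * K)"
          unfolding K_def by (intro sums_mult geometric_sums) (use p2 in auto)
        then show ?thesis
          using C0 p2 by (intro suminf_ennreal_eq) auto
      qed
      also have "ennreal K * (ennreal (C0 * K) * N) = ennreal (K * (C0 * K)) * N"
        using K C0 by (intro ennreal_mult_mult) auto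
      finally show ?thesis .
    qed
    moreover have "\<Omega> \<in> borel_measurable borel" unfolding \<Omega>_def by measurable
    ultimately show "tri_form_dominated D F G (ennreal (K * (C0 * K)) * (weighted_norm2 s\<^sub>1 F * weighted_norm2 s\<^sub>2 G))"
      unfolding tri_form_dominated_def N_def by blast
  qed
qed

section \<open>Exchanging the two frequencies\<close>

lemma tri_mult_swap: "tri_mult (prod.swap X) = tri_mult (X :: 'a::euclidean_space \<times> 'a)"
proof -
  have [measurable]: "prod.swap \<in> borel_measurable (borel :: ('a \<times> 'a) measure)"
    unfolding prod.swap_def by (intro borel_measurable_continuous_onI continuous_intros)
  have "tri_mult (prod.swap X) = (LINT p|distr triangle_measure borel prod.swap. cis (- 2 * pi * (prod.swap X \<bullet> p)))"
    by (simp only: tri_mult_def triangle_measure_swap)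
  also have "\<dots> = (LINT p|triangle_measure. cis (- 2 * pi * (prod.swap X \<bullet> prod.swap p)))"
    by (rule integral_distr) simp_all
  also have "\<dots> = tri_mult X"
    unfolding tri_mult_def by (simp add: inner_prod_def add.commute)
  finally show ?thesis .
qed

lemma tri_form_swap:
  fixes F G :: "'a::euclidean_space \<Rightarrow> complex"
  assumes [measurable]: "F \<in> borel_measurable borel" "G \<in> borel_measurable borel" "D \<in> sets borel"
  shows "tri_form D F G t x = tri_form (prod.swap -` D) G F t x"
proof -
  have sw [measurable]: "prod.swap \<in> borel_measurable (borel :: ('a \<times> 'a) measure)"
    unfolding prod.swap_def by (intro borel_measurable_continuous_onI continuous_intros)
  have d: "distr lborel borel prod.swap = (lborel :: ('a \<times> 'a) measure)"
  proof -
    have "distr (lborel \<Otimes>\<^sub>M lborel) (lborel \<Otimes>\<^sub>M lborel) (\<lambda>(x, y). (y, x)) = (lborel \<Otimes>\<^sub>M lborel :: ('a \<times> 'a) measure)"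
      by (rule lborel_pair.distr_pair_swap[symmetric])
    then have "distr lborel lborel (\<lambda>(x, y). (y, x)) = (lborel :: ('a \<times> 'a) measure)"
      by (simp only: lborel_prod)
    moreover have "distr lborel borel prod.swap = distr lborel lborel (\<lambda>(x, y). (y :: 'a, x :: 'a))"
      by (rule distr_cong) (auto simp: prod.swap_def split_beta)
    ultimately show ?thesis by simp
  qed
  let ?h = "\<lambda>X. F (fst X) * G (snd X) * (indicator D X * tri_mult (t *\<^sub>R X)) * cis (2 * pi * (x \<bullet> (fst X + snd X)))"
  have "tri_form D F G t x = (LINT X|distr lborel borel prod.swap. ?h X)"
    by (simp only: tri_form_def d)
  also have "\<dots> = (LINT X|lborel. ?h (prod.swap X))"
    by (rule integral_distr) simp_all
  also have "\<dots> = tri_form (prod.swap -` D) G F t x"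
  proof -
    have "tri_mult (t *\<^sub>R prod.swap X) = tri_mult (t *\<^sub>R X)" for X :: "'a \<times> 'a"
      using tri_mult_swap[of "t *\<^sub>R X"] by (simp add: prod.swap_def)
    then show ?thesis unfolding tri_form_def
      by (intro Bochner_Integration.integral_cong refl) (simp add: indicator_def add.commute mult_ac)
  qed
  finally show ?thesis .
qed

text \<open>Frequency space is split according to which frequency is larger. The measure of
  triangles is symmetric in its two vertices, so the part with larger second frequency is a form of
  the first kind with F and G, and the two exponents, exchanged.\<close>

lemma tri_form_bound:
  assumes dim: "DIM('a::euclidean_space) \<ge> 5" and s: "s\<^sub>1 \<ge> 0" "s\<^sub>2 \<ge> 0" "s\<^sub>1 + s\<^sub>2 < (real DIM('a) - 4) / 2"
  shows "\<exists>C>0. \<forall>F G :: 'a \<Rightarrow> complex. bounded_integrable F \<longrightarrow> bounded_integrable G \<longrightarrow>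
    tri_form_dominated UNIV F G (ennreal C * (weighted_norm2 s\<^sub>1 F * weighted_norm2 s\<^sub>2 G))"
proof -
  have s': "s\<^sub>2 + s\<^sub>1 < (real DIM('a) - 4) / 2" using s(3) by simp
  obtain C1 where C1: "C1 > 0" and b1: "\<And>(D :: ('a \<times> 'a) set) F G. D \<in> sets borel \<Longrightarrow> (\<forall>X\<in>D. norm (snd X) \<le> norm (fst X)) \<Longrightarrow>
    bounded_integrable F \<Longrightarrow> bounded_integrable G \<Longrightarrow> tri_form_dominated D F G (ennreal C1 * (weighted_norm2 s\<^sub>1 F * weighted_norm2 s\<^sub>2 G))"
    using half_form_bound[OF dim s] by blast
  obtain C2 where C2: "C2 > 0" and b2: "\<And>(D :: ('a \<times> 'a) set) F G. D \<in> sets borel \<Longrightarrow> (\<forall>X\<in>D. norm (snd X) \<le> norm (fst X)) \<Longrightarrow>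
    bounded_integrable F \<Longrightarrow> bounded_integrable G \<Longrightarrow> tri_form_dominated D F G (ennreal C2 * (weighted_norm2 s\<^sub>2 F * weighted_norm2 s\<^sub>1 G))"
    using half_form_bound[OF dim s(2,1) s'] by blast
  show ?thesis
  proof (intro exI[of _ "2 * C1 + 2 * C2"] conjI allI impI)
    show "2 * C1 + 2 * C2 > 0" using C1 C2 by simp
    fix F G :: "'a \<Rightarrow> complex"
    assume FB: "bounded_integrable F" and GB: "bounded_integrable G"
    then have F: "integrable lborel F" and G: "integrable lborel G" by (auto simp: bounded_integrable_def)
    have Fm [measurable]: "F \<in> borel_measurable borel" and Gm [measurable]: "G \<in> borel_measurable borel" using F G by auto
    define D1 where "D1 = {X :: 'a \<times> 'a. norm (snd X) \<le> norm (fst X)}"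
    define D2 where "D2 = {X :: 'a \<times> 'a. norm (fst X) < norm (snd X)}"
    have D1m [measurable]: "D1 \<in> sets borel" and D2m [measurable]: "D2 \<in> sets borel" unfolding D1_def D2_def by measurable
    have D2s: "prod.swap -` D2 = {X :: 'a \<times> 'a. norm (snd X) < norm (fst X)}" by (auto simp: D2_def)
    obtain W1 where W1 [measurable]: "W1 \<in> borel_measurable borel"
      and W1b: "\<And>t x. t \<in> {1..2} \<Longrightarrow> csq (tri_form D1 F G t x) \<le> W1 x"
      and W1i: "(\<integral>\<^sup>+ x. W1 x \<partial>lborel) \<le> ennreal C1 * (weighted_norm2 s\<^sub>1 F * weighted_norm2 s\<^sub>2 G)"
      using b1[OF D1m _ FB GB] by (auto simp: D1_def tri_form_dominated_def)
    have D2sm: "prod.swap -` D2 \<in> sets borel" unfolding D2s by measurable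
    obtain W2 where W2 [measurable]: "W2 \<in> borel_measurable borel"
      and W2b: "\<And>t x. t \<in> {1..2} \<Longrightarrow> csq (tri_form (prod.swap -` D2) G F t x) \<le> W2 x"
      and W2i: "(\<integral>\<^sup>+ x. W2 x \<partial>lborel) \<le> ennreal C2 * (weighted_norm2 s\<^sub>2 G * weighted_norm2 s\<^sub>1 F)"
      using b2[OF D2sm _ GB FB] unfolding D2s tri_form_dominated_def by fastforce
    define W where "W x = ennreal 2 * W1 x + ennreal 2 * W2 x" for x
    have "csq (tri_form UNIV F G t x) \<le> W x" if t: "t \<in> {1..2}" for t x
    proof -
      have "tri_form UNIV F G t x = tri_form D1 F G t x + tri_form D2 F G t x"
        unfolding tri_form_eq_integrand
        by (subst Bochner_Integration.integral_add[symmetric]; (intro integrable_tri_integrand F G D1m D2m)?)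
          (auto simp: D1_def D2_def indicator_def intro!: Bochner_Integration.integral_cong)
      also have "tri_form D2 F G t x = tri_form (prod.swap -` D2) G F t x"
        by (rule tri_form_swap) measurable
      finally have eq: "tri_form UNIV F G t x = tri_form D1 F G t x + tri_form (prod.swap -` D2) G F t x" .
      let ?a = "cmod (tri_form D1 F G t x)" and ?b = "cmod (tri_form (prod.swap -` D2) G F t x)"
      have "(cmod (tri_form UNIV F G t x))\<^sup>2 \<le> (?a + ?b)\<^sup>2"
        unfolding eq by (intro power_mono norm_triangle_ineq) simp
      also have "\<dots> \<le> 2 * ?a\<^sup>2 + 2 * ?b\<^sup>2"
        using sum_squares_bound[of ?a ?b] by (simp add: power2_sum)
      finally have "csq (tri_form UNIV F G t x) \<le> ennreal (2 * ?a\<^sup>2 + 2 * ?b\<^sup>2)" by (rule ennreal_leI)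
      also have "\<dots> = ennreal 2 * ennreal (?a\<^sup>2) + ennreal 2 * ennreal (?b\<^sup>2)"
        by (simp add: ennreal_plus ennreal_mult del: ennreal_numeral)
      also have "\<dots> \<le> W x" unfolding W_def by (intro add_mono mult_left_mono W1b W2b t) auto
      finally show ?thesis .
    qed
    moreover have "(\<integral>\<^sup>+ x. W x \<partial>lborel) \<le> ennreal (2 * C1 + 2 * C2) * (weighted_norm2 s\<^sub>1 F * weighted_norm2 s\<^sub>2 G)"
    proof -
      have "(\<integral>\<^sup>+ x. W x \<partial>lborel) = ennreal 2 * (\<integral>\<^sup>+ x. W1 x \<partial>lborel) + ennreal 2 * (\<integral>\<^sup>+ x. W2 x \<partial>lborel)"
        unfolding W_def by (simp add: nn_integral_add nn_integral_cmult)
      also have "\<dots> \<le> ennreal 2 * (ennreal C1 * (weighted_norm2 s\<^sub>1 F * weighted_norm2 s\<^sub>2 G)) + ennreal 2 * (ennreal C2 * (weighted_norm2 s\<^sub>1 F * weighted_norm2 s\<^sub>2 G))"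
        using W2i by (intro add_mono mult_left_mono W1i) (auto simp: mult.commute)
      also have "\<dots> = ennreal (2 * C1 + 2 * C2) * (weighted_norm2 s\<^sub>1 F * weighted_norm2 s\<^sub>2 G)"
        using C1 C2 by (simp add: ennreal_plus ennreal_mult_mult distrib_right del: ennreal_numeral)
      finally show ?thesis .
    qed
    moreover have "W \<in> borel_measurable borel" unfolding W_def by measurable
    ultimately show "tri_form_dominated UNIV F G (ennreal (2 * C1 + 2 * C2) * (weighted_norm2 s\<^sub>1 F * weighted_norm2 s\<^sub>2 G))"
      unfolding tri_form_dominated_def by blast
  qed
qed

section \<open>Mollification and the maximal function\<close>

lemma fourier_eq_cis: "fourier f \<xi> = (LINT x|lborel. f x * cis (- 2 * pi * (x \<bullet> \<xi>)))"
  unfolding fourier_def cis_conv_exp by (simp add: mult_ac)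

lemma borel_measurable_fourier [measurable]:
  assumes [measurable]: "f \<in> borel_measurable borel"
  shows "fourier f \<in> borel_measurable borel"
  unfolding fourier_eq_cis[abs_def] by measurable

lemma cmod_fourier_le:
  fixes f :: "'a::euclidean_space \<Rightarrow> complex"
  assumes "integrable lborel f"
  shows "cmod (fourier f \<xi>) \<le> (LINT x|lborel. cmod (f x))"
  unfolding fourier_eq_cis
  by (rule order_trans[OF integral_norm_bound]) (simp add: norm_mult)

text \<open>The Gaussian factor makes this integrable for every integrable f, so that
  \<open>tri_form\<close> applies, and it never increases the modulus of the transform, so that
  weighted norms stay bounded uniformly in n.\<close>

definition mollified_fourier :: "nat \<Rightarrow> ('a::euclidean_space \<Rightarrow> complex) \<Rightarrow> 'a \<Rightarrow> complex" where
  "mollified_fourier n f \<xi> = complex_of_real (gaussian (1 / real (Suc n)) \<xi>) * fourier f \<xi>"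

definition mollify :: "nat \<Rightarrow> ('a::euclidean_space \<Rightarrow> complex) \<Rightarrow> 'a \<Rightarrow> complex" where
  "mollify n f x = (LINT \<xi>|lborel. mollified_fourier n f \<xi> * cis (2 * pi * (x \<bullet> \<xi>)))"

lemma mollified_fourier_integrable:
  fixes f :: "'a::euclidean_space \<Rightarrow> complex"
  assumes f: "integrable lborel f"
  shows "integrable lborel (mollified_fourier n f)"
proof -
  have [measurable]: "f \<in> borel_measurable borel" using f by simp
  have "integrable lborel (\<lambda>\<xi>::'a. (LINT x|lborel. cmod (f x)) * gaussian (1 / real (Suc n)) \<xi>)"
    using gaussian_integral[of "1 / real (Suc n)", where 'a='a]
    by (intro integrable_mult_right) (auto simp: has_bochner_integral_iff)
  then show ?thesis
  proof (rule Bochner_Integration.integrable_bound)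
    show "mollified_fourier n f \<in> borel_measurable lborel"
      unfolding mollified_fourier_def[abs_def] by measurable
    show "AE \<xi> in lborel. norm (mollified_fourier n f \<xi>) \<le> norm ((LINT x|lborel. cmod (f x)) * gaussian (1 / real (Suc n)) \<xi>)"
      by (intro always_eventually allI)
        (simp add: mollified_fourier_def norm_mult mult.commute[of _ "gaussian _ _"] mult_left_mono cmod_fourier_le[OF f])
  qed
qed

lemma mollified_fourier_bounded:
  assumes "integrable lborel f"
  shows "cmod (mollified_fourier n f \<xi>) \<le> cmod (fourier f \<xi>)" "bounded_integrable (mollified_fourier n f)"
proof -
  show le: "cmod (mollified_fourier n f \<xi>) \<le> cmod (fourier f \<xi>)" for \<xi>
    by (simp add: mollified_fourier_def norm_mult mult_left_le_one_le gaussian_le_1)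
  show "bounded_integrable (mollified_fourier n f)"
    using order_trans[OF le cmod_fourier_le[OF assms]] mollified_fourier_integrable[OF assms]
    unfolding bounded_integrable_def by blast
qed

text \<open>Fourier inversion for the damped transform, by Fubini's theorem and
  \<open>gaussian_fourier\<close>: the result is the convolution of f with a Gaussian concentrated
  at scale 1 / (n + 1), rescaled so that n appears only in the argument of f.\<close>

lemma mollify_eq:
  fixes f :: "'a::euclidean_space \<Rightarrow> complex"
  assumes f: "integrable lborel f"
  shows "mollify n f x = (LINT w|lborel. f (x - (1 / real (Suc n)) *\<^sub>R w) * complex_of_real (gaussian 1 w))"
proof -
  define \<rho> where "\<rho> = real (Suc n)"
  have \<rho>: "\<rho> > 0" by (simp add: \<rho>_def)
  have [measurable]: "f \<in> borel_measurable borel" using f by simp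
  have gi: "integrable lborel (\<lambda>\<xi>::'a. complex_of_real (gaussian (1 / \<rho>) \<xi>))"
    using gaussian_integral[of "1 / \<rho>", where 'a='a] \<rho> by (auto simp: has_bochner_integral_iff)
  define h where "h = (\<lambda>(\<xi>, y). complex_of_real (gaussian (1 / \<rho>) \<xi>) * f y * cis (2 * pi * (\<xi> \<bullet> (x - y))))"
  have hm [measurable]: "h \<in> borel_measurable (lborel \<Otimes>\<^sub>M lborel)" unfolding h_def by measurable
  have hi: "integrable (lborel \<Otimes>\<^sub>M lborel) h"
    by (rule Bochner_Integration.integrable_bound[OF lborel_pair.integrable_pair_mult[OF gi f] hm])
       (auto simp: h_def norm_mult)
  have "mollify n f x = (LINT \<xi>|lborel. LINT y|lborel. h (\<xi>, y))"
    unfolding mollify_def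
  proof (intro Bochner_Integration.integral_cong refl)
    fix \<xi> :: 'a
    have "(LINT y|lborel. h (\<xi>, y)) = (LINT y|lborel. complex_of_real (gaussian (1 / \<rho>) \<xi>) * cis (2 * pi * (x \<bullet> \<xi>)) * (f y * cis (- 2 * pi * (y \<bullet> \<xi>))))"
      by (intro Bochner_Integration.integral_cong refl)
         (simp add: h_def inner_diff_right cis_mult inner_commute[of \<xi>] algebra_simps)
    also have "\<dots> = mollified_fourier n f \<xi> * cis (2 * pi * (x \<bullet> \<xi>))"
      by (subst integral_mult_right_zero) (simp add: mollified_fourier_def fourier_eq_cis \<rho>_def)
    finally show "mollified_fourier n f \<xi> * cis (2 * pi * (x \<bullet> \<xi>)) = (LINT y|lborel. h (\<xi>, y))" by simp
  qed
  also have "\<dots> = (LINT y|lborel. LINT \<xi>|lborel. h (\<xi>, y))"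
    using lborel_pair.Fubini_integral[of "\<lambda>\<xi> y. h (\<xi>, y)"] hi by simp
  also have "\<dots> = (LINT y|lborel. f y * complex_of_real (\<rho> ^ DIM('a) * gaussian \<rho> (x - y)))"
  proof (intro Bochner_Integration.integral_cong refl)
    fix y
    have "(LINT \<xi>|lborel. h (\<xi>, y)) = (LINT \<xi>|lborel. f y * (gaussian (1 / \<rho>) \<xi> *\<^sub>R cis (2 * pi * (\<xi> \<bullet> (x - y)))))"
      by (simp add: h_def scaleR_conv_of_real mult_ac)
    then show "(LINT \<xi>|lborel. h (\<xi>, y)) = f y * complex_of_real (\<rho> ^ DIM('a) * gaussian \<rho> (x - y))"
      by (simp only: integral_mult_right_zero has_bochner_integral_integral_eq[OF gaussian_fourier[OF \<rho>]])
  qed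
  also have "\<dots> = (LINT w|lborel. f (x - (1 / \<rho>) *\<^sub>R w) * complex_of_real (gaussian 1 w))"
  proof -
    let ?g = "\<lambda>y. f y * complex_of_real (\<rho> ^ DIM('a) * gaussian \<rho> (x - y))"
    have "(LINT y|lborel. ?g y) = (LINT y|density (distr lborel borel (\<lambda>w. x + (- 1 / \<rho>) *\<^sub>R w)) (\<lambda>_. ennreal (\<bar>- 1 / \<rho>\<bar> ^ DIM('a))). ?g y)"
      using \<rho> by (subst lborel_affine[of "- 1 / \<rho>" x]) auto
    also have "\<dots> = (LINT y|distr lborel borel (\<lambda>w. x + (- 1 / \<rho>) *\<^sub>R w). (\<bar>- 1 / \<rho>\<bar> ^ DIM('a)) *\<^sub>R ?g y)"
      by (subst integral_density) auto
    also have "\<dots> = (LINT w|lborel. (\<bar>- 1 / \<rho>\<bar> ^ DIM('a)) *\<^sub>R ?g (x + (- 1 / \<rho>) *\<^sub>R w))"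
      by (subst integral_distr) auto
    also have "\<dots> = (LINT w|lborel. f (x - (1 / \<rho>) *\<^sub>R w) * complex_of_real (gaussian 1 w))"
    proof (intro Bochner_Integration.integral_cong refl)
      fix w :: 'a
      have "gaussian \<rho> (x - (x + (- 1 / \<rho>) *\<^sub>R w)) = gaussian 1 w"
        using \<rho> by (simp add: gaussian_def)
      then show "(\<bar>- 1 / \<rho>\<bar> ^ DIM('a)) *\<^sub>R ?g (x + (- 1 / \<rho>) *\<^sub>R w) = f (x - (1 / \<rho>) *\<^sub>R w) * complex_of_real (gaussian 1 w)"
        using \<rho> by (simp add: scaleR_conv_of_real power_divide)
    qed
    finally show ?thesis .
  qed
  finally show ?thesis by (simp add: \<rho>_def)
qed

lemma mollify_bounds:
  fixes f :: "'a::euclidean_space \<Rightarrow> complex"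
  assumes f: "integrable lborel f" and cont: "continuous_on UNIV f" and B: "\<And>x. cmod (f x) \<le> B"
  shows "cmod (mollify n f x) \<le> B" "(\<lambda>n. mollify n f x) \<longlonglongrightarrow> f x"
proof -
  have fm [measurable]: "f \<in> borel_measurable borel" using f by simp
  have B0: "B \<ge> 0" using order_trans[OF norm_ge_zero B] .
  have gi: "integrable lborel (gaussian 1 :: 'a \<Rightarrow> real)" and g1: "(LINT w|lborel. gaussian 1 (w::'a)) = 1"
    using gaussian_integral[of 1, where 'a='a] by (auto simp: has_bochner_integral_iff)
  have bd: "cmod (f (x - c *\<^sub>R w) * complex_of_real (gaussian 1 w)) \<le> B * gaussian 1 w" for c and w :: 'a
    using B by (simp add: norm_mult mult_right_mono)
  have "cmod (mollify n f x) \<le> (LINT w|lborel. B * gaussian 1 (w::'a))"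
    unfolding mollify_eq[OF f]
    by (intro order_trans[OF integral_norm_bound] integral_mono' integrable_mult_right gi bd) (simp add: B0)
  then show "cmod (mollify n f x) \<le> B" by (simp add: g1)
  have "(\<lambda>n. LINT w|lborel. f (x - (1 / real (Suc n)) *\<^sub>R w) * complex_of_real (gaussian 1 w)) \<longlonglongrightarrow> (LINT w|lborel. f x * complex_of_real (gaussian 1 (w::'a)))"
  proof (rule integral_dominated_convergence[where w = "\<lambda>w::'a. B * gaussian 1 w"])
    show "AE w in lborel. (\<lambda>n. f (x - (1 / real (Suc n)) *\<^sub>R w) * complex_of_real (gaussian 1 w)) \<longlonglongrightarrow> f x * complex_of_real (gaussian 1 w)"
    proof (intro always_eventually allI tendsto_mult tendsto_const)
      fix w :: 'a
      have "(\<lambda>n. x - (1 / real (Suc n)) *\<^sub>R w) \<longlonglongrightarrow> x - 0 *\<^sub>R w"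
        by (intro tendsto_intros LIMSEQ_Suc[OF lim_1_over_n])
      then show "(\<lambda>n. f (x - (1 / real (Suc n)) *\<^sub>R w)) \<longlonglongrightarrow> f x"
        by (intro continuous_on_tendsto_compose[OF cont]) auto
    qed
  qed (use gi bd in auto)
  then show "(\<lambda>n. mollify n f x) \<longlonglongrightarrow> f x"
    by (simp add: mollify_eq[OF f] g1)
qed

text \<open>After Fubini's theorem each pair of frequencies contributes its character at x times the
  average over triangles of the character at t X, which is the multiplier at that point.\<close>

lemma triangle_avg_eq_tri_form:
  fixes F G :: "'a::euclidean_space \<Rightarrow> complex"
  assumes F: "integrable lborel F" and G: "integrable lborel G"
  shows "triangle_avg t (\<lambda>x. LINT \<xi>|lborel. F \<xi> * cis (2 * pi * (x \<bullet> \<xi>))) (\<lambda>x. LINT \<eta>|lborel. G \<eta> * cis (2 * pi * (x \<bullet> \<eta>))) x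
    = tri_form UNIV F G t x"
proof -
  interpret T: finite_measure "triangle_measure :: ('a \<times> 'a) measure" by (rule finite_triangle_measure)
  interpret LT: pair_sigma_finite "lborel :: ('a \<times> 'a) measure" "triangle_measure :: ('a \<times> 'a) measure" ..
  have [measurable]: "F \<in> borel_measurable borel" "G \<in> borel_measurable borel" using F G by auto
  define c where "c X = F (fst X) * G (snd X) * cis (2 * pi * (x \<bullet> (fst X + snd X)))" for X
  have cm [measurable]: "c \<in> borel_measurable borel" unfolding c_def by measurable
  have ci: "integrable lborel c"
    by (rule Bochner_Integration.integrable_bound[OF integrable_tensor[OF F G]]) (auto simp: c_def norm_mult)
  define h where "h = (\<lambda>(X, p). c X * cis (- 2 * pi * ((t *\<^sub>R X) \<bullet> p)))"
  have hm [measurable]: "h \<in> borel_measurable (lborel \<Otimes>\<^sub>M triangle_measure)" unfolding h_def by measurable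
  have hi: "integrable (lborel \<Otimes>\<^sub>M triangle_measure) h"
    using LT.integrable_pair_mult[OF ci, of "\<lambda>_. 1"]
    by (rule Bochner_Integration.integrable_bound[OF _ hm]) (auto simp: h_def norm_mult)
  have "triangle_avg t (\<lambda>x. LINT \<xi>|lborel. F \<xi> * cis (2 * pi * (x \<bullet> \<xi>))) (\<lambda>x. LINT \<eta>|lborel. G \<eta> * cis (2 * pi * (x \<bullet> \<eta>))) x
    = (LINT p|triangle_measure. LINT X|lborel. h (X, p))"
    unfolding triangle_avg_def
  proof (intro Bochner_Integration.integral_cong refl, unfold split_beta)
    fix p :: "'a \<times> 'a"
    let ?F = "\<lambda>\<xi>. F \<xi> * cis (2 * pi * ((x - t *\<^sub>R fst p) \<bullet> \<xi>))" and ?G = "\<lambda>\<eta>. G \<eta> * cis (2 * pi * ((x - t *\<^sub>R snd p) \<bullet> \<eta>))"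
    have Fi: "integrable lborel ?F" by (rule Bochner_Integration.integrable_bound[OF F]) (auto simp: norm_mult)
    have Gi: "integrable lborel ?G" by (rule Bochner_Integration.integrable_bound[OF G]) (auto simp: norm_mult)
    have "(LINT \<xi>|lborel. ?F \<xi>) * (LINT \<eta>|lborel. ?G \<eta>) = (LINT \<xi>|lborel. LINT \<eta>|lborel. ?F \<xi> * ?G \<eta>)"
      by (simp only: integral_mult_right_zero integral_mult_left_zero)
    also have "\<dots> = (LINT X|lborel. ?F (fst X) * ?G (snd X))"
      using lborel_pair.integral_fst'[of "\<lambda>X. ?F (fst X) * ?G (snd X)"] integrable_tensor[OF Fi Gi]
      by (simp add: lborel_prod)
    also have "\<dots> = (LINT X|lborel. h (X, p))"
    proof (intro Bochner_Integration.integral_cong refl)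
      fix X :: "'a \<times> 'a"
      have "cis (2 * pi * ((x - t *\<^sub>R fst p) \<bullet> fst X)) * cis (2 * pi * ((x - t *\<^sub>R snd p) \<bullet> snd X)) =
          cis (2 * pi * (x \<bullet> (fst X + snd X))) * cis (- 2 * pi * ((t *\<^sub>R X) \<bullet> p))"
        unfolding cis_mult by (rule arg_cong[of _ _ cis])
          (simp add: inner_prod_def inner_diff_left inner_add_right inner_commute[of "fst p"] inner_commute[of "snd p"] algebra_simps)
      then show "?F (fst X) * ?G (snd X) = h (X, p)" by (simp add: h_def c_def mult_ac)
    qed
    finally show "(LINT \<xi>|lborel. ?F \<xi>) * (LINT \<eta>|lborel. ?G \<eta>) = (LINT X|lborel. h (X, p))" .
  qed
  also have "\<dots> = (LINT X|lborel. LINT p|triangle_measure. h (X, p))"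
    using LT.Fubini_integral[of "\<lambda>X p. h (X, p)"] hi by simp
  also have "\<dots> = tri_form UNIV F G t x"
    unfolding tri_form_def
  proof (intro Bochner_Integration.integral_cong refl)
    fix X :: "'a \<times> 'a"
    have "(LINT p|triangle_measure. h (X, p)) = c X * tri_mult (t *\<^sub>R X)"
      by (simp only: h_def split_conv integral_mult_right_zero tri_mult_def)
    then show "(LINT p|triangle_measure. h (X, p)) = F (fst X) * G (snd X) * (indicator UNIV X * tri_mult (t *\<^sub>R X)) * cis (2 * pi * (x \<bullet> (fst X + snd X)))"
      by (simp add: c_def mult_ac)
  qed
  finally show ?thesis .
qed

lemma triangle_avg_mollify_tendsto:
  fixes f g :: "'a::euclidean_space \<Rightarrow> complex"
  assumes f: "integrable lborel f" "continuous_on UNIV f" "\<And>x. cmod (f x) \<le> B"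
    and g: "integrable lborel g" "continuous_on UNIV g" "\<And>x. cmod (g x) \<le> B'"
  shows "(\<lambda>n. tri_form UNIV (mollified_fourier n f) (mollified_fourier n g) t x) \<longlonglongrightarrow> triangle_avg t f g x"
proof -
  interpret T: finite_measure "triangle_measure :: ('a \<times> 'a) measure" by (rule finite_triangle_measure)
  have [measurable]: "f \<in> borel_measurable borel" "g \<in> borel_measurable borel" using f(1) g(1) by auto
  have mm [measurable]: "mollify n f \<in> borel_measurable borel" "mollify n g \<in> borel_measurable borel" for n
    unfolding mollify_def[abs_def] mollified_fourier_def by measurable
  have "(\<lambda>n. LINT p|triangle_measure. mollify n f (x - t *\<^sub>R fst p) * mollify n g (x - t *\<^sub>R snd p)) \<longlonglongrightarrow>
      (LINT p|triangle_measure. f (x - t *\<^sub>R fst p) * g (x - t *\<^sub>R snd p))"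
  proof (rule integral_dominated_convergence[where w = "\<lambda>_. B * B'"])
    show "AE p in triangle_measure. (\<lambda>n. mollify n f (x - t *\<^sub>R fst p) * mollify n g (x - t *\<^sub>R snd p)) \<longlonglongrightarrow> f (x - t *\<^sub>R fst p) * g (x - t *\<^sub>R snd p)"
      by (intro always_eventually allI tendsto_mult mollify_bounds(2)[OF f] mollify_bounds(2)[OF g])
    show "AE p in triangle_measure. norm (mollify n f (x - t *\<^sub>R fst p) * mollify n g (x - t *\<^sub>R snd p)) \<le> B * B'" for n
      unfolding norm_mult
      by (intro always_eventually allI mult_mono mollify_bounds(1)[OF f] mollify_bounds(1)[OF g] order_trans[OF norm_ge_zero f(3)]) auto
  qed simp_all
  moreover have "(LINT p|triangle_measure. mollify n f (x - t *\<^sub>R fst p) * mollify n g (x - t *\<^sub>R snd p)) =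
      tri_form UNIV (mollified_fourier n f) (mollified_fourier n g) t x" for n
    using triangle_avg_eq_tri_form[OF mollified_fourier_integrable[OF f(1)] mollified_fourier_integrable[OF g(1)], of t n n x]
    by (simp add: triangle_avg_def split_beta' mollify_def)
  ultimately show ?thesis by (simp add: triangle_avg_def split_beta')
qed

lemma weighted_norm2_mono:
  assumes "\<And>\<xi>. cmod (F \<xi>) \<le> cmod (G \<xi>)"
  shows "weighted_norm2 s F \<le> weighted_norm2 s G"
  unfolding weighted_norm2_def norm_mult
  by (intro nn_integral_mono power_mono ennreal_leI mult_left_mono assms) auto

lemma test_function_bounded_integrable:
  fixes f :: "'a::euclidean_space \<Rightarrow> complex"
  assumes "test_function f"
  shows "continuous_on UNIV f" "integrable lborel f" "\<exists>B. \<forall>x. cmod (f x) \<le> B"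
proof -
  have "C_k 0 f"
    using assms unfolding test_function_def by blast
  then show cont: "continuous_on UNIV f" by simp
  define K where "K = closure {x. f x \<noteq> 0}"
  have comp: "compact K"
    using assms unfolding test_function_def K_def by blast
  have out: "f x = 0" if "x \<notin> K" for x
    using that subsetD[OF closure_subset, of x "{x. f x \<noteq> 0}"] unfolding K_def by blast
  have "compact (f ` K)"
    by (intro compact_continuous_image comp continuous_on_subset[OF cont]) simp
  then obtain B where B: "\<And>x. x \<in> K \<Longrightarrow> cmod (f x) \<le> B"
    using compact_imp_bounded[of "f ` K"] unfolding bounded_iff by blast
  have "cmod (f x) \<le> max B 0" for x
    using B[of x] out[of x] by (cases "x \<in> K") auto
  then show "\<exists>B. \<forall>x. cmod (f x) \<le> B" by blast
  have "integrable lborel (\<lambda>x. indicator K x *\<^sub>R f x)"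
    by (rule borel_integrable_compact[OF comp continuous_on_subset[OF cont]]) simp
  moreover have "(\<lambda>x. indicator K x *\<^sub>R f x) = f"
    using out by (auto simp: indicator_def)
  ultimately show "integrable lborel f" by simp
qed

text \<open>The square of a supremum is a double supremum of products, and each product is at most
  the larger of the two squares.\<close>

lemma ennreal_SUP_square_le:
  fixes a :: "'b \<Rightarrow> ennreal"
  assumes "\<And>t. t \<in> E \<Longrightarrow> (a t)\<^sup>2 \<le> M"
  shows "(SUP t\<in>E. a t)\<^sup>2 \<le> M"
proof -
  have "a t * a s \<le> M" if "t \<in> E" "s \<in> E" for s t
  proof (cases "a t \<le> a s")
    case True
    then have "a t * a s \<le> (a s)\<^sup>2" by (simp add: power2_eq_square mult_right_mono)
    then show ?thesis using assms[OF that(2)] by simp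
  next
    case False
    then have "a t * a s \<le> (a t)\<^sup>2" by (simp add: power2_eq_square mult_left_mono)
    then show ?thesis using assms[OF that(1)] by simp
  qed
  then show ?thesis
    by (simp add: power2_eq_square SUP_mult_left_ennreal SUP_mult_right_ennreal SUP_le_iff)
qed

text \<open>The case distinction of \<open>L2_norm\<close> isolated as a function on
  \<open>ennreal\<close>, so that it can be used as monotone and multiplicative.\<close>

definition ennreal_sqrt :: "ennreal \<Rightarrow> ennreal" where
  "ennreal_sqrt I = (if I = \<infinity> then \<infinity> else ennreal (sqrt (enn2real I)))"

lemma ennreal_sqrt_mono: "x \<le> y \<Longrightarrow> ennreal_sqrt x \<le> ennreal_sqrt y"
  by (auto simp: ennreal_sqrt_def top_unique less_top intro!: ennreal_leI enn2real_mono)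

lemma ennreal_sqrt_mult: "ennreal_sqrt (x * y) = ennreal_sqrt x * ennreal_sqrt y"
proof (cases x; cases y)
  fix a b :: real assume "x = ennreal a" "0 \<le> a" "y = ennreal b" "0 \<le> b"
  then show ?thesis
    by (simp add: ennreal_sqrt_def ennreal_mult[symmetric] real_sqrt_mult)
qed (auto simp: ennreal_sqrt_def ennreal_mult_top ennreal_top_mult)

lemma ennreal_sqrt_ennreal: "0 \<le> c \<Longrightarrow> ennreal_sqrt (ennreal c) = ennreal (sqrt c)"
  by (simp add: ennreal_sqrt_def)

lemma L2_norm_eq_sqrt: "L2_norm h = ennreal_sqrt (\<integral>\<^sup>+ x. (h x)\<^sup>2 \<partial>lborel)"
  by (simp add: L2_norm_def ennreal_sqrt_def Let_def)

lemma sobolev_norm_eq: "sobolev_norm (- s) f = ennreal_sqrt (weighted_norm2 s (fourier f))"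
  unfolding sobolev_norm_def L2_norm_eq_sqrt weighted_norm2_def ..

text \<open>The majorants for the mollified functions have integrals bounded independently of n, and
  their lower limit dominates the squared maximal function because the mollified averages converge
  for every t and x. Fatou's lemma finishes, with a constant that does not depend on E.\<close>

lemma triangle_max_bound:
  assumes dim: "DIM('a::euclidean_space) \<ge> 5" and s: "s\<^sub>1 \<ge> 0" "s\<^sub>2 \<ge> 0" "s\<^sub>1 + s\<^sub>2 < (real DIM('a) - 4) / 2"
  shows "\<exists>C>0. \<forall>E f (g :: 'a \<Rightarrow> complex). E \<subseteq> {1..2} \<longrightarrow> test_function f \<longrightarrow> test_function g \<longrightarrow>
    L2_norm (triangle_max E f g) \<le> ennreal C * sobolev_norm (- s\<^sub>1) f * sobolev_norm (- s\<^sub>2) g"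
proof -
  obtain C where C: "C > 0" and bound: "\<And>F G :: 'a \<Rightarrow> complex. bounded_integrable F \<Longrightarrow> bounded_integrable G \<Longrightarrow>
    tri_form_dominated UNIV F G (ennreal C * (weighted_norm2 s\<^sub>1 F * weighted_norm2 s\<^sub>2 G))"
    using tri_form_bound[OF dim s] by blast
  show ?thesis
  proof (intro exI[of _ "sqrt C"] conjI allI impI)
    show "sqrt C > 0" using C by simp
    fix E :: "real set" and f g :: "'a \<Rightarrow> complex"
    assume E: "E \<subseteq> {1..2}" and "test_function f" "test_function g"
    then have f: "integrable lborel f" "continuous_on UNIV f" and g: "integrable lborel g" "continuous_on UNIV g"
      and B: "\<exists>B. \<forall>x. cmod (f x) \<le> B" "\<exists>B. \<forall>x. cmod (g x) \<le> B"
      using test_function_bounded_integrable by blast+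
    obtain Bf Bg where Bf: "\<And>x. cmod (f x) \<le> Bf" and Bg: "\<And>x. cmod (g x) \<le> Bg" using B by blast
    define N where "N = ennreal C * (weighted_norm2 s\<^sub>1 (fourier f) * weighted_norm2 s\<^sub>2 (fourier g))"
    define u where "u n t x = tri_form UNIV (mollified_fourier n f) (mollified_fourier n g) t x" for n t x
    have "\<exists>W\<in>borel_measurable borel. (\<forall>t\<in>{1..2}. \<forall>x. csq (u n t x) \<le> W x) \<and> (\<integral>\<^sup>+ x. W x \<partial>lborel) \<le> N" for n
    proof -
      obtain W where W: "W \<in> borel_measurable borel" "\<forall>t\<in>{1..2}. \<forall>x. csq (u n t x) \<le> W x"
        "(\<integral>\<^sup>+ x. W x \<partial>lborel) \<le> ennreal C * (weighted_norm2 s\<^sub>1 (mollified_fourier n f) * weighted_norm2 s\<^sub>2 (mollified_fourier n g))"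
        using bound[OF mollified_fourier_bounded(2)[OF f(1)] mollified_fourier_bounded(2)[OF g(1)], of n n]
        unfolding u_def tri_form_dominated_def by blast
      note W(3)
      also have "ennreal C * (weighted_norm2 s\<^sub>1 (mollified_fourier n f) * weighted_norm2 s\<^sub>2 (mollified_fourier n g)) \<le> N"
        unfolding N_def
        by (intro mult_left_mono mult_mono weighted_norm2_mono mollified_fourier_bounded(1) f g) auto
      finally show ?thesis using W(1,2) by blast
    qed
    then obtain W where Wm [measurable]: "\<And>n. W n \<in> borel_measurable borel"
      and W: "\<And>n t x. t \<in> {1..2} \<Longrightarrow> csq (u n t x) \<le> W n x"
      and WI: "\<And>n. (\<integral>\<^sup>+ x. W n x \<partial>lborel) \<le> N"
      unfolding Bex_def by metis
    \<comment> \<open>Convergence in n is used for one t at a time; the supremum over t can be taken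
      afterwards because \<open>W n x\<close> does not depend on t.\<close>
    have pt: "(triangle_max E f g x)\<^sup>2 \<le> liminf (\<lambda>n. W n x)" for x
      unfolding triangle_max_def
    proof (rule ennreal_SUP_square_le)
      fix t assume t: "t \<in> E"
      have "(\<lambda>n. u n t x) \<longlonglongrightarrow> triangle_avg t f g x"
        unfolding u_def by (rule triangle_avg_mollify_tendsto[OF f Bf g Bg])
      then have "(\<lambda>n. csq (u n t x)) \<longlonglongrightarrow> csq (triangle_avg t f g x)"
        by (intro tendsto_ennrealI tendsto_intros)
      from lim_imp_Liminf[OF trivial_limit_sequentially this]
      have "(ennreal (cmod (triangle_avg t f g x)))\<^sup>2 = liminf (\<lambda>n. csq (u n t x))"
        by (simp add: ennreal_power)
      also have "\<dots> \<le> liminf (\<lambda>n. W n x)"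
        using W E t by (intro Liminf_mono always_eventually allI) blast
      finally show "(ennreal (cmod (triangle_avg t f g x)))\<^sup>2 \<le> liminf (\<lambda>n. W n x)" .
    qed
    have "(\<integral>\<^sup>+ x. (triangle_max E f g x)\<^sup>2 \<partial>lborel) \<le> (\<integral>\<^sup>+ x. liminf (\<lambda>n. W n x) \<partial>lborel)"
      by (intro nn_integral_mono pt)
    also have "\<dots> \<le> liminf (\<lambda>n. \<integral>\<^sup>+ x. W n x \<partial>lborel)"
      by (rule nn_integral_liminf) simp
    also have "\<dots> \<le> liminf (\<lambda>n::nat. N)"
      by (intro Liminf_mono always_eventually allI WI)
    also have "\<dots> = N" by (simp add: Liminf_const)
    finally have "L2_norm (triangle_max E f g) \<le> ennreal_sqrt N"
      unfolding L2_norm_eq_sqrt by (rule ennreal_sqrt_mono)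
    also have "\<dots> = ennreal (sqrt C) * sobolev_norm (- s\<^sub>1) f * sobolev_norm (- s\<^sub>2) g"
      using C unfolding N_def ennreal_sqrt_mult sobolev_norm_eq by (simp only: ennreal_sqrt_ennreal less_imp_le mult.assoc)
    finally show "L2_norm (triangle_max E f g) \<le> ennreal (sqrt C) * sobolev_norm (- s\<^sub>1) f * sobolev_norm (- s\<^sub>2) g" .
  qed
qed

text \<open>No covering is needed here: \<^term>\<open>ln (real n) \<ge> 0\<close> for every natural \<open>n\<close>, as \<^term>\<open>ln (0::real) = 0\<close>.\<close>

lemma upper_minkowski_dim_nonneg: "0 \<le> upper_minkowski_dim E"
  unfolding upper_minkowski_dim_def
proof (rule le_Limsup)
  show "eventually (\<lambda>\<delta>. 0 \<le> ereal (ln (real (covering_number E \<delta>)) / ln (1 / \<delta>))) (at_right 0)"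
  proof (rule eventually_at_rightI[of 0 1])
    fix \<delta> :: real assume "\<delta> \<in> {0<..<1}"
    then have "ln (1 / \<delta>) \<ge> 0" by (intro ln_ge_zero) auto
    moreover have "ln (real n) \<ge> 0" for n :: nat by (cases n) auto
    ultimately show "0 \<le> ereal (ln (real (covering_number E \<delta>)) / ln (1 / \<delta>))" by simp
  qed simp
qed simp

theorem theorem1p3:
  fixes E :: "real set" and \<beta> s\<^sub>1 s\<^sub>2 :: real
  assumes "E \<noteq> {}" and "E \<subseteq> {1..2}"
    and "upper_minkowski_dim E = ereal \<beta>"
    and "real CARD('n::finite) > 4 + \<beta>"
    and "s\<^sub>1 \<ge> 0" and "s\<^sub>2 \<ge> 0"
    and "s\<^sub>1 + s\<^sub>2 < (real CARD('n) - 4 - \<beta>) / 2"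
  shows "\<exists>C::real. C > 0 \<and>
    (\<forall>f g :: real ^ 'n \<Rightarrow> complex. test_function f \<longrightarrow> test_function g \<longrightarrow>
       L2_norm (triangle_max E f g) \<le> ennreal C * sobolev_norm (- s\<^sub>1) f * sobolev_norm (- s\<^sub>2) g)"
proof -
  have \<beta>: "\<beta> \<ge> 0" using upper_minkowski_dim_nonneg[of E] assms(3) by simp
  have "real CARD('n) > 4" using \<beta> assms(4) by linarith
  \<comment> \<open>The dimension is an integer, so exceeding 4 already yields the bound 5 under
    which the derivative kernel is controlled.\<close>
  then have "DIM(real ^ 'n) \<ge> 5" by simp
  moreover have "s\<^sub>1 + s\<^sub>2 < (real DIM(real ^ 'n) - 4) / 2" using \<beta> assms(7) by (simp add: field_simps)
  ultimately obtain C where "C > 0" and "\<forall>E f (g :: real ^ 'n \<Rightarrow> complex). E \<subseteq> {1..2} \<longrightarrow> test_function f \<longrightarrow> test_function g \<longrightarrow>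
      L2_norm (triangle_max E f g) \<le> ennreal C * sobolev_norm (- s\<^sub>1) f * sobolev_norm (- s\<^sub>2) g"
    using triangle_max_bound[where 'a = "real ^ 'n", OF _ assms(5,6)] by blast
  with assms(2) show ?thesis by (intro exI[of _ C]) simp
qed

end
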